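(* Let $G$ be a countable group of isometries of a separable Gromov hyperbolic space $X$, and let $\mu$ be a non-elementary probability distribution on $G$. Then, for any basepoint $x_0 \in X$, almost every sample path $(w_n x_0)_{n \in \mathbb{N}}$ converges to a point $\omega_+ \in \partial X$. The resulting hitting measure $\nu$ (the distribution of $\omega_+$ on $\partial X$) is non-atomic, and is the unique $\mu$-stationary Borel probability measure on $\partial X$.
   Context: A Gromov hyperbolic space is a geodesic metric space $X$ for which there is $\delta \ge 0$ such that in every geodesic triangle each side is contained in a $\delta$-neighbourhood of the other two sides; $X$ is not assumed proper or locally compact. The Gromov product is $(x\cdot y)_{x_0} = \frac12(d_X(x_0,x)+d_X(x_0,y)-d_X(x,y))$. The Gromov boundary $\partial X$ is the set of equivalence classes of Gromov sequences, i.e. sequences $(x_n)$ in $X$ with $(x_m\cdot x_n)_{x_0}\to\infty$ as $\min\{m,n\}\to\infty$, where $(x_n)\sim(y_n)$ if $(x_n\cdot y_n)_{x_0}\to\infty$. The product extends to $X\cup\partial X$ by $(x\cdot y)_{x_0}=\sup\liminf_{m,n\to\infty}(x_m\cdot y_n)_{x_0}$, the supremum over sequences in $X$ with $x_m\to x$, $y_n\to y$. The topology on $X\cup\partial X$ restricts to the usual one on the open set $X$, and neighbourhoods of $\lambda\in\partial X$ are generated by the sets $\{y : (y\cdot\lambda)_{x_0}>N\}$, $N\ge 0$; $\partial X$ is metrizable. A sequence in $X$ converges to $\lambda\in\partial X$ iff it is a Gromov sequence in the class $\lambda$. Isometries of $X$ act on $\partial X$ by homeomorphisms. A group of isometries of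 $X$ is non-elementary if it contains a pair of hyperbolic (loxodromic) isometries with disjoint fixed point sets in $\partial X$. A probability measure $\mu$ on $G$ is non-elementary if the semigroup generated by its support is a non-elementary subgroup of $G$. The random walk is $w_n = g_1g_2\cdots g_n$, where the $g_i$ are independent elements of $G$ with distribution $\mu$; the sequence $(w_nx_0)_{n\in\mathbb{N}}$ is called a sample path. A Borel probability measure $\nu$ on $\partial X$ is $\mu$-stationary if $\nu(U)=\sum_{g\in G}\mu(g)\nu(g^{-1}U)$ for all Borel $U$. *)

theory Defs
  imports "HOL-Probability.Probability" "HOL-Algebra.Group"
begin

section \<open>Gromov hyperbolic spaces\<close>

definition geodesic_segment :: "'a::metric_space \<Rightarrow> 'a \<Rightarrow> 'a set \<Rightarrow> bool" where
  "geodesic_segment x y A \<longleftrightarrow>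
     (\<exists>\<gamma>. \<gamma> 0 = x \<and> \<gamma> (dist x y) = y \<and> A = \<gamma> ` {0..dist x y} \<and>
          (\<forall>s\<in>{0..dist x y}. \<forall>t\<in>{0..dist x y}. dist (\<gamma> s) (\<gamma> t) = \<bar>s - t\<bar>))"

text \<open>The space \<open>X\<close> is the whole type; the argument only serves to name that type.\<close>

definition geodesic_space :: "'a::metric_space itself \<Rightarrow> bool" where
  "geodesic_space _ \<longleftrightarrow> (\<forall>x y :: 'a. \<exists>A. geodesic_segment x y A)"

definition closed_nbhd :: "real \<Rightarrow> 'a::metric_space set \<Rightarrow> 'a set" where
  "closed_nbhd \<delta> S = (\<Union>q\<in>S. cball q \<delta>)"

definition gromov_hyperbolic :: "'a::metric_space itself \<Rightarrow> bool" where
  "gromov_hyperbolic T \<longleftrightarrow> geodesic_space T \<and>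
     (\<exists>\<delta>\<ge>0. \<forall>(x::'a) y z A B C.
        geodesic_segment x y A \<and> geodesic_segment y z B \<and> geodesic_segment z x C \<longrightarrow>
        A \<subseteq> closed_nbhd \<delta> (B \<union> C) \<and>
        B \<subseteq> closed_nbhd \<delta> (C \<union> A) \<and>
        C \<subseteq> closed_nbhd \<delta> (A \<union> B))"

definition gromov_product :: "'a::metric_space \<Rightarrow> 'a \<Rightarrow> 'a \<Rightarrow> real" where
  "gromov_product x0 x y = (dist x0 x + dist x0 y - dist x y) / 2"


section \<open>The Gromov boundary\<close>

text \<open>The product filter on pairs of indices expresses \<open>min {m, n} \<longlonglongrightarrow> \<infinity>\<close>.\<close>

definition gromov_sequence :: "'a::metric_space \<Rightarrow> (nat \<Rightarrow> 'a) \<Rightarrow> bool" where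
  "gromov_sequence x0 u \<longleftrightarrow>
     filterlim (\<lambda>(m, n). gromov_product x0 (u m) (u n)) at_top (sequentially \<times>\<^sub>F sequentially)"

definition gromov_equiv :: "'a::metric_space \<Rightarrow> ((nat \<Rightarrow> 'a) \<times> (nat \<Rightarrow> 'a)) set" where
  "gromov_equiv x0 = {(u, v). gromov_sequence x0 u \<and> gromov_sequence x0 v \<and>
     filterlim (\<lambda>n. gromov_product x0 (u n) (v n)) at_top sequentially}"

definition gromov_boundary :: "'a::metric_space \<Rightarrow> (nat \<Rightarrow> 'a) set set" where
  "gromov_boundary x0 = {u. gromov_sequence x0 u} // gromov_equiv x0"

text \<open>The basepoint is only a device: the boundary is literally the same set for all basepoints.\<close>

lemma gromov_product_basepoint:
  "gromov_product x0 x y \<le> gromov_product y0 x y + dist x0 y0"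
  using dist_triangle[of x0 x y0] dist_triangle[of x0 y y0]
  by (simp add: gromov_product_def field_simps)

lemma filterlim_gromov_product_basepoint:
  "filterlim (\<lambda>i. gromov_product x0 (f i) (g i)) at_top F \<longleftrightarrow>
   filterlim (\<lambda>i. gromov_product y0 (f i) (g i)) at_top F"
proof -
  have "filterlim (\<lambda>i. gromov_product b (f i) (g i)) at_top F"
    if "filterlim (\<lambda>i. gromov_product a (f i) (g i)) at_top F" for a b
  proof (rule filterlim_at_top_mono)
    show "filterlim (\<lambda>i. - dist a b + gromov_product a (f i) (g i)) at_top F"
      by (rule filterlim_tendsto_add_at_top[OF tendsto_const that])
    show "\<forall>\<^sub>F i in F. - dist a b + gromov_product a (f i) (g i) \<le> gromov_product b (f i) (g i)"
      using gromov_product_basepoint[of a _ _ b]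
      by (intro always_eventually) (simp add: algebra_simps)
  qed
  then show ?thesis by blast
qed

lemma gromov_sequence_basepoint: "gromov_sequence x0 u \<longleftrightarrow> gromov_sequence y0 u"
  unfolding gromov_sequence_def case_prod_unfold by (rule filterlim_gromov_product_basepoint)

lemma gromov_boundary_basepoint: "gromov_boundary x0 = gromov_boundary y0"
proof -
  have "gromov_sequence x0 = gromov_sequence y0"
    using gromov_sequence_basepoint by blast
  then show ?thesis
    unfolding gromov_boundary_def gromov_equiv_def
    by (simp add: filterlim_gromov_product_basepoint[of x0 _ _ _ y0])
qed

text \<open>\<open>X \<union> \<partial>X\<close> is the disjoint sum, with \<open>X\<close> on the left and \<open>\<partial>X\<close> on the right.\<close>

definition bordification :: "'a::metric_space \<Rightarrow> ('a + (nat \<Rightarrow> 'a) set) set" where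
  "bordification x0 = UNIV <+> gromov_boundary x0"

text \<open>Convergence of sequences in \<open>X\<close>, as it is needed to extend the Gromov product (hence prior to
  the topology on \<open>X \<union> \<partial>X\<close>): a boundary point is the set of the sequences converging to it.\<close>

fun represents :: "(nat \<Rightarrow> 'a::metric_space) \<Rightarrow> 'a + (nat \<Rightarrow> 'a) set \<Rightarrow> bool" where
  "represents u (Inl x) \<longleftrightarrow> u \<longlonglongrightarrow> x"
| "represents u (Inr \<xi>) \<longleftrightarrow> u \<in> \<xi>"

definition gromov_product_ext ::
  "'a::metric_space \<Rightarrow> 'a + (nat \<Rightarrow> 'a) set \<Rightarrow> 'a + (nat \<Rightarrow> 'a) set \<Rightarrow> ereal" where
  "gromov_product_ext x0 p q =
     (SUP (u, v) \<in> {(u, v). represents u p \<and> represents v q}.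
        Liminf (sequentially \<times>\<^sub>F sequentially) (\<lambda>(m, n). ereal (gromov_product x0 (u m) (v n))))"

definition bordification_topology :: "'a::metric_space \<Rightarrow> ('a + (nat \<Rightarrow> 'a) set) topology" where
  "bordification_topology x0 = topology (\<lambda>U. U \<subseteq> bordification x0 \<and> open (Inl -` U) \<and>
     (\<forall>\<xi>. Inr \<xi> \<in> U \<longrightarrow>
        (\<exists>N\<ge>0. {p \<in> bordification x0. gromov_product_ext x0 p (Inr \<xi>) > ereal N} \<subseteq> U)))"

lemma openin_bordification_topology:
  "openin (bordification_topology x0) U \<longleftrightarrow> U \<subseteq> bordification x0 \<and> open (Inl -` U) \<and>
     (\<forall>\<xi>. Inr \<xi> \<in> U \<longrightarrow>
        (\<exists>N\<ge>0. {p \<in> bordification x0. gromov_product_ext x0 p (Inr \<xi>) > ereal N} \<subseteq> U))"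
proof -
  define V where "V \<xi> N = {p \<in> bordification x0. gromov_product_ext x0 p (Inr \<xi>) > ereal N}" for \<xi> N
  define P where "P U \<longleftrightarrow> U \<subseteq> bordification x0 \<and> open (Inl -` U) \<and>
     (\<forall>\<xi>. Inr \<xi> \<in> U \<longrightarrow> (\<exists>N\<ge>0. V \<xi> N \<subseteq> U))" for U
  have V_mono: "V \<xi> N \<subseteq> V \<xi> M" if "M \<le> N" for \<xi> M N
    unfolding V_def using that by (auto intro: le_less_trans[of "ereal M" "ereal N"])
  have "P (S \<inter> T)" if S: "P S" and T: "P T" for S T
    unfolding P_def
  proof (intro conjI allI impI)
    show "S \<inter> T \<subseteq> bordification x0"
      using S unfolding P_def by blast
    have "open (Inl -` S)" "open (Inl -` T)"
      using S T unfolding P_def by blast+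
    then show "open (Inl -` (S \<inter> T))"
      unfolding vimage_Int by (rule open_Int)
    fix \<xi> assume \<xi>: "Inr \<xi> \<in> S \<inter> T"
    obtain M where M: "M \<ge> 0" "V \<xi> M \<subseteq> S"
      using S \<xi> unfolding P_def by blast
    obtain N where N: "V \<xi> N \<subseteq> T"
      using T \<xi> unfolding P_def by blast
    have "V \<xi> (max M N) \<subseteq> S \<inter> T"
      using M(2) N V_mono[of M "max M N" \<xi>] V_mono[of N "max M N" \<xi>] by auto
    moreover have "max M N \<ge> 0"
      using M(1) by simp
    ultimately show "\<exists>N\<ge>0. V \<xi> N \<subseteq> S \<inter> T"
      by blast
  qed
  moreover have "P (\<Union>K)" if K: "\<forall>S\<in>K. P S" for K
    unfolding P_def
  proof (intro conjI allI impI)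
    show "\<Union>K \<subseteq> bordification x0"
      using K unfolding P_def by blast
    have "\<forall>S\<in>K. open (Inl -` S)"
      using K unfolding P_def by blast
    then show "open (Inl -` \<Union>K)"
      unfolding vimage_Union by (rule open_UN)
    fix \<xi> assume "Inr \<xi> \<in> \<Union>K"
    then obtain S where S: "S \<in> K" "Inr \<xi> \<in> S" by blast
    then obtain N where "N \<ge> 0" "V \<xi> N \<subseteq> S"
      using K unfolding P_def by blast
    then show "\<exists>N\<ge>0. V \<xi> N \<subseteq> \<Union>K"
      using S(1) by blast
  qed
  ultimately have "istopology P" unfolding istopology_def by blast
  then have "openin (topology P) U = P U" by simp
  then show ?thesis
    unfolding bordification_topology_def P_def[abs_def] V_def .
qed

definition boundary_topology :: "'a::metric_space \<Rightarrow> (nat \<Rightarrow> 'a) set topology" where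
  "boundary_topology x0 = pullback_topology (gromov_boundary x0) Inr (bordification_topology x0)"

definition boundary_borel :: "'a::metric_space \<Rightarrow> (nat \<Rightarrow> 'a) set measure" where
  "boundary_borel x0 = sigma (gromov_boundary x0) {U. openin (boundary_topology x0) U}"


section \<open>Groups of isometries\<close>

definition isometry :: "('a::metric_space \<Rightarrow> 'a) \<Rightarrow> bool" where
  "isometry g \<longleftrightarrow> surj g \<and> (\<forall>x y. dist (g x) (g y) = dist x y)"

definition isometry_group :: "('a::metric_space \<Rightarrow> 'a) monoid" where
  "isometry_group = \<lparr>carrier = {g. isometry g}, monoid.mult = (\<circ>), one = id\<rparr>"

lemma group_isometry_group: "group isometry_group"
proof (rule groupI)
  fix g :: "'a \<Rightarrow> 'a" assume "g \<in> carrier isometry_group"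
  then have surj: "surj g" and d: "dist (g x) (g y) = dist x y" for x y
    by (auto simp: isometry_group_def isometry_def)
  have "inj g"
    using d by (intro injI) (metis dist_eq_0_iff)
  define h where "h = inv_into UNIV g"
  have gh: "g (h x) = x" for x
    using surj by (simp add: h_def surj_f_inv_f)
  have hg: "h (g x) = x" for x
    using \<open>inj g\<close> by (simp add: h_def)
  have "isometry h"
    unfolding isometry_def using d[of "h _" "h _", unfolded gh] surjI[of h g, OF hg] by simp
  moreover have "h \<circ> g = id"
    by (simp add: fun_eq_iff hg)
  ultimately show "\<exists>y\<in>carrier isometry_group. y \<otimes>\<^bsub>isometry_group\<^esub> g = \<one>\<^bsub>isometry_group\<^esub>"
    unfolding isometry_group_def by auto
next
  fix g h :: "'a \<Rightarrow> 'a"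
  assume "g \<in> carrier isometry_group" "h \<in> carrier isometry_group"
  then show "g \<otimes>\<^bsub>isometry_group\<^esub> h \<in> carrier isometry_group"
    using comp_surj[of h g] by (simp add: isometry_group_def isometry_def)
qed (simp_all add: isometry_group_def isometry_def comp_assoc)

text \<open>The action on the boundary: the class of \<open>(x\<^sub>n)\<close> goes to that of \<open>(g x\<^sub>n)\<close>; for an isometry
  \<open>g\<close> the elementwise image of a class is again a full class.\<close>

definition boundary_action :: "('a \<Rightarrow> 'a) \<Rightarrow> (nat \<Rightarrow> 'a) set \<Rightarrow> (nat \<Rightarrow> 'a) set" where
  "boundary_action g \<xi> = (\<lambda>u. g \<circ> u) ` \<xi>"

definition boundary_fixed_points :: "'a::metric_space \<Rightarrow> ('a \<Rightarrow> 'a) \<Rightarrow> (nat \<Rightarrow> 'a) set set" where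
  "boundary_fixed_points x0 g = {\<xi> \<in> gromov_boundary x0. boundary_action g \<xi> = \<xi>}"

text \<open>Positive translation length.\<close>

definition loxodromic :: "('a::metric_space \<Rightarrow> 'a) \<Rightarrow> bool" where
  "loxodromic g \<longleftrightarrow> isometry g \<and>
     (\<exists>\<tau>>0. \<forall>x. (\<lambda>n. dist x ((g ^^ n) x) / real n) \<longlonglongrightarrow> \<tau>)"

definition non_elementary :: "'a::metric_space \<Rightarrow> ('a \<Rightarrow> 'a) set \<Rightarrow> bool" where
  "non_elementary x0 H \<longleftrightarrow> (\<exists>g\<in>H. \<exists>h\<in>H. loxodromic g \<and> loxodromic h \<and>
     boundary_fixed_points x0 g \<inter> boundary_fixed_points x0 h = {})"

inductive_set generated_semigroup :: "('a \<Rightarrow> 'a) set \<Rightarrow> ('a \<Rightarrow> 'a) set" for S where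
  incl: "g \<in> S \<Longrightarrow> g \<in> generated_semigroup S"
| comp: "g \<in> generated_semigroup S \<Longrightarrow> h \<in> generated_semigroup S \<Longrightarrow> g \<circ> h \<in> generated_semigroup S"

definition non_elementary_distribution ::
  "'a::metric_space \<Rightarrow> ('a \<Rightarrow> 'a) set \<Rightarrow> ('a \<Rightarrow> 'a) pmf \<Rightarrow> bool" where
  "non_elementary_distribution x0 G \<mu> \<longleftrightarrow>
     subgroup (generated_semigroup (set_pmf \<mu>)) (isometry_group\<lparr>carrier := G\<rparr>) \<and>
     non_elementary x0 (generated_semigroup (set_pmf \<mu>))"


section \<open>Random walks and stationary measures\<close>

primrec random_walk :: "(nat \<Rightarrow> 'w \<Rightarrow> 'a \<Rightarrow> 'a) \<Rightarrow> nat \<Rightarrow> 'w \<Rightarrow> 'a \<Rightarrow> 'a" where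
  "random_walk g 0 \<omega> = id"
| "random_walk g (Suc n) \<omega> = random_walk g n \<omega> \<circ> g (Suc n) \<omega>"

definition borel_probability_on_boundary ::
  "'a::metric_space \<Rightarrow> (nat \<Rightarrow> 'a) set measure \<Rightarrow> bool" where
  "borel_probability_on_boundary x0 \<nu> \<longleftrightarrow> prob_space \<nu> \<and> sets \<nu> = sets (boundary_borel x0)"

text \<open>The set \<open>g\<^sup>-\<^sup>1 U\<close> is written as the preimage of \<open>U\<close> in \<open>\<partial>X\<close>.\<close>

definition stationary ::
  "'a::metric_space \<Rightarrow> ('a \<Rightarrow> 'a) set \<Rightarrow> ('a \<Rightarrow> 'a) pmf \<Rightarrow> (nat \<Rightarrow> 'a) set measure \<Rightarrow> bool" where
  "stationary x0 G \<mu> \<nu> \<longleftrightarrow> (\<forall>U\<in>sets (boundary_borel x0).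
     measure \<nu> U =
       (\<Sum>\<^sub>\<infinity>g\<in>G. pmf \<mu> g * measure \<nu> {\<xi> \<in> gromov_boundary x0. boundary_action g \<xi> \<in> U}))"

definition non_atomic :: "'b measure \<Rightarrow> bool" where
  "non_atomic \<nu> \<longleftrightarrow> (\<forall>\<xi>\<in>space \<nu>. {\<xi>} \<in> null_sets \<nu>)"

end

(* Choose a finitely additive mean L on X, a cluster point of the Cesaro averages of the laws of w_n x0; it is
   mu-stationary and takes the place of a stationary measure on a compactification. Loxodromic elements
   force L to vanish on balls. Non-elementarity together with Ramsey's theorem forces the L-mass of the
   shadows {x : (z.x) >= R} to tend to 0 as R grows, uniformly in z. For fixed u = w_n the function
   H(v) = L {q : (u x0 . v q) >= K} is harmonic in v. It is close to 1 at v = u if u x0 is far from x0, and close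
   to 0 if (u x0 . v x0) is much smaller than K. Optional stopping shows that after time n the path rarely
   leaves the shadow of w_n x0, so almost every path is a Gromov sequence.

   A stationary probability measure nu' on the boundary has no atoms, hence uniformly small shadows, so
   w_n nu' converges weakly to the Dirac mass at the limit point. Averaging gives nu' = nu. *)

theory Submission
  imports Defs "HOL-Library.Ramsey"
begin

section \<open>The four-point inequality\<close>

text \<open>Nothing compact is at hand, so countable additivity enters only once the limit points
  exist. The mean \<open>L\<close> is defined on all bounded functions, which makes every shadow
  measurable, but the neighbourhoods of a boundary point have no common point in \<open>X\<close>;
  the mass of a boundary point is therefore an infimum, and an inequality takes the place of
  stationarity. \<open>no_stationary_atoms\<close> is stated for weights with this inequality and so
  serves both \<open>L\<close> and genuine stationary measures. Its maximum principle yields a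
  finite set of boundary points invariant under inverses, hence periodic points of loxodromic
  elements. Loxodromy is given by translation length alone, so that a periodic point is fixed needs
  an argument of its own, with Busemann functions. Being a cluster point ties \<open>L\<close> to
  the walk: a set of zero mean is visited with small probability at some time, and one such time is
  enough. The extended product is controlled only up to additive constants; strict lower bounds are
  passed around, each rule paying a fixed loss. Comparisons of measures on the boundary are reduced
  to one inequality on open sets.\<close>

lemma geodesic_segment_dist_sum:
  assumes "geodesic_segment x y A" "p \<in> A"
  shows "dist x p + dist p y = dist x y"
proof -
  obtain \<gamma> where \<gamma>: "\<gamma> 0 = x" "\<gamma> (dist x y) = y" "A = \<gamma> ` {0..dist x y}"
    "\<forall>s\<in>{0..dist x y}. \<forall>t\<in>{0..dist x y}. dist (\<gamma> s) (\<gamma> t) = \<bar>s - t\<bar>"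
    using assms(1) unfolding geodesic_segment_def by blast
  obtain t where t: "t \<in> {0..dist x y}" "p = \<gamma> t"
    using assms(2) \<gamma>(3) by blast
  have "dist x p = t" "dist p y = dist x y - t"
    using \<gamma>(4)[rule_format, of 0 t] \<gamma>(4)[rule_format, of t "dist x y"] t \<gamma>(1,2) by auto
  then show ?thesis by simp
qed

text \<open>Triangle inequalities from \<open>w\<close> to both endpoints through \<open>p\<close>.
  This half of the comparison between the product and the distance to a segment holds in every
  metric space.\<close>

lemma gromov_product_le_dist_segment:
  assumes "geodesic_segment x y A" "p \<in> A"
  shows "gromov_product w x y \<le> dist w p"
  using geodesic_segment_dist_sum[OF assms] dist_triangle[of w x p] dist_triangle[of w y p]
  by (simp add: gromov_product_def dist_commute)

text \<open>The side \<open>[x, y]\<close> is connected and covered by the neighbourhoods of the two other sides, so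
  some point of it is close to both of them.\<close>

lemma ex_near_both_sides:
  assumes A: "geodesic_segment x y A" and x: "x \<in> B" and y: "y \<in> C" and "\<delta> \<ge> 0"
    and cov: "A \<subseteq> closed_nbhd \<delta> (B \<union> C)"
  shows "\<exists>p\<in>A. (\<exists>b\<in>B. dist p b \<le> \<delta> + 1) \<and> (\<exists>c\<in>C. dist p c \<le> \<delta> + 1)"
proof -
  obtain \<gamma> where \<gamma>: "\<gamma> 0 = x" "\<gamma> (dist x y) = y" "A = \<gamma> ` {0..dist x y}"
    "\<forall>s\<in>{0..dist x y}. \<forall>t\<in>{0..dist x y}. dist (\<gamma> s) (\<gamma> t) = \<bar>s - t\<bar>"
    using A unfolding geodesic_segment_def by blast
  define D where "D = dist x y"
  \<comment> \<open>Parameters of points near \<open>B\<close>. At the supremum \<open>t\<close> the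
    point is within 1 of a point near \<open>B\<close>, and points just beyond \<open>t\<close> must
    be near \<open>C\<close>; the 1 in the bound pays for the supremum not being attained.\<close>
  define S where "S = {t \<in> {0..D}. \<exists>b\<in>B. dist (\<gamma> t) b \<le> \<delta>}"
  have "0 \<in> S"
    using x \<open>\<delta> \<ge> 0\<close> \<gamma>(1) by (auto simp: S_def D_def intro!: bexI[of _ x])
  have bdd: "bdd_above S"
    unfolding S_def by (rule bdd_aboveI[of _ D]) auto
  define t where "t = Sup S"
  have t: "t \<in> {0..D}"
  proof -
    have "0 \<le> Sup S"
      by (rule cSup_upper[OF \<open>0 \<in> S\<close> bdd])
    moreover have "Sup S \<le> D"
      using \<open>0 \<in> S\<close> by (intro cSup_least) (auto simp: S_def)
    ultimately show ?thesis by (simp add: t_def)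
  qed
  obtain s where s: "s \<in> S" "s > t - 1"
    using less_cSupD[of S "t - 1"] \<open>0 \<in> S\<close> by (force simp: t_def)
  have st: "s \<le> t"
    using cSup_upper[OF s(1) bdd] by (simp add: t_def)
  obtain b where b: "b \<in> B" "dist (\<gamma> s) b \<le> \<delta>"
    using s(1) by (auto simp: S_def)
  have "dist (\<gamma> t) (\<gamma> s) = \<bar>t - s\<bar>"
    using \<gamma>(4) t s(1) by (auto simp: S_def D_def)
  then have tb: "dist (\<gamma> t) b \<le> \<delta> + 1"
    using dist_triangle[of "\<gamma> t" b "\<gamma> s"] b s st by linarith
  have "\<exists>c\<in>C. dist (\<gamma> t) c \<le> \<delta> + 1"
  proof (cases "t = D")
    case True
    then show ?thesis
      using \<gamma>(2) y \<open>\<delta> \<ge> 0\<close> by (intro bexI[of _ y]) (auto simp: D_def)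
  next
    case False
    \<comment> \<open>A parameter beyond \<open>t\<close> by at most 1: it lies outside
      \<open>S\<close>, so the covering puts its point near \<open>C\<close>.\<close>
    define r where "r = min D (t + 1)"
    have r: "r \<in> {0..D}" "r > t" "r \<le> t + 1"
      using False t by (auto simp: r_def)
    then have "r \<notin> S"
      using cSup_upper[OF _ bdd, of r] by (auto simp: t_def)
    moreover have "\<gamma> r \<in> closed_nbhd \<delta> (B \<union> C)"
      using cov \<gamma>(3) r by (auto simp: D_def)
    ultimately obtain c where c: "c \<in> C" "dist (\<gamma> r) c \<le> \<delta>"
      using r by (auto simp: S_def closed_nbhd_def dist_commute)
    have "dist (\<gamma> t) (\<gamma> r) = \<bar>t - r\<bar>"
      using \<gamma>(4) t r by (auto simp: D_def)
    then have "dist (\<gamma> t) c \<le> \<delta> + 1"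
      using dist_triangle[of "\<gamma> t" c "\<gamma> r"] c r by linarith
    with c show ?thesis by blast
  qed
  moreover have "\<gamma> t \<in> A"
    using t \<gamma>(3) by (auto simp: D_def)
  ultimately show ?thesis
    using tb b by blast
qed

text \<open>A point \<open>p\<close> of [x,z] close to both [w,x] and [w,z] satisfies d(w,p) \<le>
  (x.z) + 2(\<delta> + 1). Thinness of the triangle x, y, z gives a point \<open>q\<close> on [x,y]
  or [y,z] within \<delta> of \<open>p\<close>, and d(w,q) is at least the smaller of the two other
  products. The errors add up to 3\<delta> + 2.\<close>

lemma gromov_hyperbolic_four_point:
  assumes "gromov_hyperbolic TYPE('a::metric_space)"
  obtains \<delta> where "\<delta> \<ge> 0"
    "\<And>w x y z :: 'a. min (gromov_product w x y) (gromov_product w y z) - \<delta> \<le> gromov_product w x z"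
proof -
  have geo: "\<exists>A. geodesic_segment x y A" for x y :: 'a
    using assms by (simp add: gromov_hyperbolic_def geodesic_space_def)
  obtain \<delta> where \<delta>: "\<delta> \<ge> 0" and tri: "\<forall>(x::'a) y z A B C.
        geodesic_segment x y A \<and> geodesic_segment y z B \<and> geodesic_segment z x C \<longrightarrow>
        A \<subseteq> closed_nbhd \<delta> (B \<union> C) \<and>
        B \<subseteq> closed_nbhd \<delta> (C \<union> A) \<and>
        C \<subseteq> closed_nbhd \<delta> (A \<union> B)"
    using assms unfolding gromov_hyperbolic_def by (elim conjE exE) (rule that)
  have thin: "A \<subseteq> closed_nbhd \<delta> (B \<union> C)" if "geodesic_segment x y A" "geodesic_segment y z B"
    "geodesic_segment z x C" for x y z :: 'a and A B C
    using tri[rule_format, of x y A z B C] that by simp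
  have "min (gromov_product w x y) (gromov_product w y z) - (3 * \<delta> + 2) \<le> gromov_product w x z"
    for w x y z :: 'a
  proof -
    obtain A where A: "geodesic_segment x z A" using geo by blast
    obtain B where B: "geodesic_segment w x B" using geo by blast
    obtain C where C: "geodesic_segment z w C" using geo by blast
    obtain X where X: "geodesic_segment z y X" using geo by blast
    obtain Z where Z: "geodesic_segment y x Z" using geo by blast
    have ends: "u \<in> S \<and> v \<in> S" if uv: "geodesic_segment u v S" for u v :: 'a and S
    proof -
      obtain \<gamma> where \<gamma>: "\<gamma> 0 = u" "\<gamma> (dist u v) = v" "S = \<gamma> ` {0..dist u v}"
        using uv unfolding geodesic_segment_def by blast
      have "\<gamma> 0 \<in> S" "\<gamma> (dist u v) \<in> S"
        unfolding \<gamma>(3) by (auto intro!: imageI)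
      then show ?thesis
        using \<gamma>(1,2) by simp
    qed
    have "A \<subseteq> closed_nbhd \<delta> (B \<union> C)"
      using thin[OF A C B] by (simp add: Un_commute)
    then obtain p b c where p: "p \<in> A" "b \<in> B" "dist p b \<le> \<delta> + 1" "c \<in> C" "dist p c \<le> \<delta> + 1"
      using ex_near_both_sides[OF A _ _ \<delta>, of B C] ends[OF B] ends[OF C] by blast
    have "dist w b + dist b x = dist w x" "dist z c + dist c w = dist z w"
      "dist x p + dist p z = dist x z"
      using geodesic_segment_dist_sum B C A p by blast+
    moreover have "dist w p \<le> dist w b + dist p b" "dist x p \<le> dist b x + dist p b"
      "dist w p \<le> dist c w + dist p c" "dist p z \<le> dist z c + dist p c"
      using dist_triangle[of w p b] dist_triangle[of x p b] dist_triangle[of w p c]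
        dist_triangle[of p z c] by (simp_all add: dist_commute)
    ultimately have le: "dist w p \<le> gromov_product w x z + 2 * (\<delta> + 1)"
      using p by (simp add: gromov_product_def dist_commute field_simps)
    have "p \<in> closed_nbhd \<delta> (X \<union> Z)"
      using thin[OF A X Z] p by blast
    then obtain q where q: "q \<in> X \<union> Z" "dist q p \<le> \<delta>"
      by (auto simp: closed_nbhd_def)
    have "min (gromov_product w x y) (gromov_product w y z) \<le> dist w q"
      using q gromov_product_le_dist_segment[OF X, of q w] gromov_product_le_dist_segment[OF Z, of q w]
      by (auto simp: min_def gromov_product_def dist_commute add.commute)
    also have "\<dots> \<le> dist w p + \<delta>"
      using dist_triangle[of w q p] q by (simp add: dist_commute)
    finally show ?thesis using le by simp
  qed
  moreover have "3 * \<delta> + 2 \<ge> 0" using \<delta> by simp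
  ultimately show thesis using that by blast
qed

section \<open>The extended Gromov product\<close>

lemma eventually_prod_sequentially_iff:
  "eventually P (sequentially \<times>\<^sub>F sequentially) \<longleftrightarrow> (\<exists>N. \<forall>m\<ge>N. \<forall>n\<ge>N. P (m, n))"
  unfolding eventually_prod_sequentially by blast

lemma gromov_product_commute: "gromov_product w x y = gromov_product w y x"
  by (simp add: gromov_product_def dist_commute)

lemma gromov_product_nonneg: "0 \<le> gromov_product w x y"
  using dist_triangle[of x y w] by (simp add: gromov_product_def dist_commute)

lemma gromov_product_le_dist: "gromov_product w x y \<le> dist w x"
  using dist_triangle[of w y x] by (simp add: gromov_product_def)

lemma gromov_product_lipschitz: "gromov_product w x y \<le> gromov_product w x' y + dist x x'"
  using dist_triangle[of w x x'] dist_triangle[of x' y x]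
  by (simp add: gromov_product_def dist_commute field_simps)

section \<open>Isometries and the Gromov product\<close>

abbreviation ginv :: "('a \<Rightarrow> 'a) \<Rightarrow> 'a \<Rightarrow> 'a" where
  "ginv g \<equiv> inv_into UNIV g"

lemma isometryD: "isometry g \<Longrightarrow> dist (g x) (g y) = dist x y" "isometry g \<Longrightarrow> surj g"
  by (auto simp: isometry_def)

lemma isometry_inj: "isometry g \<Longrightarrow> inj g"
  by (intro injI) (metis isometryD(1) dist_eq_0_iff)

lemma isometry_inv_apply:
  assumes "isometry g"
  shows "g (ginv g x) = x" "ginv g (g x) = x"
  using isometryD(2)[OF assms] isometry_inj[OF assms] by (simp_all add: surj_f_inv_f)

lemma isometry_inv: "isometry g \<Longrightarrow> isometry (ginv g)"
  unfolding isometry_def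
  by (metis isometry_def isometry_inj inj_imp_surj_inv surj_f_inv_f)

lemma isometry_id: "isometry id"
  by (simp add: isometry_def)

lemma isometry_comp: "isometry g \<Longrightarrow> isometry h \<Longrightarrow> isometry (g \<circ> h)"
  using comp_surj[of h g] by (simp add: isometry_def)

lemma isometry_funpow: "isometry g \<Longrightarrow> isometry (g ^^ n)"
  by (induction n) (simp_all add: isometry_id isometry_comp del: id_apply)

lemma gromov_product_isometry:
  assumes "isometry g"
  shows "gromov_product w (g x) (g y) \<le> gromov_product w x y + dist w (g w)"
    and "gromov_product w x y \<le> gromov_product w (g x) (g y) + dist w (g w)"
proof -
  have "gromov_product (g w) (g x) (g y) = gromov_product w x y"
    using isometryD(1)[OF assms] by (simp add: gromov_product_def)
  then show "gromov_product w (g x) (g y) \<le> gromov_product w x y + dist w (g w)"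
    "gromov_product w x y \<le> gromov_product w (g x) (g y) + dist w (g w)"
    using gromov_product_basepoint[of w "g x" "g y" "g w"]
      gromov_product_basepoint[of "g w" "g x" "g y" w] by (simp_all add: dist_commute)
qed

text \<open>The shadow of \<open>g w\<close> seen from \<open>w\<close> is the image under \<open>g\<close> of the complement of the
  shadow of \<open>g\<^sup>-\<^sup>1 w\<close>.\<close>

lemma gromov_product_isometry_flip:
  assumes "isometry g"
  shows "gromov_product w (g x) (g w) + gromov_product w (ginv g w) x = dist w (g w)"
proof -
  have "dist (ginv g w) x = dist w (g x)" "dist w (ginv g w) = dist w (g w)"
    using isometryD(1)[OF assms, of "ginv g w" x] isometryD(1)[OF assms, of w "ginv g w"]
    by (simp_all add: isometry_inv_apply[OF assms] dist_commute)
  then show ?thesis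
    using isometryD(1)[OF assms, of x w]
    by (simp add: gromov_product_def field_simps dist_commute)
qed

text \<open>Geodesics are left behind here: from now on hyperbolicity means the four-point
  inequality.\<close>

locale hyperbolic =
  fixes x0 :: "'a::metric_space" and \<delta> :: real
  assumes \<delta>_nonneg: "\<delta> \<ge> 0"
    and four_point: "\<And>w x y z :: 'a. min (gromov_product w x y) (gromov_product w y z) - \<delta> \<le> gromov_product w x z"
begin

abbreviation gp :: "'a \<Rightarrow> 'a \<Rightarrow> real" where "gp \<equiv> gromov_product x0"
abbreviation E where "E \<equiv> gromov_product_ext x0"
abbreviation BX where "BX \<equiv> gromov_boundary x0"
abbreviation BD where "BD \<equiv> bordification x0"
abbreviation gseq where "gseq \<equiv> gromov_sequence x0"
abbreviation geq where "geq \<equiv> gromov_equiv x0"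
abbreviation bopen where "bopen \<equiv> openin (boundary_topology x0)"

lemma gp_tri: "R \<le> gp x y \<Longrightarrow> R \<le> gp y z \<Longrightarrow> R - \<delta> \<le> gp x z"
  using four_point[of x0 x y z] by (simp add: min_def split: if_splits)

lemma gp_tri_less: "R < gp x y \<Longrightarrow> R < gp y z \<Longrightarrow> R - \<delta> < gp x z"
  using four_point[of x0 x y z] by (simp add: min_def split: if_splits)

lemma gromov_sequence_iff:
  "gseq u \<longleftrightarrow> (\<forall>R. \<exists>N. \<forall>m\<ge>N. \<forall>n\<ge>N. R < gp (u m) (u n))"
  unfolding gromov_sequence_def filterlim_at_top_dense eventually_prod_sequentially_iff by simp

lemma gromov_sequenceD:
  "gseq u \<Longrightarrow> \<exists>N. \<forall>m\<ge>N. \<forall>n\<ge>N. R < gp (u m) (u n)"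
  unfolding gromov_sequence_iff by blast

text \<open>Equivalence is defined along the diagonal only; the Gromov property of \<open>u\<close>
  and the four-point inequality through \<open>u n\<close> free the two indices.\<close>

lemma gromov_equivD:
  assumes "(u, v) \<in> geq"
  shows "\<exists>N. \<forall>m\<ge>N. \<forall>n\<ge>N. R < gp (u m) (v n)"
proof -
  have u: "gseq u" and lim: "filterlim (\<lambda>n. gp (u n) (v n)) at_top sequentially"
    using assms by (auto simp: gromov_equiv_def)
  obtain N1 where N1: "\<forall>m\<ge>N1. \<forall>n\<ge>N1. R + \<delta> < gp (u m) (u n)"
    using gromov_sequenceD[OF u] by blast
  obtain N2 where N2: "\<forall>n\<ge>N2. R + \<delta> < gp (u n) (v n)"
    using lim unfolding filterlim_at_top_dense eventually_sequentially by blast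
  have "R < gp (u m) (v n)" if "m \<ge> max N1 N2" "n \<ge> max N1 N2" for m n
    using gp_tri_less[of "R + \<delta>" "u m" "u n" "v n"] N1 N2 that by simp
  then show ?thesis by blast
qed

lemma gromov_equivI:
  assumes "gseq u" "gseq v" "\<And>R. \<exists>N. \<forall>n\<ge>N. R < gp (u n) (v n)"
  shows "(u, v) \<in> geq"
  using assms by (auto simp: gromov_equiv_def filterlim_at_top_dense eventually_sequentially)

lemma equiv_gromov_equiv: "equiv {u. gseq u} (geq)"
proof (rule equivI)
  show "refl_on {u. gseq u} (geq)"
  proof (rule refl_onI)
    fix u assume "u \<in> {u. gseq u}"
    then show "(u, u) \<in> geq"
      by (intro gromov_equivI) (auto, metis gromov_sequenceD)
  qed
  show "geq \<subseteq> {u. gseq u} \<times> {u. gseq u}"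
    by (auto simp: gromov_equiv_def)
  show "sym (geq)"
    by (auto simp: sym_def gromov_equiv_def gromov_product_commute)
  show "trans (geq)"
  proof (rule transI)
    fix u v w assume uv: "(u, v) \<in> geq" and vw: "(v, w) \<in> geq"
    show "(u, w) \<in> geq"
    proof (rule gromov_equivI)
      show "gseq u" "gseq w"
        using uv vw by (auto simp: gromov_equiv_def)
      fix R
      obtain N where N: "\<forall>m\<ge>N. \<forall>n\<ge>N. R + \<delta> < gp (u m) (v n)"
        using gromov_equivD[OF uv] by blast
      obtain K where K: "\<forall>m\<ge>K. \<forall>n\<ge>K. R + \<delta> < gp (v m) (w n)"
        using gromov_equivD[OF vw] by blast
      have "R < gp (u n) (w n)" if "n \<ge> max N K" for n
        using gp_tri_less[of "R + \<delta>" "u n" "v n" "w n"] N K that by simp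
      then show "\<exists>N. \<forall>n\<ge>N. R < gp (u n) (w n)" by blast
    qed
  qed
qed

lemma boundary_gromov_sequence: "\<xi> \<in> BX \<Longrightarrow> u \<in> \<xi> \<Longrightarrow> gseq u"
  unfolding gromov_boundary_def using in_quotient_imp_subset[OF equiv_gromov_equiv] by blast

lemma boundary_equiv: "\<xi> \<in> BX \<Longrightarrow> u \<in> \<xi> \<Longrightarrow> v \<in> \<xi> \<Longrightarrow> (u, v) \<in> geq"
  unfolding gromov_boundary_def using in_quotient_imp_in_rel[OF equiv_gromov_equiv] by blast

lemma boundary_closed: "\<xi> \<in> BX \<Longrightarrow> u \<in> \<xi> \<Longrightarrow> (u, v) \<in> geq \<Longrightarrow> v \<in> \<xi>"
  unfolding gromov_boundary_def using in_quotient_imp_closed[OF equiv_gromov_equiv] by blast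

lemma boundary_eqI: "\<xi> \<in> BX \<Longrightarrow> \<eta> \<in> BX \<Longrightarrow> u \<in> \<xi> \<Longrightarrow> v \<in> \<eta> \<Longrightarrow> (u, v) \<in> geq \<Longrightarrow> \<xi> = \<eta>"
  unfolding gromov_boundary_def using quotient_eqI[OF equiv_gromov_equiv] by blast

lemma boundary_nonempty: "\<xi> \<in> BX \<Longrightarrow> \<exists>u. u \<in> \<xi>"
  unfolding gromov_boundary_def using in_quotient_imp_non_empty[OF equiv_gromov_equiv] by blast

definition seq_class :: "(nat \<Rightarrow> 'a) \<Rightarrow> (nat \<Rightarrow> 'a) set" where
  "seq_class u = geq `` {u}"

lemma seq_class:
  assumes "gseq u"
  shows "seq_class u \<in> BX" "u \<in> seq_class u"
  using assms equiv_class_self[OF equiv_gromov_equiv, of u]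
  by (auto simp: seq_class_def gromov_boundary_def intro: quotientI)

lemma represents_exists: "p \<in> BD \<Longrightarrow> \<exists>u. represents u p"
  unfolding bordification_def
proof (elim PlusE)
  fix x assume "p = Inl x"
  then show ?thesis by (intro exI[of _ "\<lambda>_. x"]) simp
next
  fix \<xi> assume "\<xi> \<in> BX" "p = Inr \<xi>"
  then show ?thesis using boundary_nonempty[of \<xi>] by auto
qed

text \<open>Two sequences with the same limit in \<open>X\<close> are eventually within distance 1,
  and two sequences of one class are linked by the four-point inequality; \<delta> + 1 covers both
  cases.\<close>

lemma represents_swap:
  assumes "p \<in> BD" "represents u p" "represents u' p"
    and "\<exists>N. \<forall>m\<ge>N. \<forall>n\<ge>N. R < gp (u m) (b n)"
  shows "\<exists>N. \<forall>m\<ge>N. \<forall>n\<ge>N. R - \<delta> - 1 < gp (u' m) (b n)"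
proof -
  obtain N where N: "\<forall>m\<ge>N. \<forall>n\<ge>N. R < gp (u m) (b n)" using assms by blast
  show ?thesis
  proof (cases p)
    case (Inl x)
    then have "u \<longlonglongrightarrow> x" "u' \<longlonglongrightarrow> x" using assms by auto
    then obtain K K' where K: "\<forall>n\<ge>K. dist (u n) x < 1/2" "\<forall>n\<ge>K'. dist (u' n) x < 1/2"
      using metric_LIMSEQ_D[of u x "1/2"] metric_LIMSEQ_D[of u' x "1/2"] by (auto simp: dist_commute)
    have "R - \<delta> - 1 < gp (u' m) (b n)" if "m \<ge> max N (max K K')" "n \<ge> max N (max K K')" for m n
    proof -
      have "dist (u m) (u' m) < 1"
        using dist_triangle_half_l[of "u m" x 1 "u' m"] K that by (simp add: dist_commute)
      moreover have "R < gp (u m) (b n)" using N that by simp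
      ultimately show ?thesis
        using gromov_product_lipschitz[of x0 "u m" "b n" "u' m"] \<delta>_nonneg by linarith
    qed
    then show ?thesis by blast
  next
    case (Inr \<xi>)
    then have "\<xi> \<in> BX" "u \<in> \<xi>" "u' \<in> \<xi>"
      using assms by (auto simp: bordification_def)
    then have "(u', u) \<in> geq" using boundary_equiv by blast
    then obtain K where K: "\<forall>m\<ge>K. \<forall>n\<ge>K. R < gp (u' m) (u n)"
      using gromov_equivD by blast
    have "R - \<delta> - 1 < gp (u' m) (b n)" if "m \<ge> max N K" "n \<ge> max N K" for m n
      using gp_tri_less[of R "u' m" "u m" "b n"] N K that by simp
    then show ?thesis by blast
  qed
qed

text \<open>Twice the loss of \<open>represents_swap\<close>: the cost of exchanging the
  representatives in both slots.\<close>

definition C0 :: real where "C0 = 2 * \<delta> + 2"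

lemma C0_pos: "C0 \<ge> 2" using \<delta>_nonneg by (simp add: C0_def)

text \<open>A strict bound below a supremum is met by one pair of representatives;
  \<open>represents_swap\<close> carries it to every other pair. This is why bounds on
  \<open>E\<close> are strict and have a real left side throughout.\<close>

lemma E_imp_gp:
  assumes "p \<in> BD" "q \<in> BD" "represents u p" "represents v q"
    and "ereal R < E p q"
  shows "\<exists>N. \<forall>m\<ge>N. \<forall>n\<ge>N. R - C0 < gp (u m) (v n)"
proof -
  obtain u' v' where u': "represents u' p" and v': "represents v' q"
    and less: "ereal R < Liminf (sequentially \<times>\<^sub>F sequentially) (\<lambda>(m, n). ereal (gp (u' m) (v' n)))"
    using assms(5) unfolding gromov_product_ext_def less_SUP_iff by auto
  have "\<forall>\<^sub>F x in sequentially \<times>\<^sub>F sequentially.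
      ereal R < (case x of (m, n) \<Rightarrow> ereal (gp (u' m) (v' n)))"
    by (rule less_LiminfD[OF less])
  then have "\<exists>N. \<forall>m\<ge>N. \<forall>n\<ge>N. R < gp (u' m) (v' n)"
    unfolding eventually_prod_sequentially_iff by simp
  then have "\<exists>N. \<forall>m\<ge>N. \<forall>n\<ge>N. R - \<delta> - 1 < gp (u m) (v' n)"
    by (rule represents_swap[OF assms(1) u' assms(3)])
  then have "\<exists>N. \<forall>m\<ge>N. \<forall>n\<ge>N. R - \<delta> - 1 < gp (v' m) (u n)"
    by (subst gromov_product_commute) blast
  then have "\<exists>N. \<forall>m\<ge>N. \<forall>n\<ge>N. R - \<delta> - 1 - \<delta> - 1 < gp (v m) (u n)"
    by (rule represents_swap[OF assms(2) v' assms(4)])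
  moreover have "R - \<delta> - 1 - \<delta> - 1 = R - C0" by (simp add: C0_def)
  ultimately have "\<exists>N. \<forall>m\<ge>N. \<forall>n\<ge>N. R - C0 < gp (v m) (u n)" by metis
  then show ?thesis
    by (subst gromov_product_commute) blast
qed

lemma gp_imp_E_ge:
  assumes "represents u p" "represents v q" "\<exists>N. \<forall>m\<ge>N. \<forall>n\<ge>N. R \<le> gp (u m) (v n)"
  shows "ereal R \<le> E p q"
proof -
  have "ereal R \<le> Liminf (sequentially \<times>\<^sub>F sequentially) (\<lambda>(m, n). ereal (gp (u m) (v n)))"
    using assms(3) by (intro Liminf_bounded) (simp add: eventually_prod_sequentially_iff)
  also have "\<dots> \<le> E p q"
    unfolding gromov_product_ext_def using assms by (intro SUP_upper2[of "(u, v)"]) auto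
  finally show ?thesis .
qed

lemma gp_imp_E:
  assumes "represents u p" "represents v q" "\<exists>N. \<forall>m\<ge>N. \<forall>n\<ge>N. R' \<le> gp (u m) (v n)" "R < R'"
  shows "ereal R < E p q"
  using gp_imp_E_ge[OF assms(1-3)] assms(4) by (meson less_ereal.simps(1) less_le_trans)

lemma Inl_bordification [simp]: "Inl x \<in> BD"
  and Inr_bordification [simp]: "Inr \<xi> \<in> BD \<longleftrightarrow> \<xi> \<in> BX"
  by (auto simp: bordification_def)

text \<open>One constant, not meant to be sharp, that covers the loss in each of the rules
  \<open>E_commute\<close>, \<open>E_tri\<close>, \<open>E_act\<close> and
  \<open>E_act_flip\<close>.\<close>

definition C1 :: real where "C1 = 2 * C0 + \<delta> + 1"

lemma C1_ge: "C1 \<ge> C0 + 1" "C1 \<ge> 1" "C1 \<ge> 0"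
  using C0_pos \<delta>_nonneg by (auto simp: C1_def)

lemma E_commute:
  assumes "p \<in> BD" "q \<in> BD" "ereal R < E p q"
  shows "ereal (R - C1) < E q p"
proof -
  obtain u v where uv: "represents u p" "represents v q"
    using assms represents_exists by blast
  then obtain N where N: "\<forall>m\<ge>N. \<forall>n\<ge>N. R - C0 < gp (u m) (v n)"
    using E_imp_gp assms by blast
  have "\<exists>N. \<forall>m\<ge>N. \<forall>n\<ge>N. R - C0 \<le> gp (v m) (u n)"
    using N by (subst gromov_product_commute) (auto intro!: exI[of _ N] less_imp_le)
  then show ?thesis
    by (rule gp_imp_E[OF uv(2,1)]) (use C1_ge in simp)
qed

lemma E_tri:
  assumes "p \<in> BD" "q \<in> BD" "r \<in> BD"
    and "ereal R < E p q" "ereal R < E q r"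
  shows "ereal (R - C1) < E p r"
proof -
  obtain u v w where uvw: "represents u p" "represents v q" "represents w r"
    using assms represents_exists by metis
  obtain N where N: "\<forall>m\<ge>N. \<forall>n\<ge>N. R - C0 < gp (u m) (v n)"
    using E_imp_gp[OF assms(1,2) uvw(1,2) assms(4)] by blast
  obtain K where K: "\<forall>m\<ge>K. \<forall>n\<ge>K. R - C0 < gp (v m) (w n)"
    using E_imp_gp[OF assms(2,3) uvw(2,3) assms(5)] by blast
  have "R - C0 - \<delta> \<le> gp (u m) (w n)" if "m \<ge> max N K" "n \<ge> max N K" for m n
    using gp_tri[of "R - C0" "u m" "v m" "w n"] N K that by (simp add: less_imp_le)
  then have "\<exists>N. \<forall>m\<ge>N. \<forall>n\<ge>N. R - C0 - \<delta> \<le> gp (u m) (w n)" by blast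
  then show ?thesis
    by (rule gp_imp_E[OF uvw(1,3)]) (use C0_pos in \<open>simp add: C1_def\<close>)
qed

lemma E_Inl_Inl:
  "R < gp x y \<Longrightarrow> ereal R < E (Inl x) (Inl y)"
  "ereal R < E (Inl x) (Inl y) \<Longrightarrow> R - C0 < gp x y"
proof -
  show "ereal R < E (Inl x) (Inl y)" if "R < gp x y"
    by (rule gp_imp_E[of "\<lambda>_. x" _ "\<lambda>_. y" _ "gp x y"]) (use that in auto)
  show "R - C0 < gp x y" if "ereal R < E (Inl x) (Inl y)"
    using E_imp_gp[of "Inl x" "Inl y" "\<lambda>_. x" "\<lambda>_. y", OF _ _ _ _ that] by auto
qed

lemma E_Inl_Inr:
  assumes "\<xi> \<in> BX" "u \<in> \<xi>"
  shows "ereal R < E (Inl x) (Inr \<xi>) \<Longrightarrow> \<exists>N. \<forall>n\<ge>N. R - C0 < gp x (u n)"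
    and "\<exists>N. \<forall>n\<ge>N. R < gp x (u n) \<Longrightarrow> ereal (R - 1) < E (Inl x) (Inr \<xi>)"
proof -
  show "\<exists>N. \<forall>n\<ge>N. R - C0 < gp x (u n)" if "ereal R < E (Inl x) (Inr \<xi>)"
    using E_imp_gp[of "Inl x" "Inr \<xi>" "\<lambda>_. x" u, OF _ _ _ _ that] assms by auto
  show "ereal (R - 1) < E (Inl x) (Inr \<xi>)" if "\<exists>N. \<forall>n\<ge>N. R < gp x (u n)"
    by (rule gp_imp_E[of "\<lambda>_. x" _ u _ R]) (use that assms in \<open>auto intro: less_imp_le\<close>)
qed

lemma E_seq_tendsto:
  assumes "\<xi> \<in> BX" "u \<in> \<xi>"
  shows "\<exists>N. \<forall>n\<ge>N. ereal R < E (Inl (u n)) (Inr \<xi>)"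
proof -
  obtain N where N: "\<forall>m\<ge>N. \<forall>n\<ge>N. R + 1 < gp (u m) (u n)"
    using gromov_sequenceD[OF boundary_gromov_sequence[OF assms]] by blast
  have "ereal R < E (Inl (u n)) (Inr \<xi>)" if "n \<ge> N" for n
    using E_Inl_Inr(2)[OF assms, of "R + 1" "u n"] N that by auto
  then show ?thesis by blast
qed

lemma E_self: "\<xi> \<in> BX \<Longrightarrow> ereal R < E (Inr \<xi>) (Inr \<xi>)"
proof -
  assume \<xi>: "\<xi> \<in> BX"
  obtain u where u: "u \<in> \<xi>" using boundary_nonempty[OF \<xi>] by blast
  obtain N where N: "\<forall>m\<ge>N. \<forall>n\<ge>N. R + 1 < gp (u m) (u n)"
    using gromov_sequenceD[OF boundary_gromov_sequence[OF \<xi> u]] by blast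
  then show ?thesis
    using u by (intro gp_imp_E[of u _ u _ "R + 1"]) (auto intro!: exI[of _ N] less_imp_le)
qed

lemma E_eqI:
  assumes "\<xi> \<in> BX" "\<eta> \<in> BX" "\<And>R. ereal R < E (Inr \<xi>) (Inr \<eta>)"
  shows "\<xi> = \<eta>"
proof -
  obtain u v where uv: "u \<in> \<xi>" "v \<in> \<eta>" using boundary_nonempty assms by blast
  have "\<exists>N. \<forall>m\<ge>N. \<forall>n\<ge>N. (R + C0) - C0 < gp (u m) (v n)" for R
    using uv assms by (intro E_imp_gp[of "Inr \<xi>" "Inr \<eta>"]) auto
  then have *: "\<exists>N. \<forall>m\<ge>N. \<forall>n\<ge>N. R < gp (u m) (v n)" for R by simp
  have "\<exists>N. \<forall>n\<ge>N. R < gp (u n) (v n)" for R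
    using *[of R] by blast
  then have "(u, v) \<in> geq"
    using uv assms boundary_gromov_sequence by (intro gromov_equivI) auto
  then show ?thesis using boundary_eqI uv assms by blast
qed

lemma E_distinct:
  assumes "\<xi> \<in> BX" "\<eta> \<in> BX" "\<xi> \<noteq> \<eta>"
  shows "\<exists>R. \<not> ereal R < E (Inr \<xi>) (Inr \<eta>)"
  using E_eqI assms by blast

text \<open>The threshold for \<open>k\<close> may depend on \<open>n\<close>, which is all that
  estimates at a fixed point of \<open>X\<close> provide. Any two terms of \<open>v\<close> are
  compared through one \<open>u k\<close> that is late enough for both.\<close>

lemma boundary_memI:
  assumes "\<xi> \<in> BX" "u \<in> \<xi>" "\<And>R. \<exists>N. \<forall>n\<ge>N. \<exists>K. \<forall>k\<ge>K. R < gp (v n) (u k)"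
  shows "v \<in> \<xi>"
proof -
  have gu: "gseq u" using assms boundary_gromov_sequence by blast
  have "gseq v"
    unfolding gromov_sequence_iff
  proof
    fix R
    obtain N where N: "\<forall>n\<ge>N. \<exists>K. \<forall>k\<ge>K. R + \<delta> < gp (v n) (u k)"
      using assms(3) by blast
    have "R < gp (v m) (v n)" if mn: "m \<ge> N" "n \<ge> N" for m n
    proof -
      obtain K K' where "\<forall>k\<ge>K. R + \<delta> < gp (v m) (u k)" "\<forall>k\<ge>K'. R + \<delta> < gp (v n) (u k)"
        using N mn by blast
      then have "R + \<delta> < gp (v m) (u (max K K'))" "R + \<delta> < gp (u (max K K')) (v n)"
        by (simp, subst gromov_product_commute, simp)
      then show ?thesis using gp_tri_less by force
    qed
    then show "\<exists>N. \<forall>m\<ge>N. \<forall>n\<ge>N. R < gp (v m) (v n)" by blast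
  qed
  moreover have "\<exists>N. \<forall>n\<ge>N. R < gp (u n) (v n)" for R
  proof -
    obtain N where N: "\<forall>n\<ge>N. \<exists>K. \<forall>k\<ge>K. R + \<delta> < gp (v n) (u k)"
      using assms(3) by blast
    obtain L where L: "\<forall>m\<ge>L. \<forall>n\<ge>L. R + \<delta> < gp (u m) (u n)"
      using gromov_sequenceD[OF gu] by blast
    have "R < gp (u n) (v n)" if n: "n \<ge> max N L" for n
    proof -
      obtain K where "\<forall>k\<ge>K. R + \<delta> < gp (v n) (u k)"
        using N n by force
      then have "R + \<delta> < gp (u (max K L)) (v n)" "R + \<delta> < gp (u n) (u (max K L))"
        using L n by (subst gromov_product_commute, simp, simp)
      then show ?thesis using gp_tri_less by force
    qed
    then show ?thesis by blast
  qed
  ultimately have "(u, v) \<in> geq"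
    using gu by (intro gromov_equivI) auto
  then show ?thesis using assms boundary_closed by blast
qed

lemma boundary_memI_bounded:
  assumes "\<xi> \<in> BX" "u \<in> \<xi>" "\<And>n. dist (u n) (v n) \<le> D"
  shows "v \<in> \<xi>"
proof (rule boundary_memI[OF assms(1,2)])
  fix R
  obtain N where N: "\<forall>m\<ge>N. \<forall>n\<ge>N. R + D < gp (u m) (u n)"
    using gromov_sequenceD[OF boundary_gromov_sequence[OF assms(1,2)]] by blast
  have "R < gp (v n) (u k)" if "n \<ge> N" "k \<ge> N" for n k
    using N that gromov_product_lipschitz[of x0 "u n" "u k" "v n"] assms(3)[of n] by force
  then show "\<exists>N. \<forall>n\<ge>N. \<exists>K. \<forall>k\<ge>K. R < gp (v n) (u k)" by blast
qed

subsection \<open>The action of isometries\<close>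

abbreviation act :: "('a \<Rightarrow> 'a) \<Rightarrow> 'a + (nat \<Rightarrow> 'a) set \<Rightarrow> 'a + (nat \<Rightarrow> 'a) set" where
  "act g \<equiv> map_sum g (boundary_action g)"

lemma gromov_equiv_isometry:
  assumes "isometry g" "(u, v) \<in> geq"
  shows "(g \<circ> u, g \<circ> v) \<in> geq"
proof -
  have shift: "R < gp (g x) (g y)" if "R + dist x0 (g x0) < gp x y" for R x y
    using gromov_product_isometry(2)[OF assms(1), of x0 x y] that by linarith
  have seq: "gseq (g \<circ> w)" if "gseq w" for w
    unfolding gromov_sequence_iff
  proof
    fix R show "\<exists>N. \<forall>m\<ge>N. \<forall>n\<ge>N. R < gp ((g \<circ> w) m) ((g \<circ> w) n)"
      using gromov_sequenceD[OF that, of "R + dist x0 (g x0)"] shift by (metis comp_apply)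
  qed
  have "\<exists>N. \<forall>n\<ge>N. R < gp ((g \<circ> u) n) ((g \<circ> v) n)" for R
    using gromov_equivD[OF assms(2), of "R + dist x0 (g x0)"] shift by (metis comp_apply)
  then show ?thesis
    using assms(2) seq by (intro gromov_equivI) (auto simp: gromov_equiv_def)
qed

lemma boundary_action_id: "boundary_action id \<xi> = \<xi>"
  by (simp add: boundary_action_def)

lemma boundary_action_comp: "boundary_action (g \<circ> h) \<xi> = boundary_action g (boundary_action h \<xi>)"
  by (simp add: boundary_action_def image_image comp_assoc)

lemma isometry_inv_comp: "isometry g \<Longrightarrow> ginv g \<circ> g = id" "isometry g \<Longrightarrow> g \<circ> ginv g = id"
  by (simp_all add: isometry_inv_apply fun_eq_iff)

lemma boundary_action_inv:
  "isometry g \<Longrightarrow> boundary_action (ginv g) (boundary_action g \<xi>) = \<xi>"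
  "isometry g \<Longrightarrow> boundary_action g (boundary_action (ginv g) \<xi>) = \<xi>"
  by (simp_all add: boundary_action_comp[symmetric] isometry_inv_comp boundary_action_id)

text \<open>The image of a class is again a full class because the inverse isometry also preserves
  equivalence.\<close>

lemma boundary_action_BX:
  assumes "isometry g" "\<xi> \<in> BX"
  shows "boundary_action g \<xi> \<in> BX"
proof -
  obtain u where u: "u \<in> \<xi>" using boundary_nonempty assms by blast
  have "(u, u) \<in> geq" using boundary_equiv assms u by blast
  then have gu: "gseq (g \<circ> u)"
    using gromov_equiv_isometry[OF assms(1)] by (auto simp: gromov_equiv_def)
  have "boundary_action g \<xi> = seq_class (g \<circ> u)"
  proof (intro equalityI subsetI)
    fix w assume "w \<in> boundary_action g \<xi>"
    then obtain v where "v \<in> \<xi>" "w = g \<circ> v" by (auto simp: boundary_action_def)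
    then show "w \<in> seq_class (g \<circ> u)"
      using gromov_equiv_isometry[OF assms(1) boundary_equiv[OF assms(2) u]] by (auto simp: seq_class_def)
  next
    fix w assume "w \<in> seq_class (g \<circ> u)"
    then have "(ginv g \<circ> (g \<circ> u), ginv g \<circ> w) \<in> geq"
      by (intro gromov_equiv_isometry isometry_inv assms) (simp add: seq_class_def)
    then have "(u, ginv g \<circ> w) \<in> geq"
      by (simp add: comp_assoc[symmetric] isometry_inv_comp assms)
    then have "ginv g \<circ> w \<in> \<xi>" using boundary_closed assms u by blast
    moreover have "w = g \<circ> (ginv g \<circ> w)"
      by (simp add: comp_assoc[symmetric] isometry_inv_comp assms)
    ultimately show "w \<in> boundary_action g \<xi>"
      by (auto simp: boundary_action_def)
  qed
  then show ?thesis using seq_class(1)[OF gu] by simp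
qed

lemma represents_act:
  assumes "isometry g" "represents u p"
  shows "represents (g \<circ> u) (act g p)"
proof (cases p)
  case (Inl x)
  then have "u \<longlonglongrightarrow> x" using assms by simp
  then have "(\<lambda>n. g (u n)) \<longlonglongrightarrow> g x"
    by (subst (asm) tendsto_dist_iff, subst tendsto_dist_iff, subst isometryD(1)[OF assms(1)])
  then show ?thesis using Inl by (simp add: comp_def)
qed (use assms in \<open>auto simp: boundary_action_def\<close>)

text \<open>The basepoint does not move with the isometry, hence the displacement of
  \<open>x0\<close> in the loss. The rule is of use only while \<open>g\<close> stays fixed;
  \<open>E_act_flip\<close> handles isometries that move \<open>x0\<close> far.\<close>

lemma E_act:
  assumes "isometry g" "p \<in> BD" "q \<in> BD" "ereal R < E p q"
  shows "ereal (R - C1 - dist x0 (g x0)) < E (act g p) (act g q)"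
proof -
  obtain u v where uv: "represents u p" "represents v q"
    using assms represents_exists by metis
  obtain N where N: "\<forall>m\<ge>N. \<forall>n\<ge>N. R - C0 < gp (u m) (v n)"
    using E_imp_gp[OF assms(2,3) uv assms(4)] by blast
  have "R - C0 - dist x0 (g x0) \<le> gp ((g \<circ> u) m) ((g \<circ> v) n)" if "m \<ge> N" "n \<ge> N" for m n
    using N[rule_format, OF that] gromov_product_isometry(2)[OF assms(1), of x0 "u m" "v n"] by simp
  then have "\<exists>N. \<forall>m\<ge>N. \<forall>n\<ge>N. R - C0 - dist x0 (g x0) \<le> gp ((g \<circ> u) m) ((g \<circ> v) n)" by blast
  then show ?thesis
    by (rule gp_imp_E[OF represents_act[OF assms(1) uv(1)] represents_act[OF assms(1) uv(2)]])
      (use C1_ge in simp)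
qed

text \<open>Boundary version of \<open>gromov_product_isometry_flip\<close>. Lying outside the
  shadow bounds the product only for infinitely many terms of \<open>u\<close>; one late such term
  is flipped, and the Gromov property of \<open>g \<circ> u\<close> spreads the result to all late
  terms.\<close>

lemma E_act_flip:
  assumes g: "isometry g" and \<eta>: "\<eta> \<in> BX" and "\<not> ereal R < E (Inl (ginv g x0)) (Inr \<eta>)"
  shows "ereal (dist x0 (g x0) - R - C1) < E (Inl (g x0)) (Inr (boundary_action g \<eta>))"
proof -
  obtain u where u: "u \<in> \<eta>" using boundary_nonempty[OF \<eta>] by blast
  have gu: "g \<circ> u \<in> boundary_action g \<eta>" using u by (auto simp: boundary_action_def)
  have "\<not> (\<exists>N. \<forall>n\<ge>N. R + 1 < gp (ginv g x0) (u n))"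
    using E_Inl_Inr(2)[OF \<eta> u, of "R + 1"] assms(3) by auto
  then have freq: "\<forall>N. \<exists>n\<ge>N. gp (ginv g x0) (u n) \<le> R + 1"
    by (meson not_le)
  obtain N where N: "\<forall>m\<ge>N. \<forall>n\<ge>N. dist x0 (g x0) < gp ((g \<circ> u) m) ((g \<circ> u) n)"
    using gromov_sequenceD[OF boundary_gromov_sequence[OF boundary_action_BX[OF g \<eta>] gu]] by blast
  have "dist x0 (g x0) - R - 1 - 1 - \<delta> < gp (g x0) ((g \<circ> u) n)" if "n \<ge> N" for n
  proof -
    obtain k where k: "k \<ge> N" "gp (ginv g x0) (u k) \<le> R + 1" using freq by blast
    have 1: "dist x0 (g x0) - (R + 1) \<le> gp (g x0) (g (u k))"
      using gromov_product_isometry_flip[OF g, of x0 "u k"] k by (simp add: gromov_product_commute)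
    have "dist x0 (g x0) < gp (g (u k)) (g (u n))"
      using N k that by simp
    \<comment> \<open>Makes the flipped bound at most d(x0, g x0), the level that all late products
      of terms of \<open>g \<circ> u\<close> exceed.\<close>
    moreover have "R \<ge> -1"
      using gromov_product_nonneg[of x0 "ginv g x0" "u k"] k by linarith
    ultimately have "dist x0 (g x0) - (R + 1) \<le> gp (g (u k)) (g (u n))" by linarith
    from gp_tri[OF 1 this] show ?thesis by simp
  qed
  then have "ereal (dist x0 (g x0) - R - 1 - 1 - \<delta> - 1) < E (Inl (g x0)) (Inr (boundary_action g \<eta>))"
    by (intro E_Inl_Inr(2)[OF boundary_action_BX[OF g \<eta>] gu]) blast
  moreover have "dist x0 (g x0) - R - C1 \<le> dist x0 (g x0) - R - 1 - 1 - \<delta> - 1"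
    using C0_pos by (simp add: C1_def)
  ultimately show ?thesis by (meson ereal_less_eq(3) le_less_trans)
qed

subsection \<open>The topology of the boundary\<close>

lemma openin_boundary_topology:
  "bopen U \<longleftrightarrow>
     U \<subseteq> BX \<and> (\<forall>\<xi>\<in>U. \<exists>N. \<forall>\<eta>\<in>BX. ereal N < E (Inr \<eta>) (Inr \<xi>) \<longrightarrow> \<eta> \<in> U)"
    (is "?l \<longleftrightarrow> ?r")
proof
  assume ?l
  then obtain W where W: "openin (bordification_topology x0) W" "U = Inr -` W \<inter> BX"
    unfolding boundary_topology_def openin_pullback_topology by blast
  show ?r
  proof (intro conjI ballI)
    fix \<xi> assume "\<xi> \<in> U"
    then obtain N where "{p \<in> BD. E p (Inr \<xi>) > ereal N} \<subseteq> W"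
      using W by (auto simp: openin_bordification_topology)
    then show "\<exists>N. \<forall>\<eta>\<in>BX. ereal N < E (Inr \<eta>) (Inr \<xi>) \<longrightarrow> \<eta> \<in> U"
      using W(2) by (intro exI[of _ N]) auto
  qed (use W in blast)
next
  assume r: ?r
  \<comment> \<open>All of \<open>X\<close> is adjoined to \<open>U\<close>, so that the condition
    on the part in \<open>X\<close> becomes trivial.\<close>
  have "openin (bordification_topology x0) (range Inl \<union> Inr ` U)"
    unfolding openin_bordification_topology
  proof (intro conjI allI impI)
    show "range Inl \<union> Inr ` U \<subseteq> BD" using r by auto
    have "Inl -` (range Inl \<union> Inr ` U) = UNIV" by auto
    then show "open (Inl -` (range Inl \<union> Inr ` U))" by (rule ssubst) (rule open_UNIV)
    fix \<xi> assume "Inr \<xi> \<in> range Inl \<union> Inr ` U"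
    then have "\<xi> \<in> U" by auto
    then obtain N where N: "\<forall>\<eta>\<in>BX. ereal N < E (Inr \<eta>) (Inr \<xi>) \<longrightarrow> \<eta> \<in> U" using r by blast
    have "{p \<in> BD. E p (Inr \<xi>) > ereal (max 0 N)} \<subseteq> range Inl \<union> Inr ` U"
    proof
      fix p assume p: "p \<in> {p \<in> BD. E p (Inr \<xi>) > ereal (max 0 N)}"
      show "p \<in> range Inl \<union> Inr ` U"
      proof (cases p)
        case (Inr \<eta>)
        have "ereal N \<le> ereal (max 0 N)" by simp
        also have "\<dots> < E (Inr \<eta>) (Inr \<xi>)" using p Inr by blast
        finally show ?thesis using N p Inr by auto
      qed simp
    qed
    then show "\<exists>N\<ge>0. {p \<in> BD. E p (Inr \<xi>) > ereal N} \<subseteq> range Inl \<union> Inr ` U"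
      by (intro exI[of _ "max 0 N"]) simp
  qed
  moreover have "U = Inr -` (range Inl \<union> Inr ` U) \<inter> BX" using r by auto
  ultimately show ?l unfolding boundary_topology_def openin_pullback_topology by blast
qed

text \<open>The interior in the boundary. The sets where \<open>E\<close> exceeds a bound are not
  known to be open or Borel, so measures are evaluated on interiors of shadows.\<close>

definition bint :: "(nat \<Rightarrow> 'a) set set \<Rightarrow> (nat \<Rightarrow> 'a) set set" where
  "bint A = {\<xi> \<in> BX. \<exists>N. \<forall>\<eta>\<in>BX. ereal N < E (Inr \<eta>) (Inr \<xi>) \<longrightarrow> \<eta> \<in> A}"

lemma bint_subset: "bint A \<subseteq> A" "bint A \<subseteq> BX"
  unfolding bint_def using E_self by blast+

text \<open>Raising the radius from \<open>N\<close> to \<open>N + C1\<close> makes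
  \<open>E_tri\<close> applicable at every nearby point; this is why the sets that define the
  topology really are neighbourhoods.\<close>

lemma openin_bint: "bopen (bint A)"
  unfolding openin_boundary_topology
proof (intro conjI ballI)
  show "bint A \<subseteq> BX" by (auto simp: bint_def)
  fix \<xi> assume "\<xi> \<in> bint A"
  then obtain N where \<xi>: "\<xi> \<in> BX" and N: "\<forall>\<eta>\<in>BX. ereal N < E (Inr \<eta>) (Inr \<xi>) \<longrightarrow> \<eta> \<in> A"
    by (auto simp: bint_def)
  have "\<eta> \<in> bint A" if \<eta>: "\<eta> \<in> BX" "ereal (N + C1) < E (Inr \<eta>) (Inr \<xi>)" for \<eta>
  proof -
    have "\<zeta> \<in> A" if "\<zeta> \<in> BX" "ereal (N + C1) < E (Inr \<zeta>) (Inr \<eta>)" for \<zeta>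
      using E_tri[of "Inr \<zeta>" "Inr \<eta>" "Inr \<xi>" "N + C1"] that \<eta> \<xi> N by simp
    then show ?thesis using \<eta> unfolding bint_def by blast
  qed
  then show "\<exists>N. \<forall>\<eta>\<in>BX. ereal N < E (Inr \<eta>) (Inr \<xi>) \<longrightarrow> \<eta> \<in> bint A" by blast
qed

lemma space_boundary_borel: "space (boundary_borel x0) = BX"
  unfolding boundary_borel_def by (rule space_measure_of) (auto simp: openin_boundary_topology)

lemma sets_boundary_borel:
  "sets (boundary_borel x0) = sigma_sets BX {U. bopen U}"
  unfolding boundary_borel_def by (rule sets_measure_of) (auto simp: openin_boundary_topology)

lemma openin_imp_borel: "bopen U \<Longrightarrow> U \<in> sets (boundary_borel x0)"
  unfolding sets_boundary_borel by auto

lemma openin_BX: "bopen BX"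
  by (auto simp: openin_boundary_topology)

lemma singleton_borel:
  assumes "\<xi> \<in> BX"
  shows "{\<xi>} \<in> sets (boundary_borel x0)"
proof -
  have "bopen (BX - {\<xi>})"
    unfolding openin_boundary_topology
  proof (intro conjI ballI)
    fix \<eta> assume "\<eta> \<in> BX - {\<xi>}"
    then show "\<exists>N. \<forall>\<zeta>\<in>BX. ereal N < E (Inr \<zeta>) (Inr \<eta>) \<longrightarrow> \<zeta> \<in> BX - {\<xi>}"
      using E_distinct[of \<xi> \<eta>] assms by blast
  qed auto
  then have "BX - (BX - {\<xi>}) \<in> sets (boundary_borel x0)"
    by (intro sets.Diff openin_imp_borel openin_BX)
  moreover have "BX - (BX - {\<xi>}) = {\<xi>}" using assms by blast
  ultimately show ?thesis by simp
qed

lemma boundary_action_vimage_open: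
  assumes g: "isometry g" and U: "bopen U"
  shows "bopen {\<xi> \<in> BX. boundary_action g \<xi> \<in> U}"
  unfolding openin_boundary_topology
proof (intro conjI ballI)
  fix \<xi> assume "\<xi> \<in> {\<xi> \<in> BX. boundary_action g \<xi> \<in> U}"
  then have \<xi>: "\<xi> \<in> BX" "boundary_action g \<xi> \<in> U" by auto
  then obtain N where N: "\<forall>\<eta>\<in>BX. ereal N < E (Inr \<eta>) (Inr (boundary_action g \<xi>)) \<longrightarrow> \<eta> \<in> U"
    using U unfolding openin_boundary_topology by blast
  have "boundary_action g \<eta> \<in> U" if "\<eta> \<in> BX" "ereal (N + C1 + dist x0 (g x0)) < E (Inr \<eta>) (Inr \<xi>)" for \<eta>
    using E_act[OF g, of "Inr \<eta>" "Inr \<xi>" "N + C1 + dist x0 (g x0)"] that \<xi> N boundary_action_BX[OF g] by simp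
  then show "\<exists>N. \<forall>\<eta>\<in>BX. ereal N < E (Inr \<eta>) (Inr \<xi>) \<longrightarrow> \<eta> \<in> {\<xi> \<in> BX. boundary_action g \<xi> \<in> U}"
    by blast
qed auto

lemma boundary_action_measurable:
  assumes g: "isometry g"
  shows "boundary_action g \<in> boundary_borel x0 \<rightarrow>\<^sub>M boundary_borel x0"
proof -
  have "boundary_action g \<in> boundary_borel x0 \<rightarrow>\<^sub>M sigma BX {U. bopen U}"
  proof (rule measurable_measure_of)
    show "{U. bopen U} \<subseteq> Pow BX"
      by (auto simp: openin_boundary_topology)
    show "boundary_action g \<in> space (boundary_borel x0) \<rightarrow> BX"
      using boundary_action_BX[OF g] by (simp add: space_boundary_borel)
    fix U assume "U \<in> {U. bopen U}"
    then have "{\<xi> \<in> BX. boundary_action g \<xi> \<in> U} \<in> sets (boundary_borel x0)"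
      using boundary_action_vimage_open[OF g] openin_imp_borel by auto
    moreover have "boundary_action g -` U \<inter> space (boundary_borel x0) = {\<xi> \<in> BX. boundary_action g \<xi> \<in> U}"
      by (auto simp: space_boundary_borel)
    ultimately show "boundary_action g -` U \<inter> space (boundary_borel x0) \<in> sets (boundary_borel x0)"
      by simp
  qed
  then show ?thesis by (simp add: boundary_borel_def)
qed

lemma boundary_action_vimage_borel:
  assumes "isometry g" "U \<in> sets (boundary_borel x0)"
  shows "{\<xi> \<in> BX. boundary_action g \<xi> \<in> U} \<in> sets (boundary_borel x0)"
proof -
  have "boundary_action g -` U \<inter> space (boundary_borel x0) = {\<xi> \<in> BX. boundary_action g \<xi> \<in> U}"
    by (auto simp: space_boundary_borel)
  then show ?thesis
    using measurable_sets[OF boundary_action_measurable[OF assms(1)] assms(2)] by simp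
qed

lemma limitin_bordification:
  assumes "\<xi> \<in> BX" "u \<in> \<xi>"
  shows "limitin (bordification_topology x0) (\<lambda>n. Inl (u n)) (Inr \<xi>) sequentially"
proof -
  have "openin (bordification_topology x0) (BD)"
  proof -
    have "Inl -` BD = UNIV" by auto
    then show ?thesis
      unfolding openin_bordification_topology by (auto intro!: exI[of _ 0])
  qed
  then have "Inr \<xi> \<in> topspace (bordification_topology x0)"
    using openin_subset assms(1) by (metis Inr_bordification subsetD)
  moreover have "\<forall>\<^sub>F n in sequentially. Inl (u n) \<in> W"
    if W: "openin (bordification_topology x0) W" "Inr \<xi> \<in> W" for W
  proof -
    obtain N where N: "{p \<in> BD. E p (Inr \<xi>) > ereal N} \<subseteq> W"
      using W by (auto simp: openin_bordification_topology)
    show ?thesis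
      using E_seq_tendsto[OF assms, of N] N unfolding eventually_sequentially by (metis (mono_tags, lifting) Inl_bordification mem_Collect_eq subsetD)
  qed
  ultimately show ?thesis unfolding limitin_def by blast
qed

end

section \<open>Fixed points of loxodromic isometries\<close>

context hyperbolic
begin

text \<open>Products with a fixed \<open>x\<close> never exceed d(x0,x). Once the terms of
  \<open>z\<close> and \<open>z'\<close> have a larger product with each other, exchanging one for
  the other costs only \<delta>.\<close>

lemma gp_boundary_stable:
  assumes "\<zeta> \<in> BX" "z \<in> \<zeta>" "z' \<in> \<zeta>"
  shows "\<exists>N. \<forall>k\<ge>N. \<forall>l\<ge>N. \<bar>gp x (z k) - gp x (z' l)\<bar> \<le> \<delta>"
proof -
  obtain N where N: "\<forall>k\<ge>N. \<forall>l\<ge>N. dist x0 x < gp (z k) (z' l)"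
    using gromov_equivD[OF boundary_equiv[OF assms]] by blast
  have "\<bar>gp x (z k) - gp x (z' l)\<bar> \<le> \<delta>" if "k \<ge> N" "l \<ge> N" for k l
  proof -
    have big: "dist x0 x < gp (z k) (z' l)" using N that by blast
    have "gp x (z k) - \<delta> \<le> gp x (z' l)"
      using big gromov_product_le_dist[of x0 x "z k"] by (intro gp_tri[of _ x "z k"]) auto
    moreover have "gp x (z' l) - \<delta> \<le> gp x (z k)"
      using big gromov_product_le_dist[of x0 x "z' l"]
      by (intro gp_tri[of _ x "z' l"]) (auto simp: gromov_product_commute[of x0 "z' l"])
    ultimately show ?thesis by linarith
  qed
  then show ?thesis by blast
qed

text \<open>A coarse Busemann function: instead of taking a limit, the value is frozen at one late
  index of one sequence. The error 4\<delta> is twice two uses of \<open>gp_boundary_stable\<close>,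
  and it is the same for all sequences of the class.\<close>

lemma busemann_exists:
  assumes "\<zeta> \<in> BX"
  obtains h where "\<And>x z. z \<in> \<zeta> \<Longrightarrow> \<exists>N. \<forall>k\<ge>N. \<bar>dist x (z k) - dist x0 (z k) - h x\<bar> \<le> 4 * \<delta>"
proof -
  obtain u where u: "u \<in> \<zeta>" using boundary_nonempty[OF assms] by blast
  have "\<exists>c. \<forall>z\<in>\<zeta>. \<exists>N. \<forall>k\<ge>N. \<bar>dist x (z k) - dist x0 (z k) - c\<bar> \<le> 4 * \<delta>" for x
  proof -
    obtain M where M: "\<forall>k\<ge>M. \<forall>l\<ge>M. \<bar>gp x (u k) - gp x (u l)\<bar> \<le> \<delta>"
      using gp_boundary_stable[OF assms u u] by blast
    have "\<exists>N. \<forall>k\<ge>N. \<bar>dist x (z k) - dist x0 (z k) - (dist x0 x - 2 * gp x (u M))\<bar> \<le> 4 * \<delta>"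
      if z: "z \<in> \<zeta>" for z
    proof -
      obtain N where N: "\<forall>k\<ge>N. \<forall>l\<ge>N. \<bar>gp x (u k) - gp x (z l)\<bar> \<le> \<delta>"
        using gp_boundary_stable[OF assms u z] by blast
      have "\<bar>dist x (z k) - dist x0 (z k) - (dist x0 x - 2 * gp x (u M))\<bar> \<le> 4 * \<delta>" if "k \<ge> N" for k
      proof -
        have "\<bar>gp x (u (max M N)) - gp x (z k)\<bar> \<le> \<delta>" "\<bar>gp x (u M) - gp x (u (max M N))\<bar> \<le> \<delta>"
          using N M that by auto
        moreover have "dist x (z k) = dist x0 x + dist x0 (z k) - 2 * gp x (z k)"
          by (simp add: gromov_product_def field_simps)
        ultimately show ?thesis by linarith
      qed
      then show ?thesis by blast
    qed
    then show ?thesis by blast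
  qed
  then obtain h where "\<And>x. \<forall>z\<in>\<zeta>. \<exists>N. \<forall>k\<ge>N. \<bar>dist x (z k) - dist x0 (z k) - h x\<bar> \<le> 4 * \<delta>"
    by metis
  then show thesis using that by blast
qed

section \<open>Orbits of an isometry with positive translation length\<close>

lemma boundary_action_funpow_fixed:
  "boundary_action f \<zeta> = \<zeta> \<Longrightarrow> boundary_action (f ^^ n) \<zeta> = \<zeta>"
  by (induction n) (simp_all add: boundary_action_id boundary_action_comp del: id_apply)

text \<open>With a Busemann function \<open>h\<close> at \<open>\<zeta>\<close>, the numbers \<open>b n = h (f\<^sup>n x0)\<close> are coarsely additive.
  The four-point inequality for \<open>x0, f\<^sup>n x0, f\<^sup>2\<^sup>n x0, \<zeta>\<close> forces \<open>\<bar>b n\<bar>\<close> to grow linearly, so that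
  \<open>b\<close> has eventually constant sign, and the sign tells which of the two orbits tends to \<open>\<zeta>\<close>.\<close>

lemma positive_translation_fixed_point:
  assumes f: "isometry f" and \<tau>: "\<tau> > 0" and lim: "(\<lambda>n. dist x0 ((f ^^ n) x0) / real n) \<longlonglongrightarrow> \<tau>"
    and \<zeta>: "\<zeta> \<in> BX" and invariant: "boundary_action f \<zeta> = \<zeta>"
  shows "(\<lambda>n. (f ^^ n) x0) \<in> \<zeta> \<or> (\<lambda>n. ginv (f ^^ n) x0) \<in> \<zeta>"
proof -
  obtain z where z: "z \<in> \<zeta>" using boundary_nonempty[OF \<zeta>] by blast
  obtain h where h: "\<And>x z. z \<in> \<zeta> \<Longrightarrow> \<exists>N. \<forall>k\<ge>N. \<bar>dist x (z k) - dist x0 (z k) - h x\<bar> \<le> 4 * \<delta>"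
    using busemann_exists[OF \<zeta>] by blast
  have h0: "\<bar>h x0\<bar> \<le> 4 * \<delta>"
    using h[OF z, of x0] by auto
  \<comment> \<open>The Busemann function is read along \<open>z\<close> at \<open>g x\<close> and
    along \<open>ginv g \<circ> z\<close> at \<open>x\<close>. The distances agree exactly and the
    terms at \<open>x0\<close> cancel in the differences, which leaves four errors of
    4\<delta>.\<close>
  have h_quasi: "\<bar>(h (g x) - h (g y)) - (h x - h y)\<bar> \<le> 16 * \<delta>"
    if g: "isometry g" "boundary_action g \<zeta> = \<zeta>" for g x y
  proof -
    have "ginv g \<circ> z \<in> boundary_action (ginv g) \<zeta>"
      using z by (auto simp: boundary_action_def)
    then have z': "ginv g \<circ> z \<in> \<zeta>"
      using boundary_action_inv(1)[OF g(1), of \<zeta>] g(2) by simp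
    obtain N1 N2 N3 N4 where N: "\<forall>k\<ge>N1. \<bar>dist (g x) (z k) - dist x0 (z k) - h (g x)\<bar> \<le> 4 * \<delta>"
      "\<forall>k\<ge>N2. \<bar>dist (g y) (z k) - dist x0 (z k) - h (g y)\<bar> \<le> 4 * \<delta>"
      "\<forall>k\<ge>N3. \<bar>dist x ((ginv g \<circ> z) k) - dist x0 ((ginv g \<circ> z) k) - h x\<bar> \<le> 4 * \<delta>"
      "\<forall>k\<ge>N4. \<bar>dist y ((ginv g \<circ> z) k) - dist x0 ((ginv g \<circ> z) k) - h y\<bar> \<le> 4 * \<delta>"
      using h[OF z] h[OF z'] by metis
    define k where "k = N1 + N2 + N3 + N4"
    have eq: "dist w ((ginv g \<circ> z) k) = dist (g w) (z k)" for w
      using isometryD(1)[OF g(1), of w "ginv g (z k)"] by (simp add: isometry_inv_apply[OF g(1)])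
    have "\<bar>dist (g x) (z k) - dist x0 (z k) - h (g x)\<bar> \<le> 4 * \<delta>"
      "\<bar>dist (g y) (z k) - dist x0 (z k) - h (g y)\<bar> \<le> 4 * \<delta>"
      "\<bar>dist x ((ginv g \<circ> z) k) - dist x0 ((ginv g \<circ> z) k) - h x\<bar> \<le> 4 * \<delta>"
      "\<bar>dist y ((ginv g \<circ> z) k) - dist x0 ((ginv g \<circ> z) k) - h y\<bar> \<le> 4 * \<delta>"
      using N by (auto simp: k_def)
    then show ?thesis
      unfolding eq by linarith
  qed
  define d where "d n = dist x0 ((f ^^ n) x0)" for n
  define b where "b n = h ((f ^^ n) x0)" for n
  have fn: "isometry (f ^^ n)" "boundary_action (f ^^ n) \<zeta> = \<zeta>" for n
    using isometry_funpow[OF f] boundary_action_funpow_fixed[OF invariant] by auto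
  have b_quasi: "\<bar>b (n + m) - b n - b m\<bar> \<le> 20 * \<delta>" for n m
    using h_quasi[OF fn[of n], of "(f ^^ m) x0" x0] h0 unfolding b_def funpow_add comp_apply by linarith
  \<comment> \<open>Seen from \<open>y\<close>, the products (x0 . z k) and (z k . w) are (d n + b
    n)/2 and (d n - b n)/2 up to bounded errors, while (x0 . w) is d n - d(2n)/2. The smaller of the
    first two bounds the third from below.\<close>
  have double: "d (2 * n) \<le> d n + \<bar>b n\<bar> + 60 * \<delta>" for n
  proof -
    define y where "y = (f ^^ n) x0"
    define w where "w = (f ^^ (2 * n)) x0"
    have w_eq: "w = (f ^^ n) y" by (simp add: w_def y_def funpow_add mult_2)
    obtain N1 N2 where N: "\<forall>k\<ge>N1. \<bar>dist y (z k) - dist x0 (z k) - h y\<bar> \<le> 4 * \<delta>"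
      "\<forall>k\<ge>N2. \<bar>dist w (z k) - dist x0 (z k) - h w\<bar> \<le> 4 * \<delta>"
      using h[OF z] by metis
    define k where "k = N1 + N2"
    have k: "\<bar>dist y (z k) - dist x0 (z k) - h y\<bar> \<le> 4 * \<delta>"
      "\<bar>dist w (z k) - dist x0 (z k) - h w\<bar> \<le> 4 * \<delta>"
      using N by (auto simp: k_def)
    have "dist y w = dist x0 y"
      using isometryD(1)[OF fn(1)[of n], of x0 y] by (simp add: w_eq y_def)
    moreover have "dist x0 y = d n" "dist x0 w = d (2 * n)" by (simp_all add: y_def w_def d_def)
    moreover have "h y = b n" "h w = b (2 * n)" by (simp_all add: y_def w_def b_def)
    moreover have "\<bar>b (2 * n) - b n - b n\<bar> \<le> 20 * \<delta>"
      using b_quasi[of n n] unfolding mult_2 .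
    moreover have "d n + dist y (z k) - dist x0 (z k) - 2 * \<delta> \<le> 2 * d n - d (2 * n) \<or>
        d n + dist y (z k) - dist w (z k) - 2 * \<delta> \<le> 2 * d n - d (2 * n)"
      using four_point[of y x0 "z k" w] calculation(1-3)
      by (auto simp: gromov_product_def dist_commute min_def field_simps split: if_splits)
    moreover have "dist y x0 = dist x0 y" "dist (z k) w = dist w (z k)"
      by (simp_all add: dist_commute)
    ultimately show ?thesis
      using k \<delta>_nonneg by (elim disjE) linarith+
  qed
  \<comment> \<open>The factors 7/8 and 9/8 are chosen so that 2 * 7/8 - 9/8 = 5/8 exceeds 1/2; the
    surplus later absorbs the additive constants.\<close>
  have "\<exists>N. \<forall>n\<ge>N. real n * (7/8 * \<tau>) \<le> d n \<and> d n \<le> real n * (9/8 * \<tau>)"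
  proof -
    obtain N where N: "\<forall>n\<ge>N. \<bar>d n / real n - \<tau>\<bar> < \<tau> / 8"
      using metric_LIMSEQ_D[OF lim, of "\<tau> / 8"] \<tau> by (auto simp: d_def dist_real_def)
    have "real n * (7/8 * \<tau>) \<le> d n \<and> d n \<le> real n * (9/8 * \<tau>)" if "n \<ge> max N 1" for n
    proof -
      have "\<bar>d n / real n - \<tau>\<bar> < \<tau> / 8" using N that by simp
      then have "7/8 * \<tau> \<le> d n / real n" "d n / real n \<le> 9/8 * \<tau>" by linarith+
      then show ?thesis using that by (simp add: field_simps)
    qed
    then show ?thesis by blast
  qed
  then obtain N0 where N0: "\<And>n. n \<ge> N0 \<Longrightarrow> real n * (7/8 * \<tau>) \<le> d n" "\<And>n. n \<ge> N0 \<Longrightarrow> d n \<le> real n * (9/8 * \<tau>)"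
    by blast
  have b_large: "\<bar>b n\<bar> \<ge> real n * (\<tau> * 5/8) - 60 * \<delta>" if "n \<ge> N0" for n
  proof -
    have "real (2 * n) * (7/8 * \<tau>) \<le> d n + \<bar>b n\<bar> + 60 * \<delta>"
      using N0(1)[of "2 * n"] double[of n] that by linarith
    then show ?thesis using N0(2)[OF that] by (simp add: algebra_simps)
  qed
  \<comment> \<open>Bounds one increment of \<open>b\<close>. Beyond \<open>N\<close> the absolute
    value of \<open>b\<close> exceeds it, so a single step cannot change the sign.\<close>
  define B where "B = \<bar>b 1\<bar> + 20 * \<delta>"
  obtain N1 :: nat where N1: "real N1 * (\<tau> / 8) > 60 * \<delta> + B + 1"
    using reals_Archimedean3[of "\<tau> / 8"] \<tau> by fastforce
  define N where "N = max N0 N1"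
  have b_lin: "\<bar>b n\<bar> \<ge> real n * (\<tau> / 2) + B + 1" if "n \<ge> N" for n
  proof -
    have "real N1 * (\<tau> / 8) \<le> real n * (\<tau> / 8)"
      using that \<tau> by (intro mult_right_mono) (auto simp: N_def)
    then show ?thesis
      using b_large[of n] that N1 by (simp add: N_def algebra_simps)
  qed
  have pos: "real n * (\<tau> / 2) \<ge> 0" for n using \<tau> by simp
  have step: "\<bar>b (Suc n) - b n\<bar> \<le> B" for n
    using b_quasi[of n 1] by (simp add: B_def)
  have sign: "(b n > 0) = (b N > 0)" if "n \<ge> N" for n
    using that
  proof (induction n rule: dec_induct)
    case (step n)
    have "\<bar>b n\<bar> \<ge> B + 1" "\<bar>b (Suc n)\<bar> \<ge> B + 1"
      using b_lin[of n] b_lin[of "Suc n"] step.hyps pos[of n] pos[of "Suc n"] by linarith+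
    then have "(b (Suc n) > 0) = (b n > 0)"
      using \<open>\<And>n. \<bar>b (Suc n) - b n\<bar> \<le> B\<close>[of n] \<delta>_nonneg by (auto simp: B_def)
    then show ?case using step.IH by simp
  qed simp
  have B0: "B \<ge> 0" using \<delta>_nonneg by (simp add: B_def)
  \<comment> \<open>A Busemann value tending to minus infinity forces the products with
    \<open>z k\<close> to grow. The slack 24\<delta> is what the inverse orbit needs: 16\<delta>
    from \<open>h_quasi\<close> and twice the bound 4\<delta> on h x0.\<close>
  have conv: "v \<in> \<zeta>" if v: "\<And>n. n \<ge> N \<Longrightarrow> h (v n) \<le> - (real n * (\<tau> / 2)) + 24 * \<delta>" for v
  proof (rule boundary_memI[OF \<zeta> z])
    fix R
    obtain K :: nat where K: "real K * (\<tau> / 2) > 2 * R + 28 * \<delta>"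
      using reals_Archimedean3[of "\<tau> / 2"] \<tau> by fastforce
    have "\<exists>M. \<forall>k\<ge>M. R < gp (v n) (z k)" if n: "n \<ge> max N K" for n
    proof -
      obtain M where M: "\<forall>k\<ge>M. \<bar>dist (v n) (z k) - dist x0 (z k) - h (v n)\<bar> \<le> 4 * \<delta>"
        using h[OF z] by blast
      have "real K * (\<tau> / 2) \<le> real n * (\<tau> / 2)"
        using n \<tau> by (intro mult_right_mono) auto
      then have hn: "h (v n) < - 2 * R - 4 * \<delta>" using K v[of n] n by simp
      have "R < gp (v n) (z k)" if "k \<ge> M" for k
      proof -
        have "\<bar>dist (v n) (z k) - dist x0 (z k) - h (v n)\<bar> \<le> 4 * \<delta>" using M that by blast
        then have "dist x0 (v n) + dist x0 (z k) - dist (v n) (z k) > 2 * R"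
          using hn zero_le_dist[of x0 "v n"] by linarith
        then show ?thesis by (simp add: gromov_product_def)
      qed
      then show ?thesis by blast
    qed
    then show "\<exists>N. \<forall>n\<ge>N. \<exists>K. \<forall>k\<ge>K. R < gp (v n) (z k)" by blast
  qed
  show ?thesis
  proof (cases "b N > 0")
    case True
    \<comment> \<open>Applying the inverse power to \<open>x0\<close> and \<open>(f ^^ n) x0\<close>
      shows that \<open>h\<close> along the inverse orbit is close to \<open>- b n\<close>.\<close>
    have "h (ginv (f ^^ n) x0) \<le> - (real n * (\<tau> / 2)) + 24 * \<delta>" if n: "n \<ge> N" for n
    proof -
      have "isometry (ginv (f ^^ n))" "boundary_action (ginv (f ^^ n)) \<zeta> = \<zeta>"
        using isometry_inv[OF fn(1)] boundary_action_inv(1)[OF fn(1), of n \<zeta>] fn(2) by auto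
      from h_quasi[OF this, of x0 "(f ^^ n) x0"]
      have "\<bar>h (ginv (f ^^ n) x0) - h x0 - (h x0 - b n)\<bar> \<le> 16 * \<delta>"
        by (simp add: b_def isometry_inv_apply[OF fn(1)])
      moreover have "b n \<ge> real n * (\<tau> / 2)"
        using b_lin[OF n] sign[OF n] True B0 by linarith
      ultimately show ?thesis using h0 by linarith
    qed
    then show ?thesis by (intro disjI2 conv)
  next
    case False
    have "h ((f ^^ n) x0) \<le> - (real n * (\<tau> / 2)) + 24 * \<delta>" if n: "n \<ge> N" for n
      using b_lin[OF n] sign[OF n] False B0 \<delta>_nonneg unfolding b_def by linarith
    then show ?thesis by (intro disjI1 conv)
  qed
qed

text \<open>\<open>g\<close> commutes with its power \<open>f\<close>, so it moves every point of
  the orbit of \<open>x0\<close> under powers of \<open>f\<close> by the same distance. The orbit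
  that converges to \<zeta>, forward or backward, thus stays at bounded distance from its image
  under \<open>g\<close>.\<close>

lemma loxodromic_power_fixed_point:
  assumes g: "loxodromic g" and "p \<ge> 1" and \<zeta>: "\<zeta> \<in> BX" and invariant: "boundary_action (g ^^ p) \<zeta> = \<zeta>"
  shows "boundary_action g \<zeta> = \<zeta>"
proof -
  have ig: "isometry g" using g by (simp add: loxodromic_def)
  define f where "f = g ^^ p"
  have f: "isometry f" using isometry_funpow[OF ig] by (simp add: f_def)
  obtain \<tau> where \<tau>: "\<tau> > 0" "(\<lambda>n. dist x0 ((g ^^ n) x0) / real n) \<longlonglongrightarrow> \<tau>"
    using g by (auto simp: loxodromic_def)
  have "strict_mono (\<lambda>n. p * n)" using \<open>p \<ge> 1\<close> by (simp add: strict_mono_def)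
  from LIMSEQ_subseq_LIMSEQ[OF \<tau>(2) this]
  have "(\<lambda>n. real p * (dist x0 ((g ^^ (p * n)) x0) / real (p * n))) \<longlonglongrightarrow> real p * \<tau>"
    by (intro tendsto_mult_left) (simp add: comp_def)
  moreover have "real p * (dist x0 ((g ^^ (p * n)) x0) / real (p * n)) = dist x0 ((f ^^ n) x0) / real n" for n
    using \<open>p \<ge> 1\<close> by (simp add: f_def funpow_mult)
  ultimately have lim: "(\<lambda>n. dist x0 ((f ^^ n) x0) / real n) \<longlonglongrightarrow> real p * \<tau>"
    by simp
  have comm: "(f ^^ n) (g x) = g ((f ^^ n) x)" for n x
    by (simp add: f_def funpow_mult funpow_swap1)
  have disj: "(\<lambda>n. (f ^^ n) x0) \<in> \<zeta> \<or> (\<lambda>n. ginv (f ^^ n) x0) \<in> \<zeta>"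
    using positive_translation_fixed_point[OF f _ lim \<zeta>] invariant \<tau>(1) \<open>p \<ge> 1\<close>
    by (simp add: f_def)
  have "\<exists>u\<in>\<zeta>. \<forall>n. dist (u n) (g (u n)) = dist x0 (g x0)"
    using disj
  proof (elim disjE)
    assume mem: "(\<lambda>n. (f ^^ n) x0) \<in> \<zeta>"
    have "dist ((f ^^ n) x0) (g ((f ^^ n) x0)) = dist x0 (g x0)" for n
      unfolding comm[symmetric] by (rule isometryD(1)[OF isometry_funpow[OF f]])
    then show ?thesis using mem by (intro bexI[of _ "\<lambda>n. (f ^^ n) x0"]) auto
  next
    assume mem: "(\<lambda>n. ginv (f ^^ n) x0) \<in> \<zeta>"
    have "dist (ginv (f ^^ n) x0) (g (ginv (f ^^ n) x0)) = dist x0 (g x0)" for n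
      using isometryD(1)[OF isometry_funpow[OF f], of n "ginv (f ^^ n) x0" "g (ginv (f ^^ n) x0)"]
      by (simp add: comm isometry_inv_apply[OF isometry_funpow[OF f]])
    then show ?thesis using mem by (intro bexI[of _ "\<lambda>n. ginv (f ^^ n) x0"]) auto
  qed
  then obtain u where u: "u \<in> \<zeta>" "\<And>n. dist (u n) (g (u n)) = dist x0 (g x0)" by blast
  have "g \<circ> u \<in> \<zeta>"
    by (rule boundary_memI_bounded[OF \<zeta> u(1), of _ "dist x0 (g x0)"]) (simp add: u(2))
  moreover have "g \<circ> u \<in> boundary_action g \<zeta>"
    using u(1) by (auto simp: boundary_action_def)
  ultimately show ?thesis
    using boundary_eqI[OF boundary_action_BX[OF ig \<zeta>] \<zeta>] boundary_equiv[OF \<zeta>] by blast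
qed

end

section \<open>Stationary atoms\<close>

abbreviation avg :: "'b pmf \<Rightarrow> ('b \<Rightarrow> real) \<Rightarrow> real" where
  "avg p \<equiv> measure_pmf.expectation p"

lemma pmf_integrable_bounded:
  fixes f :: "'b \<Rightarrow> real"
  assumes "\<And>x. x \<in> set_pmf p \<Longrightarrow> \<bar>f x\<bar> \<le> C"
  shows "integrable (measure_pmf p) f"
  by (rule measure_pmf.integrable_const_bound[of _ C]) (use assms in \<open>auto simp: AE_measure_pmf_iff\<close>)

text \<open>The basis of both maximum principles: a nonnegative deficit with a small mean is small
  at each point of the support.\<close>

lemma pmf_point_le_expectation:
  fixes f :: "'b \<Rightarrow> real"
  assumes "\<And>x. x \<in> set_pmf p \<Longrightarrow> 0 \<le> f x" "\<And>x. x \<in> set_pmf p \<Longrightarrow> f x \<le> C"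
  shows "pmf p t * f t \<le> avg p f"
proof -
  have "pmf p t * f t = avg p (\<lambda>x. f t * indicator {t} x)"
    by (simp add: measure_pmf_single)
  also have "\<dots> \<le> avg p f"
  proof (rule integral_mono_AE)
    show "integrable (measure_pmf p) (\<lambda>x. f t * indicator {t} x :: real)"
      by (rule pmf_integrable_bounded[of _ _ "\<bar>f t\<bar>"]) (auto simp: indicator_def)
    show "integrable (measure_pmf p) f"
      by (rule pmf_integrable_bounded[of _ _ C]) (use assms in \<open>auto simp: abs_of_nonneg\<close>)
    show "AE x in measure_pmf p. f t * indicator {t} x \<le> f x"
      using assms by (auto simp: AE_measure_pmf_iff indicator_def)
  qed
  finally show ?thesis .
qed

lemma generated_semigroup_funpow:
  assumes "t \<in> generated_semigroup S"
  shows "t ^^ Suc n \<in> generated_semigroup S"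
  using assms by (induction n) (auto intro: generated_semigroup.comp)

lemma funpow_cancel:
  assumes "\<And>x. f (g x) = x"
  shows "(f ^^ (k + i)) ((g ^^ i) x) = (f ^^ k) x"
proof (induction i arbitrary: x)
  case (Suc i)
  have "(f ^^ (k + Suc i)) ((g ^^ Suc i) x) = (f ^^ (k + i)) (f (g ((g ^^ i) x)))"
    unfolding add_Suc_right funpow_Suc_right[of _ f] by simp
  then show ?case using Suc.IH by (simp add: assms)
qed simp

context hyperbolic
begin

lemma boundary_action_funpow: "boundary_action (g ^^ n) \<xi> = (boundary_action g ^^ n) \<xi>"
proof (induction n)
  case (Suc n)
  then show ?case unfolding funpow.simps boundary_action_comp by simp
qed (simp add: boundary_action_id[unfolded id_def])

text \<open>The heaviest points form a finite set invariant under inverses of elements of the semigroup; its points are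
  periodic, hence fixed, for both loxodromic elements.\<close>

lemma no_stationary_atoms:
  fixes \<mu> :: "('a \<Rightarrow> 'a) pmf"
  assumes iso: "\<And>s. s \<in> set_pmf \<mu> \<Longrightarrow> isometry s"
    and ne: "non_elementary x0 (generated_semigroup (set_pmf \<mu>))"
    and nonneg: "\<And>\<zeta>. \<zeta> \<in> BX \<Longrightarrow> 0 \<le> a \<zeta>"
    and sum: "\<And>F. finite F \<Longrightarrow> F \<subseteq> BX \<Longrightarrow> (\<Sum>\<zeta>\<in>F. a \<zeta>) \<le> (1::real)"
    and sub: "\<And>\<zeta>. \<zeta> \<in> BX \<Longrightarrow> a \<zeta> \<le> avg \<mu> (\<lambda>s. a (boundary_action (ginv s) \<zeta>))"
    and \<zeta>: "\<zeta>1 \<in> BX"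
  shows "a \<zeta>1 = 0"
proof (rule ccontr)
  assume "a \<zeta>1 \<noteq> 0"
  then have pos: "a \<zeta>1 > 0" using nonneg[OF \<zeta>] by simp
  \<comment> \<open>Only finitely many points weigh as much as \<zeta>1, because the total weight is
    at most 1. This is what makes the maximum exist.\<close>
  define A1 where "A1 = {\<zeta> \<in> BX. a \<zeta> \<ge> a \<zeta>1}"
  have fin1: "finite A1"
  proof (rule ccontr)
    assume inf: "infinite A1"
    obtain n :: nat where n: "real n * a \<zeta>1 > 1"
      using reals_Archimedean3[OF pos] by blast
    obtain F where F: "F \<subseteq> A1" "finite F" "card F = n"
      using infinite_arbitrarily_large[OF inf] by blast
    have "real n * a \<zeta>1 \<le> (\<Sum>\<zeta>\<in>F. a \<zeta>)"
      using sum_bounded_below[of F "a \<zeta>1" a] F by (auto simp: A1_def)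
    also have "\<dots> \<le> 1" using F by (intro sum) (auto simp: A1_def)
    finally show False using n by simp
  qed
  have mem1: "\<zeta>1 \<in> A1" using \<zeta> by (simp add: A1_def)
  define Mx where "Mx = Max (a ` A1)"
  have le: "a \<zeta> \<le> Mx" if "\<zeta> \<in> BX" for \<zeta>
  proof (cases "\<zeta> \<in> A1")
    case True
    then show ?thesis using fin1 by (simp add: Mx_def)
  next
    case False
    then have "a \<zeta> \<le> a \<zeta>1" using that by (auto simp: A1_def)
    also have "\<dots> \<le> Mx" using fin1 mem1 by (simp add: Mx_def)
    finally show ?thesis .
  qed
  define A where "A = {\<zeta> \<in> BX. a \<zeta> = Mx}"
  have "a \<zeta>1 \<le> Mx" using fin1 mem1 by (simp add: Mx_def)
  then have "A \<subseteq> A1" by (auto simp: A_def A1_def)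
  then have finA: "finite A" using fin1 finite_subset by blast
  have "Mx \<in> a ` A1" unfolding Mx_def using fin1 mem1 by (intro Max_in) auto
  then obtain \<eta> where \<eta>: "\<eta> \<in> A" by (auto simp: A_def A1_def)
  \<comment> \<open>Maximum principle: the deficits \<open>Mx - a\<close> at the images of \<zeta>
    are nonnegative and have mean at most 0, so each of them vanishes.\<close>
  have inv_step: "boundary_action (ginv s) \<zeta> \<in> A" if s: "s \<in> set_pmf \<mu>" and z: "\<zeta> \<in> A" for s \<zeta>
  proof -
    have zB: "\<zeta> \<in> BX" "a \<zeta> = Mx" using z by (auto simp: A_def)
    have B: "boundary_action (ginv t) \<zeta> \<in> BX" if "t \<in> set_pmf \<mu>" for t
      using boundary_action_BX[OF isometry_inv[OF iso[OF that]] zB(1)] .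
    have "pmf \<mu> s * (Mx - a (boundary_action (ginv s) \<zeta>)) \<le>
        avg \<mu> (\<lambda>t. Mx - a (boundary_action (ginv t) \<zeta>))"
      by (rule pmf_point_le_expectation[of \<mu> _ Mx]) (use B le nonneg in auto)
    also have "\<dots> = Mx - avg \<mu> (\<lambda>t. a (boundary_action (ginv t) \<zeta>))"
      by (subst Bochner_Integration.integral_diff)
        (use B le nonneg in \<open>auto intro!: pmf_integrable_bounded[of _ _ Mx] simp: abs_of_nonneg\<close>)
    also have "\<dots> \<le> 0" using sub[OF zB(1)] zB(2) by simp
    finally have "Mx \<le> a (boundary_action (ginv s) \<zeta>)"
      using s by (simp add: mult_le_0_iff pmf_positive_iff set_pmf_iff not_le)
    then show ?thesis using B[OF s] le by (auto simp: A_def intro: antisym)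
  qed
  have inv_sg: "isometry t \<and> (\<forall>\<zeta>\<in>A. boundary_action (ginv t) \<zeta> \<in> A)"
    if "t \<in> generated_semigroup (set_pmf \<mu>)" for t
    using that
  proof induction
    case (comp g h)
    have "ginv (g \<circ> h) = ginv h \<circ> ginv g"
      using comp.IH by (intro o_inv_distrib) (auto simp: bij_def isometry_inj isometryD)
    then have "boundary_action (ginv (g \<circ> h)) \<zeta> = boundary_action (ginv h) (boundary_action (ginv g) \<zeta>)" for \<zeta>
      by (metis boundary_action_comp)
    moreover have "isometry (g \<circ> h)" using comp.IH by (intro isometry_comp) auto
    ultimately show ?case using comp.IH by metis
  qed (use iso inv_step in auto)
  have fixed: "boundary_action g \<eta> = \<eta>"
    if g: "g \<in> generated_semigroup (set_pmf \<mu>)" "loxodromic g" for g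
  proof -
    have ig: "isometry g" using inv_sg[OF g(1)] by blast
    let ?f = "boundary_action g" and ?g = "boundary_action (ginv g)"
    have mem: "(?g ^^ i) \<eta> \<in> A" for i
      using \<eta> inv_sg[OF g(1)] by (induction i) auto
    \<comment> \<open>Only the inverse is known to preserve \<open>A\<close>, so the pigeonhole
      principle is applied to the inverse orbit, and the repetition is then turned into a period of
      \<open>g\<close> by cancellation.\<close>
    have "\<not> inj (\<lambda>i::nat. (?g ^^ i) \<eta>)"
    proof
      assume "inj (\<lambda>i::nat. (?g ^^ i) \<eta>)"
      then have "infinite (range (\<lambda>i::nat. (?g ^^ i) \<eta>))" by (rule range_inj_infinite)
      moreover have "range (\<lambda>i::nat. (?g ^^ i) \<eta>) \<subseteq> A" using mem by blast
      ultimately show False using finA finite_subset by blast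
    qed
    then obtain i j :: nat where ij: "i < j" "(?g ^^ i) \<eta> = (?g ^^ j) \<eta>"
      unfolding inj_def by (metis linorder_neqE_nat)
    have canc: "?f (?g \<xi>) = \<xi>" for \<xi> using boundary_action_inv(2)[OF ig] .
    have "(?f ^^ (j - i)) \<eta> = (?f ^^ ((j - i) + i)) ((?g ^^ i) \<eta>)"
      using funpow_cancel[of ?f ?g, OF canc] by simp
    also have "\<dots> = (?f ^^ (0 + j)) ((?g ^^ j) \<eta>)" using ij by simp
    also have "\<dots> = \<eta>" using funpow_cancel[of ?f ?g 0 j, OF canc] by simp
    finally have "boundary_action (g ^^ (j - i)) \<eta> = \<eta>" by (simp add: boundary_action_funpow)
    then show ?thesis
      using loxodromic_power_fixed_point[OF g(2), of "j - i" \<eta>] ij \<eta> by (auto simp: A_def)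
  qed
  obtain g h where gh: "g \<in> generated_semigroup (set_pmf \<mu>)" "h \<in> generated_semigroup (set_pmf \<mu>)"
    "loxodromic g" "loxodromic h" "boundary_fixed_points x0 g \<inter> boundary_fixed_points x0 h = {}"
    using ne unfolding non_elementary_def by blast
  have "\<eta> \<in> boundary_fixed_points x0 g \<inter> boundary_fixed_points x0 h"
    using fixed gh \<eta> by (auto simp: boundary_fixed_points_def A_def)
  then show False using gh by blast
qed

section \<open>Shadows\<close>

text \<open>Shadows are taken in the union of \<open>X\<close> and its boundary, so that one
  concentration lemma serves the mean on \<open>X\<close>, via \<open>Inl\<close>, and measures on
  the boundary, via \<open>Inr\<close>.\<close>

definition Sh :: "'a + (nat \<Rightarrow> 'a) set \<Rightarrow> real \<Rightarrow> ('a + (nat \<Rightarrow> 'a) set) set" where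
  "Sh p R = {q \<in> BD. ereal R < E q p}"

lemma Sh_mono:
  assumes "R \<le> R'"
  shows "Sh p R' \<subseteq> Sh p R"
proof
  fix q assume "q \<in> Sh p R'"
  moreover have "ereal R \<le> ereal R'" using assms by simp
  ultimately show "q \<in> Sh p R" unfolding Sh_def using le_less_trans by blast
qed

text \<open>Only boundedly many heavy shadows can be disjoint, so by Ramsey's theorem infinitely many of
  them meet pairwise; their centres then converge. This replaces compactness of the space.\<close>

lemma heavy_shadows_concentrate:
  fixes m :: "('a + (nat \<Rightarrow> 'a) set) set \<Rightarrow> real"
  assumes mono: "\<And>A B. A \<subseteq> B \<Longrightarrow> m A \<le> m B"
    and disj: "\<And>(A :: nat \<Rightarrow> _) F. finite F \<Longrightarrow> disjoint_family_on A F \<Longrightarrow> (\<Sum>i\<in>F. m (A i)) \<le> 1"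
    and "\<epsilon> > 0" and heavy: "\<And>R. \<exists>z. \<epsilon> < m (Sh (Inl z) R)"
  shows "\<exists>\<eta>\<in>BX. \<forall>R. \<epsilon> < m (Sh (Inr \<eta>) R)"
proof -
  obtain z where z: "\<And>k::nat. \<epsilon> < m (Sh (Inl (z k)) (real k))"
  proof -
    have "\<forall>k::nat. \<exists>z. \<epsilon> < m (Sh (Inl z) (real k))" using heavy by blast
    then show thesis using that by metis
  qed
  define S where "S k = Sh (Inl (z k)) (real k)" for k
  \<comment> \<open>Ramsey colouring: a pair has colour 1 if its two shadows are disjoint.\<close>
  define col :: "nat set \<Rightarrow> nat" where
    "col X = (if \<exists>i\<in>X. \<exists>j\<in>X. i \<noteq> j \<and> S i \<inter> S j = {} then 1 else 0)" for X
  obtain Y t where Y: "infinite Y" "t < 2" "\<And>i j. i \<in> Y \<Longrightarrow> j \<in> Y \<Longrightarrow> i \<noteq> j \<Longrightarrow> col {i, j} = t"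
  proof -
    have "\<exists>Y t. Y \<subseteq> UNIV \<and> infinite Y \<and> t < 2 \<and> (\<forall>x\<in>Y. \<forall>y\<in>Y. x \<noteq> y \<longrightarrow> col {x, y} = t)"
      by (rule Ramsey2) (auto simp: col_def)
    then show thesis using that by blast
  qed
  have meet: "S i \<inter> S j \<noteq> {}" if ij: "i \<in> Y" "j \<in> Y" "i \<noteq> j" for i j
  proof
    assume "S i \<inter> S j = {}"
    then have "col {i, j} = 1" using ij by (auto simp: col_def)
    then have t1: "t = 1" using Y(3)[OF ij] by simp
    have disjY: "S k \<inter> S l = {}" if kl: "k \<in> Y" "l \<in> Y" "k \<noteq> l" for k l
    proof (rule ccontr)
      assume "S k \<inter> S l \<noteq> {}"
      moreover from this have "S l \<inter> S k \<noteq> {}" by blast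
      ultimately have "col {k, l} = 0" unfolding col_def by simp
      then show False using Y(3)[OF kl] t1 by simp
    qed
    \<comment> \<open>An infinite set of colour 1 would contain \<open>n\<close> disjoint sets of
      mass above \<epsilon>, more than the total mass allows.\<close>
    obtain n :: nat where n: "real n * \<epsilon> > 1"
      using reals_Archimedean3[OF \<open>\<epsilon> > 0\<close>] by blast
    obtain F where F: "F \<subseteq> Y" "finite F" "card F = n"
      using infinite_arbitrarily_large[OF Y(1)] by blast
    have "real n * \<epsilon> \<le> (\<Sum>k\<in>F. m (S k))"
      using sum_bounded_below[of F \<epsilon> "\<lambda>k. m (S k)"] F z by (auto simp: S_def less_imp_le)
    also have "\<dots> \<le> 1"
      using F disjY by (intro disj) (auto simp: disjoint_family_on_def)
    finally show False using n by simp
  qed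
  define r where "r = enumerate Y"
  have r: "strict_mono r" "\<And>k. r k \<in> Y"
    using strict_mono_enumerate[OF Y(1)] enumerate_in_set[OF Y(1)] by (auto simp: r_def)
  have rk: "k \<le> r k" for k using strict_mono_imp_increasing[OF r(1)] .
  have meet': "\<exists>q. q \<in> S (r i) \<inter> S (r j)" for i j
  \<comment> \<open>On the diagonal only nonemptiness is wanted; meeting the next shadow provides
    it.\<close>
  proof (cases "i = j")
    case True
    have "r i \<noteq> r (Suc i)" using r(1) by (simp add: strict_mono_eq)
    then show ?thesis using meet[OF r(2) r(2), of i "Suc i"] True by auto
  next
    case False
    then have "r i \<noteq> r j" using r(1) by (simp add: strict_mono_eq)
    then show ?thesis using meet[OF r(2) r(2)] by auto
  qed
  define u where "u k = z (r k)" for k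
  \<comment> \<open>Losses of the passage through a common point \<open>q\<close>: \<open>C1\<close>
    for \<open>E_commute\<close>, \<open>C1\<close> for \<open>E_tri\<close> and \<open>C0\<close>
    for \<open>E_Inl_Inl\<close>.\<close>
  have gu: "R < gp (u i) (u j)" if "real i \<ge> R + 2 * C1 + C0" "real j \<ge> R + 2 * C1 + C0" for i j R
  proof -
    obtain q where q: "q \<in> S (r i)" "q \<in> S (r j)" using meet' by blast
    define T where "T = R + 2 * C1 + C0"
    have "T \<le> real (r i)" "T \<le> real (r j)"
      using that rk[of i] rk[of j] unfolding T_def by linarith+
    then have qb: "q \<in> BD" "ereal T < E q (Inl (u i))" "ereal T < E q (Inl (u j))"
      using q Sh_mono[of T "real (r i)" "Inl (u i)"] Sh_mono[of T "real (r j)" "Inl (u j)"]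
      unfolding S_def u_def by (auto simp: Sh_def)
    have 1: "ereal (T - C1) < E (Inl (u i)) q"
      using E_commute[OF qb(1) _ qb(2)] by simp
    have "ereal (T - C1) \<le> ereal T" using C1_ge by simp
    then have 2: "ereal (T - C1) < E q (Inl (u j))" using qb(3) le_less_trans by blast
    have "ereal (T - C1 - C1) < E (Inl (u i)) (Inl (u j))"
      using E_tri[OF _ qb(1) _ 1 2] by simp
    from E_Inl_Inl(2)[OF this] show ?thesis by (simp add: T_def)
  qed
  have gs: "gseq u"
    unfolding gromov_sequence_iff
  proof
    fix R
    obtain N :: nat where "real N \<ge> R + 2 * C1 + C0" using real_arch_simple by blast
    then show "\<exists>N. \<forall>m\<ge>N. \<forall>n\<ge>N. R < gp (u m) (u n)"
      by (intro exI[of _ N] allI impI gu) (simp_all add: order_trans[OF _ of_nat_mono])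
  qed
  define \<eta> where "\<eta> = seq_class u"
  have \<eta>: "\<eta> \<in> BX" "u \<in> \<eta>" using seq_class[OF gs] by (auto simp: \<eta>_def)
  have "\<epsilon> < m (Sh (Inr \<eta>) R)" for R
  proof -
    obtain N where N: "\<forall>n\<ge>N. ereal (R + C1) < E (Inl (u n)) (Inr \<eta>)"
      using E_seq_tendsto[OF \<eta>] by blast
    obtain K :: nat where K: "real K \<ge> R + C1" using real_arch_simple by blast
    define k where "k = max N K"
    have "S (r k) \<subseteq> Sh (Inr \<eta>) R"
    proof
      fix q assume q: "q \<in> S (r k)"
      have "R + C1 \<le> real (r k)" using K rk[of k] by (simp add: k_def)
      then have "ereal (R + C1) < E q (Inl (u k))"
        using q Sh_mono[of "R + C1" "real (r k)" "Inl (u k)"] unfolding S_def u_def by (auto simp: Sh_def)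
      moreover have "ereal (R + C1) < E (Inl (u k)) (Inr \<eta>)" using N by (simp add: k_def)
      moreover have qb: "q \<in> BD" using q by (simp add: S_def Sh_def)
      ultimately have "ereal (R + C1 - C1) < E q (Inr \<eta>)"
        using \<eta>(1) by (intro E_tri[of q "Inl (u k)"]) auto
      then show "q \<in> Sh (Inr \<eta>) R" using qb by (simp add: Sh_def)
    qed
    then have "m (S (r k)) \<le> m (Sh (Inr \<eta>) R)" by (rule mono)
    moreover have "\<epsilon> < m (S (r k))" using z by (simp add: S_def)
    ultimately show ?thesis by linarith
  qed
  then show ?thesis using \<eta>(1) by blast
qed

text \<open>At a common point, \<open>2 * C1\<close> would pay for one \<open>E_commute\<close> and
  one \<open>E_tri\<close>, which together bring \<xi> and \<eta> too close.\<close>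

lemma Sh_disjoint:
  assumes "\<xi> \<in> BX" "\<eta> \<in> BX" "\<not> ereal R < E (Inr \<xi>) (Inr \<eta>)"
  shows "Sh (Inr \<xi>) (R + 2 * C1) \<inter> Sh (Inr \<eta>) (R + 2 * C1) = {}"
proof (rule ccontr)
  assume "Sh (Inr \<xi>) (R + 2 * C1) \<inter> Sh (Inr \<eta>) (R + 2 * C1) \<noteq> {}"
  then obtain q where q: "q \<in> BD" "ereal (R + 2 * C1) < E q (Inr \<xi>)" "ereal (R + 2 * C1) < E q (Inr \<eta>)"
    by (auto simp: Sh_def)
  have 1: "ereal (R + C1) < E (Inr \<xi>) q"
    using E_commute[OF q(1) _ q(2)] assms(1) by (simp add: add.commute)
  have "ereal (R + C1) \<le> ereal (R + 2 * C1)" using C1_ge by simp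
  then have 2: "ereal (R + C1) < E q (Inr \<eta>)" using q(3) le_less_trans by blast
  have "ereal (R + C1 - C1) < E (Inr \<xi>) (Inr \<eta>)"
    using E_tri[OF _ q(1) _ 1 2] assms by simp
  then show False using assms by simp
qed

end

section \<open>Stationary means\<close>

definition bounded_fun :: "('b \<Rightarrow> real) \<Rightarrow> bool" where
  "bounded_fun f \<longleftrightarrow> (\<exists>C. \<forall>x. \<bar>f x\<bar> \<le> C)"

text \<open>One step of the walk that composes new increments on the left. At each fixed time it has
  the same law as the walk with increments on the right, which is
  \<open>walk_distribution\<close>.\<close>

definition markov_op :: "('b \<Rightarrow> 'b) pmf \<Rightarrow> ('b \<Rightarrow> real) \<Rightarrow> 'b \<Rightarrow> real" where
  "markov_op \<mu> f x = avg \<mu> (\<lambda>s. f (s x))"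

lemma bounded_funI: "(\<And>x. \<bar>f x\<bar> \<le> C) \<Longrightarrow> bounded_fun f"
  by (auto simp: bounded_fun_def)

lemma bounded_fun_add: "bounded_fun f \<Longrightarrow> bounded_fun g \<Longrightarrow> bounded_fun (\<lambda>x. f x + g x)"
  unfolding bounded_fun_def by (metis abs_triangle_ineq add_mono order_trans)

lemma bounded_fun_scale: "bounded_fun f \<Longrightarrow> bounded_fun (\<lambda>x. c * f x)"
  unfolding bounded_fun_def by (metis abs_ge_zero abs_mult mult_left_mono)

lemma bounded_fun_indicator: "bounded_fun (indicator A)"
  by (rule bounded_funI[of _ 1]) (simp add: indicator_def)

lemma pmf_expectation_abs_le:
  fixes f :: "'b \<Rightarrow> real"
  assumes "\<And>x. \<bar>f x\<bar> \<le> C"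
  shows "\<bar>avg p f\<bar> \<le> C"
proof -
  have int: "integrable (measure_pmf p) f"
    using assms by (intro pmf_integrable_bounded)
  have "avg p f \<le> C"
    using assms by (intro measure_pmf.integral_le_const[OF int]) (auto simp: abs_le_iff)
  moreover have "-C \<le> avg p f"
    using assms by (intro measure_pmf.integral_ge_const[OF int] AE_I2) (metis abs_le_iff minus_le_iff)
  ultimately show ?thesis by linarith
qed

lemma markov_op_abs_le:
  assumes "\<And>x. \<bar>f x\<bar> \<le> C"
  shows "\<bar>markov_op \<mu> f x\<bar> \<le> C"
  unfolding markov_op_def by (rule pmf_expectation_abs_le) (rule assms)

lemma bounded_fun_markov_op: "bounded_fun f \<Longrightarrow> bounded_fun (markov_op \<mu> f)"
  unfolding bounded_fun_def using markov_op_abs_le by metis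

lemma markov_op_funpow_abs_le:
  assumes "\<And>x. \<bar>f x\<bar> \<le> C"
  shows "\<bar>(markov_op \<mu> ^^ n) f x\<bar> \<le> C"
  by (induction n arbitrary: x) (auto intro!: markov_op_abs_le assms)

lemma markov_op_funpow_add:
  assumes "bounded_fun f" "bounded_fun g"
  shows "(markov_op \<mu> ^^ n) (\<lambda>x. f x + g x) = (\<lambda>x. (markov_op \<mu> ^^ n) f x + (markov_op \<mu> ^^ n) g x)"
proof (induction n)
  case (Suc n)
  obtain C D where C: "\<And>x. \<bar>f x\<bar> \<le> C" "\<And>x. \<bar>g x\<bar> \<le> D"
    using assms unfolding bounded_fun_def by blast
  have "markov_op \<mu> (\<lambda>x. (markov_op \<mu> ^^ n) f x + (markov_op \<mu> ^^ n) g x) y =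
      markov_op \<mu> ((markov_op \<mu> ^^ n) f) y + markov_op \<mu> ((markov_op \<mu> ^^ n) g) y" for y
    unfolding markov_op_def[of _ _ y]
    by (intro Bochner_Integration.integral_add pmf_integrable_bounded[of _ _ C]
        pmf_integrable_bounded[of _ _ D] markov_op_funpow_abs_le C)
  then show ?case by (simp add: Suc.IH)
qed simp

lemma markov_op_funpow_scale:
  "(markov_op \<mu> ^^ n) (\<lambda>x. c * f x) = (\<lambda>x. c * (markov_op \<mu> ^^ n) f x)"
  by (induction n) (simp_all add: fun_eq_iff markov_op_def)

lemma markov_op_funpow_nonneg:
  assumes "\<And>x. 0 \<le> f x"
  shows "0 \<le> (markov_op \<mu> ^^ n) f x"
  by (induction n arbitrary: x) (auto simp: markov_op_def assms intro!: Bochner_Integration.integral_nonneg)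

lemma markov_op_funpow_const: "(markov_op \<mu> ^^ n) (\<lambda>_. c) = (\<lambda>_. c)"
  by (induction n) (simp_all add: fun_eq_iff markov_op_def)

definition cesaro :: "('b \<Rightarrow> 'b) pmf \<Rightarrow> 'b \<Rightarrow> nat \<Rightarrow> ('b \<Rightarrow> real) \<Rightarrow> real" where
  "cesaro \<mu> o0 n f = (\<Sum>k\<le>n. (markov_op \<mu> ^^ k) f o0) / real (Suc n)"

lemma cesaro_abs_le:
  assumes "\<And>x. \<bar>f x\<bar> \<le> C"
  shows "\<bar>cesaro \<mu> o0 n f\<bar> \<le> C"
proof -
  have "\<bar>\<Sum>k\<le>n. (markov_op \<mu> ^^ k) f o0\<bar> \<le> (\<Sum>k\<le>n. \<bar>(markov_op \<mu> ^^ k) f o0\<bar>)"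
    by (rule sum_abs)
  also have "\<dots> \<le> (\<Sum>k\<le>n. C)" by (intro sum_mono markov_op_funpow_abs_le assms)
  also have "\<dots> = real (Suc n) * C" by simp
  finally have "\<bar>\<Sum>k\<le>n. (markov_op \<mu> ^^ k) f o0\<bar> / real (Suc n) \<le> C"
    by (subst pos_divide_le_eq) (simp_all add: mult.commute)
  then show ?thesis by (simp add: cesaro_def abs_divide)
qed

text \<open>The difference of the two sums telescopes to two boundary terms; this is why averages
  over time, and not the laws at single times, become stationary in the limit.\<close>

lemma cesaro_markov_op:
  assumes "\<And>x. \<bar>f x\<bar> \<le> C"
  shows "\<bar>cesaro \<mu> o0 n (markov_op \<mu> f) - cesaro \<mu> o0 n f\<bar> \<le> 2 * C / real (Suc n)"
proof -
  have "(markov_op \<mu> ^^ k) (markov_op \<mu> f) = (markov_op \<mu> ^^ Suc k) f" for k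
    by (simp add: funpow_swap1)
  then have "(\<Sum>k\<le>n. (markov_op \<mu> ^^ k) (markov_op \<mu> f) o0) - (\<Sum>k\<le>n. (markov_op \<mu> ^^ k) f o0)
      = (\<Sum>k\<le>n. (markov_op \<mu> ^^ Suc k) f o0 - (markov_op \<mu> ^^ k) f o0)"
    by (simp only: sum_subtractf)
  also have "\<dots> = (markov_op \<mu> ^^ Suc n) f o0 - (markov_op \<mu> ^^ 0) f o0"
    by (induction n) (simp_all del: funpow.simps)
  finally have "cesaro \<mu> o0 n (markov_op \<mu> f) - cesaro \<mu> o0 n f
      = ((markov_op \<mu> ^^ Suc n) f o0 - f o0) / real (Suc n)"
    by (simp add: cesaro_def diff_divide_distrib[symmetric])
  moreover have "\<bar>(markov_op \<mu> ^^ Suc n) f o0 - f o0\<bar> \<le> 2 * C"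
    using markov_op_funpow_abs_le[where f = f and n = "Suc n" and \<mu> = \<mu> and x = o0, OF assms] assms[of o0] by linarith
  ultimately show ?thesis by (simp add: abs_divide divide_right_mono del: funpow.simps)
qed

text \<open>\<open>L_cluster\<close> is the only trace of the construction that is kept: it carries
  an upper bound for the mean back to the walk at a single time.\<close>

locale stationary_mean =
  fixes \<mu> :: "('b \<Rightarrow> 'b) pmf" and o0 :: 'b and L :: "('b \<Rightarrow> real) \<Rightarrow> real"
  assumes L_add: "\<And>f g. bounded_fun f \<Longrightarrow> bounded_fun g \<Longrightarrow> L (\<lambda>x. f x + g x) = L f + L g"
    and L_scale: "\<And>f c. bounded_fun f \<Longrightarrow> L (\<lambda>x. c * f x) = c * L f"
    and L_nonneg: "\<And>f. bounded_fun f \<Longrightarrow> (\<And>x. 0 \<le> f x) \<Longrightarrow> 0 \<le> L f"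
    and L_one: "L (\<lambda>_. 1) = 1"
    and L_stationary: "\<And>f. bounded_fun f \<Longrightarrow> L (markov_op \<mu> f) = L f"
    and L_cluster: "\<And>f \<epsilon>. bounded_fun f \<Longrightarrow> L f < \<epsilon> \<Longrightarrow> \<exists>n. (markov_op \<mu> ^^ n) f o0 < \<epsilon>"

text \<open>A cluster point of the Cesaro means, which exists by Tychonoff's theorem.\<close>

lemma stationary_mean_exists:
  fixes \<mu> :: "('b \<Rightarrow> 'b) pmf"
  shows "\<exists>L. stationary_mean \<mu> o0 L"
proof -
  \<comment> \<open>The value 0 on unbounded functions makes every coordinate a bounded sequence, so
    that all of them lie in one product of compact intervals.\<close>
  define c where "c n f = (if bounded_fun f then cesaro \<mu> o0 n f else 0)" for n f
  have "\<exists>C. \<forall>n. \<bar>c n f\<bar> \<le> C" for f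
  proof (cases "bounded_fun f")
    case True
    then obtain C where "\<And>x. \<bar>f x\<bar> \<le> C" by (auto simp: bounded_fun_def)
    then show ?thesis using cesaro_abs_le[of f C] True by (intro exI[of _ C]) (simp add: c_def)
  qed (auto simp: c_def)
  then obtain B where B: "\<And>f n. \<bar>c n f\<bar> \<le> B f" by metis
  define K where "K = PiE UNIV (\<lambda>f. {- B f..B f})"
  have "compactin (product_topology (\<lambda>f::'b \<Rightarrow> real. euclidean :: real topology) UNIV) K"
    unfolding K_def compactin_PiE by simp
  then have "compact K" by (simp add: euclidean_product_topology)
  moreover have "filtermap c sequentially \<noteq> bot" by (simp add: filtermap_bot_iff)
  moreover have "c n \<in> K" for n
    unfolding K_def using B[of n] by (auto simp: abs_le_iff minus_le_iff)
  then have "eventually (\<lambda>x. x \<in> K) (filtermap c sequentially)"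
    by (simp add: eventually_filtermap)
  ultimately obtain L where L: "inf (nhds L) (filtermap c sequentially) \<noteq> bot"
    unfolding compact_filter by blast
  \<comment> \<open>The product topology controls finitely many functions at once, at arbitrarily
    late indices. Every axiom concerns finitely many functions; only stationarity needs the index to
    be late.\<close>
  have approx: "\<exists>n\<ge>N. \<forall>f\<in>F. \<bar>c n f - L f\<bar> < \<epsilon>" if F: "finite F" "\<epsilon> > 0" for F N \<epsilon>
  proof -
    define W where "W = (\<Inter>f\<in>F. (\<lambda>L'. L' f) -` ball (L f) \<epsilon>)"
    have "open W"
      unfolding W_def using F(1)
      by (intro open_INT ballI open_vimage open_ball continuous_on_product_coordinates) auto
    moreover have "L \<in> W" using F by (simp add: W_def)
    ultimately have "eventually (\<lambda>x. x \<in> W) (nhds L)" by (rule eventually_nhds_in_open)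
    moreover have "eventually (\<lambda>x. \<exists>n\<ge>N. x = c n) (filtermap c sequentially)"
      unfolding eventually_filtermap eventually_sequentially by blast
    ultimately have "eventually (\<lambda>x. x \<in> W \<and> (\<exists>n\<ge>N. x = c n)) (inf (nhds L) (filtermap c sequentially))"
      unfolding eventually_inf by (intro exI[of _ "\<lambda>x. x \<in> W"] exI[of _ "\<lambda>x. \<exists>n\<ge>N. x = c n"]) blast
    then obtain x n where "x \<in> W" "n \<ge> N" "x = c n"
      using eventually_happens'[OF L] by blast
    then have "c n \<in> W" "n \<ge> N" by auto
    then show ?thesis by (intro exI[of _ n]) (auto simp: W_def dist_real_def abs_minus_commute)
  qed
  have zero: "x = 0" if "\<And>\<epsilon>. \<epsilon> > 0 \<Longrightarrow> \<bar>x\<bar> \<le> \<epsilon>" for x :: real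
    using that[of "\<bar>x\<bar> / 2"] by (cases "x = 0") auto
  have "stationary_mean \<mu> o0 L"
  proof
    fix f g :: "'b \<Rightarrow> real" assume fg: "bounded_fun f" "bounded_fun g"
    have "L (\<lambda>x. f x + g x) - (L f + L g) = 0"
    proof (rule zero)
      fix \<epsilon> :: real assume "\<epsilon> > 0"
      then obtain n where n: "\<forall>h\<in>{f, g, \<lambda>x. f x + g x}. \<bar>c n h - L h\<bar> < \<epsilon> / 3"
        using approx[of "{f, g, \<lambda>x. f x + g x}" "\<epsilon> / 3" 0] by auto
      have "c n (\<lambda>x. f x + g x) = c n f + c n g"
        using fg by (simp add: c_def bounded_fun_add cesaro_def markov_op_funpow_add sum.distrib add_divide_distrib)
      moreover have "\<bar>c n f - L f\<bar> < \<epsilon> / 3" "\<bar>c n g - L g\<bar> < \<epsilon> / 3"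
        "\<bar>c n (\<lambda>x. f x + g x) - L (\<lambda>x. f x + g x)\<bar> < \<epsilon> / 3" using n by auto
      ultimately show "\<bar>L (\<lambda>x. f x + g x) - (L f + L g)\<bar> \<le> \<epsilon>" by linarith
    qed
    then show "L (\<lambda>x. f x + g x) = L f + L g" by simp
  next
    fix f :: "'b \<Rightarrow> real" and r assume f: "bounded_fun f"
    have "L (\<lambda>x. r * f x) - r * L f = 0"
    proof (rule zero)
      fix \<epsilon> :: real assume "\<epsilon> > 0"
      define e where "e = \<epsilon> / (1 + \<bar>r\<bar>)"
      have "e > 0" using \<open>\<epsilon> > 0\<close> by (simp add: e_def)
      then obtain n where n: "\<forall>h\<in>{f, \<lambda>x. r * f x}. \<bar>c n h - L h\<bar> < e"
        using approx[of "{f, \<lambda>x. r * f x}" e 0] by auto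
      have eq: "c n (\<lambda>x. r * f x) = r * c n f"
        using f by (simp add: c_def bounded_fun_scale cesaro_def markov_op_funpow_scale sum_distrib_left)
      have "\<bar>r * c n f - r * L f\<bar> = \<bar>r\<bar> * \<bar>c n f - L f\<bar>"
        by (simp add: abs_mult[symmetric] right_diff_distrib)
      also have "\<dots> \<le> \<bar>r\<bar> * e" using n by (intro mult_left_mono) (auto intro: less_imp_le)
      finally have "\<bar>L (\<lambda>x. r * f x) - r * L f\<bar> \<le> e + \<bar>r\<bar> * e"
        using n eq by (auto simp: abs_le_iff abs_less_iff)
      also have "\<dots> = (1 + \<bar>r\<bar>) * e" by (simp add: distrib_right)
      also have "\<dots> = \<epsilon>" using abs_ge_zero[of r] unfolding e_def by simp
      finally show "\<bar>L (\<lambda>x. r * f x) - r * L f\<bar> \<le> \<epsilon>" .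
    qed
    then show "L (\<lambda>x. r * f x) = r * L f" by simp
  next
    fix f :: "'b \<Rightarrow> real" assume f: "bounded_fun f" and nn: "\<And>x. 0 \<le> f x"
    show "0 \<le> L f"
    proof (rule ccontr)
      assume "\<not> 0 \<le> L f"
      then obtain n where n: "\<bar>c n f - L f\<bar> < - L f" using approx[of "{f}" "- L f" 0] by auto
      have "0 \<le> c n f"
        using f nn by (auto simp: c_def cesaro_def intro!: divide_nonneg_nonneg sum_nonneg markov_op_funpow_nonneg)
      then show False using n by linarith
    qed
  next
    have "L (\<lambda>_. 1) - 1 = 0"
    proof (rule zero)
      fix \<epsilon> :: real assume "\<epsilon> > 0"
      then obtain n where n: "\<bar>c n (\<lambda>_. 1) - L (\<lambda>_. 1)\<bar> < \<epsilon>" using approx[of "{\<lambda>_. 1}" \<epsilon> 0] by auto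
      have "c n (\<lambda>_. 1) = 1"
        by (simp add: c_def cesaro_def markov_op_funpow_const bounded_funI[of _ 1])
      then show "\<bar>L (\<lambda>_. 1) - 1\<bar> \<le> \<epsilon>" using n by linarith
    qed
    then show "L (\<lambda>_. 1) = 1" by simp
  next
    fix f :: "'b \<Rightarrow> real" assume f: "bounded_fun f"
    then obtain C where C: "\<And>x. \<bar>f x\<bar> \<le> C" by (auto simp: bounded_fun_def)
    have "L (markov_op \<mu> f) - L f = 0"
    proof (rule zero)
      fix \<epsilon> :: real assume \<epsilon>: "\<epsilon> > 0"
      obtain N :: nat where N: "2 * C < real N * (\<epsilon> / 3)"
        using reals_Archimedean3[of "\<epsilon> / 3"] \<epsilon> by (metis divide_pos_pos zero_less_numeral)
      obtain n where n: "n \<ge> N" "\<forall>h\<in>{f, markov_op \<mu> f}. \<bar>c n h - L h\<bar> < \<epsilon> / 3"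
        using approx[of "{f, markov_op \<mu> f}" "\<epsilon> / 3" N] \<epsilon> by auto
      have "real N * (\<epsilon> / 3) \<le> real (Suc n) * (\<epsilon> / 3)"
        using n \<epsilon> by (intro mult_right_mono) auto
      then have "2 * C / real (Suc n) \<le> \<epsilon> / 3"
        using N by (subst pos_divide_le_eq) (simp_all add: mult.commute)
      then have "\<bar>c n (markov_op \<mu> f) - c n f\<bar> \<le> \<epsilon> / 3"
        using cesaro_markov_op[where f = f and \<mu> = \<mu> and n = n and ?o0.0 = o0, OF C] f bounded_fun_markov_op[OF f, of \<mu>] by (simp add: c_def)
      moreover have "\<bar>c n f - L f\<bar> < \<epsilon> / 3" "\<bar>c n (markov_op \<mu> f) - L (markov_op \<mu> f)\<bar> < \<epsilon> / 3"
        using n by auto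
      ultimately show "\<bar>L (markov_op \<mu> f) - L f\<bar> \<le> \<epsilon>" by linarith
    qed
    then show "L (markov_op \<mu> f) = L f" by simp
  next
    fix f :: "'b \<Rightarrow> real" and \<epsilon> assume f: "bounded_fun f" "L f < \<epsilon>"
    then obtain n where n: "\<bar>c n f - L f\<bar> < \<epsilon> - L f" using approx[of "{f}" "\<epsilon> - L f" 0] by auto
    show "\<exists>n. (markov_op \<mu> ^^ n) f o0 < \<epsilon>"
    proof (rule ccontr)
      assume "\<not> ?thesis"
      then have "(\<Sum>k\<le>n. \<epsilon>) \<le> (\<Sum>k\<le>n. (markov_op \<mu> ^^ k) f o0)"
        by (intro sum_mono) (auto simp: not_less)
      then have "\<epsilon> \<le> cesaro \<mu> o0 n f"
        unfolding cesaro_def by (subst pos_le_divide_eq) (simp_all add: mult.commute)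
      then show False using n f by (simp add: c_def)
    qed
  qed
  then show ?thesis by blast
qed

section \<open>Finite approximation of expectations\<close>

lemma pmf_finite_approx:
  assumes "\<epsilon> > (0::real)"
  shows "\<exists>T. finite T \<and> 1 - \<epsilon> < measure_pmf.prob p T"
proof -
  define f where "f = from_nat_into (set_pmf p)"
  have range: "range f = set_pmf p"
    unfolding f_def by (intro range_from_nat_into set_pmf_not_empty countable_set_pmf)
  have "(\<lambda>n. measure_pmf.prob p (f ` {..n})) \<longlonglongrightarrow> measure_pmf.prob p (\<Union>n. f ` {..n})"
    by (intro measure_pmf.finite_Lim_measure_incseq) (auto simp: incseq_def)
  moreover have "(\<Union>n. f ` {..n}) = f ` (\<Union>n. {..n})" by blast
  then have "(\<Union>n. f ` {..n}) = set_pmf p" using range by (simp add: UN_atMost_UNIV)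
  moreover have "measure_pmf.prob p (set_pmf p) = 1"
    by (simp add: measure_pmf.prob_eq_1 AE_measure_pmf)
  ultimately have "(\<lambda>n. measure_pmf.prob p (f ` {..n})) \<longlonglongrightarrow> 1" by simp
  then have "\<forall>\<^sub>F n in sequentially. 1 - \<epsilon> < measure_pmf.prob p (f ` {..n})"
    using assms by (intro order_tendstoD(1)) auto
  then obtain n where "1 - \<epsilon> < measure_pmf.prob p (f ` {..n})"
    using eventually_happens'[OF sequentially_bot] by blast
  then show ?thesis by (intro exI[of _ "f ` {..n}"]) simp
qed

lemma pmf_expectation_finite_approx:
  fixes f :: "'b \<Rightarrow> real"
  assumes "\<And>x. \<bar>f x\<bar> \<le> C" "finite T"
  shows "\<bar>avg p f - (\<Sum>s\<in>T. pmf p s * f s)\<bar> \<le> C * (1 - measure_pmf.prob p T)"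
proof -
  have "(\<Sum>s\<in>T. pmf p s * f s) = avg p (\<lambda>s. f s * indicator T s)"
    using assms(2) by (subst integral_measure_pmf_real[of T]) (auto simp: indicator_def mult.commute)
  also have "avg p f - \<dots> = avg p (\<lambda>s. f s - f s * indicator T s)"
    using assms(1) by (intro Bochner_Integration.integral_diff[symmetric] pmf_integrable_bounded[of _ _ C])
      (auto simp: indicator_def order_trans[OF abs_ge_zero assms(1)])
  also have "\<bar>\<dots>\<bar> \<le> avg p (\<lambda>s. \<bar>f s - f s * indicator T s\<bar>)"
    by (rule integral_abs_bound)
  also have "\<dots> \<le> avg p (\<lambda>s. C * indicator (- T) s)"
    using assms(1) by (intro integral_mono pmf_integrable_bounded[of _ _ C])
      (auto simp: indicator_def order_trans[OF abs_ge_zero assms(1)])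
  also have "\<dots> = C * measure_pmf.prob p (- T)" by simp
  also have "measure_pmf.prob p (- T) = 1 - measure_pmf.prob p T"
    using measure_pmf.prob_compl[of T p] by (simp add: Compl_eq_Diff_UNIV)
  finally show ?thesis .
qed

context stationary_mean
begin

lemma L_diff:
  assumes "bounded_fun f" "bounded_fun g"
  shows "L (\<lambda>x. f x - g x) = L f - L g"
  using L_add[OF assms(1) bounded_fun_scale[OF assms(2), of "-1"]] L_scale[OF assms(2), of "-1"] by simp

lemma L_mono:
  assumes "bounded_fun f" "bounded_fun g" "\<And>x. f x \<le> g x"
  shows "L f \<le> L g"
proof -
  have "bounded_fun (\<lambda>x. g x - f x)"
    using bounded_fun_add[OF assms(2) bounded_fun_scale[OF assms(1), of "-1"]] by simp
  then have "0 \<le> L (\<lambda>x. g x - f x)" using assms(3) by (intro L_nonneg) simp_all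
  then show ?thesis using L_diff[OF assms(2,1)] by simp
qed

lemma L_const: "L (\<lambda>_. c) = c"
  using L_scale[of "\<lambda>_. 1" c] L_one by (simp add: bounded_funI[of _ 1])

lemma L_abs_le:
  assumes "\<And>x. \<bar>f x\<bar> \<le> C"
  shows "\<bar>L f\<bar> \<le> C"
proof -
  have f: "bounded_fun f" using assms by (rule bounded_funI)
  have c: "bounded_fun (\<lambda>_::'b. c)" for c :: real by (rule bounded_funI[of _ "\<bar>c\<bar>"]) simp
  have "L f \<le> C" using L_mono[OF f c, of C] assms by (simp add: L_const abs_le_iff)
  moreover have "-C \<le> L f"
    using L_mono[OF c f, of "-C"] assms by (simp add: L_const abs_le_iff minus_le_iff)
  ultimately show ?thesis by linarith
qed

lemma L_sum:
  assumes "finite T" "\<And>s. s \<in> T \<Longrightarrow> bounded_fun (F s)"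
  shows "bounded_fun (\<lambda>x. \<Sum>s\<in>T. F s x) \<and> L (\<lambda>x. \<Sum>s\<in>T. F s x) = (\<Sum>s\<in>T. L (F s))"
  using assms
proof (induction T)
  case empty
  then show ?case by (simp add: L_const bounded_funI[of _ 0])
next
  case (insert s T)
  then show ?case using L_add[of "F s" "\<lambda>x. \<Sum>s\<in>T. F s x"] by (simp add: bounded_fun_add)
qed

text \<open>Finite additivity gives no Fubini theorem. The discrete expectation is however a uniform
  limit of finite sums, with error governed by the mass outside a finite set, and \<open>L\<close>
  is continuous in the supremum norm.\<close>

lemma L_expectation:
  assumes C: "\<And>s x. \<bar>F s x\<bar> \<le> C"
  shows "L (\<lambda>x. avg p (\<lambda>s. F s x)) = avg p (\<lambda>s. L (F s))"
proof -
  have C0: "C \<ge> 0" using order_trans[OF abs_ge_zero C] by blast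
  have bF: "bounded_fun (F s)" for s using C by (rule bounded_funI)
  have bE: "bounded_fun (\<lambda>x. avg p (\<lambda>s. F s x))"
    by (rule bounded_funI[of _ C]) (intro pmf_expectation_abs_le C)
  have le: "\<bar>L (\<lambda>x. avg p (\<lambda>s. F s x)) - avg p (\<lambda>s. L (F s))\<bar> \<le> \<epsilon>"
    if "\<epsilon> > 0" for \<epsilon>
  proof -
    \<comment> \<open>\<open>C + 1\<close> instead of \<open>C\<close> avoids a division by
      zero.\<close>
    define e where "e = \<epsilon> / (2 * (C + 1))"
    have "e > 0" using that C0 by (simp add: e_def)
    then obtain T where T: "finite T" "1 - e < measure_pmf.prob p T" using pmf_finite_approx by blast
    have small: "C * (1 - measure_pmf.prob p T) \<le> \<epsilon> / 2"
    proof -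
      have "C * (1 - measure_pmf.prob p T) \<le> (C + 1) * e"
        using T C0 by (intro mult_mono) auto
      also have "\<dots> = \<epsilon> / 2" using C0 by (simp add: e_def field_simps)
      finally show ?thesis .
    qed
    have S: "bounded_fun (\<lambda>x. \<Sum>s\<in>T. pmf p s * F s x)"
      "L (\<lambda>x. \<Sum>s\<in>T. pmf p s * F s x) = (\<Sum>s\<in>T. pmf p s * L (F s))"
      using L_sum[OF T(1), of "\<lambda>s x. pmf p s * F s x"] by (simp_all add: bF bounded_fun_scale L_scale)
    have "\<bar>L (\<lambda>x. avg p (\<lambda>s. F s x) - (\<Sum>s\<in>T. pmf p s * F s x))\<bar> \<le> \<epsilon> / 2"
      by (intro L_abs_le order_trans[OF pmf_expectation_finite_approx[OF C T(1)] small])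
    then have "\<bar>L (\<lambda>x. avg p (\<lambda>s. F s x)) - (\<Sum>s\<in>T. pmf p s * L (F s))\<bar> \<le> \<epsilon> / 2"
      by (simp add: L_diff[OF bE S(1)] S(2))
    moreover have "\<bar>avg p (\<lambda>s. L (F s)) - (\<Sum>s\<in>T. pmf p s * L (F s))\<bar> \<le> \<epsilon> / 2"
      by (intro order_trans[OF pmf_expectation_finite_approx[OF L_abs_le[OF C] T(1)] small])
    ultimately show ?thesis by linarith
  qed
  show ?thesis
  proof (rule ccontr)
    assume "\<not> ?thesis"
    then show False
      using le[of "\<bar>L (\<lambda>x. avg p (\<lambda>s. F s x)) - avg p (\<lambda>s. L (F s))\<bar> / 2"]
      by auto
  qed
qed

section \<open>The finitely additive mass of a set\<close>

definition mass :: "'b set \<Rightarrow> real" where "mass A = L (indicator A)"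

lemma mass_nonneg: "0 \<le> mass A"
  unfolding mass_def by (intro L_nonneg bounded_fun_indicator) simp

lemma mass_mono: "A \<subseteq> B \<Longrightarrow> mass A \<le> mass B"
  unfolding mass_def by (intro L_mono bounded_fun_indicator) (auto simp: indicator_def)

lemma mass_UNIV: "mass UNIV = 1"
  unfolding mass_def by (simp add: indicator_UNIV L_one)

lemma mass_le_1: "mass A \<le> 1"
  using mass_mono[of A UNIV] mass_UNIV by simp

lemma mass_compl: "mass (- A) = 1 - mass A"
proof -
  have "indicator (- A) = (\<lambda>x. 1 - indicator A x :: real)" by (auto simp: indicator_def)
  then show ?thesis
    unfolding mass_def using L_diff[OF bounded_funI[of "\<lambda>_. 1" 1] bounded_fun_indicator[of A]]
    by (simp add: L_one)
qed

lemma mass_disjoint_family: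
  assumes "finite F" "disjoint_family_on A F"
  shows "(\<Sum>i\<in>F. mass (A i)) \<le> 1"
proof -
  have "(\<Sum>i\<in>F. mass (A i)) = L (\<lambda>x. \<Sum>i\<in>F. indicator (A i) x)"
    unfolding mass_def using L_sum[OF assms(1), of "\<lambda>i. indicator (A i)"] by (simp add: bounded_fun_indicator)
  also have "(\<lambda>x. \<Sum>i\<in>F. indicator (A i) x :: real) = indicator (\<Union>i\<in>F. A i)"
    by (intro ext) (rule indicator_UN_disjoint[OF assms, symmetric])
  also have "L \<dots> \<le> 1" using mass_le_1 by (simp add: mass_def)
  finally show ?thesis .
qed

lemma mass_stationary: "mass A = avg \<mu> (\<lambda>s. mass (s -` A))"
proof -
  have "mass A = L (markov_op \<mu> (indicator A))"
    unfolding mass_def by (rule L_stationary[OF bounded_fun_indicator, symmetric])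
  also have "markov_op \<mu> (indicator A) = (\<lambda>x. avg \<mu> (\<lambda>s. indicator (s -` A) x))"
    by (auto simp: markov_op_def indicator_def fun_eq_iff)
  also have "L \<dots> = avg \<mu> (\<lambda>s. L (indicator (s -` A)))"
    by (rule L_expectation[of _ 1]) (simp add: indicator_def)
  finally show ?thesis by (simp add: mass_def)
qed

lemma mass_abs_le: "\<bar>mass A\<bar> \<le> 1"
  using mass_nonneg[of A] mass_le_1[of A] by simp

text \<open>A maximum principle for a supremum that need not be attained: going to the preimage
  under a support element \<open>t\<close> multiplies the deficit \<open>b - mass\<close> by at most
  1 / \<open>pmf \<mu> t\<close>, and such factors multiply along products. The factor depends on
  \<open>t\<close> and not on the set.\<close>

lemma mass_near_maximal:
  assumes fam: "\<And>s A. s \<in> set_pmf \<mu> \<Longrightarrow> A \<in> \<F> \<Longrightarrow> s -` A \<in> \<F>"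
    and max: "\<And>A. A \<in> \<F> \<Longrightarrow> mass A \<le> b"
    and t: "t \<in> generated_semigroup (set_pmf \<mu>)"
  shows "\<exists>c>0. \<forall>A\<in>\<F>. t -` A \<in> \<F> \<and> c * (b - mass (t -` A)) \<le> b - mass A"
  using t
proof induction
  case (incl t)
  have "pmf \<mu> t * (b - mass (t -` A)) \<le> b - mass A" if A: "A \<in> \<F>" for A
  proof -
    have "pmf \<mu> t * (b - mass (t -` A)) \<le> avg \<mu> (\<lambda>s. b - mass (s -` A))"
      by (rule pmf_point_le_expectation[of \<mu> _ b]) (use fam max A mass_nonneg in auto)
    also have "\<dots> = b - avg \<mu> (\<lambda>s. mass (s -` A))"
      by (subst Bochner_Integration.integral_diff)
        (auto intro: pmf_integrable_bounded[of _ _ "\<bar>b\<bar>"] pmf_integrable_bounded[of _ _ 1] mass_abs_le)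
    also have "\<dots> = b - mass A" using mass_stationary[of A] by simp
    finally show ?thesis .
  qed
  moreover have "pmf \<mu> t > 0" using incl by (simp add: pmf_positive)
  ultimately show ?case using fam incl by blast
next
  case (comp g h)
  obtain c where c: "c > 0" "\<And>A. A \<in> \<F> \<Longrightarrow> g -` A \<in> \<F> \<and> c * (b - mass (g -` A)) \<le> b - mass A"
    using comp.IH(1) by blast
  obtain d where d: "d > 0" "\<And>A. A \<in> \<F> \<Longrightarrow> h -` A \<in> \<F> \<and> d * (b - mass (h -` A)) \<le> b - mass A"
    using comp.IH(2) by blast
  have "(g \<circ> h) -` A \<in> \<F> \<and> c * d * (b - mass ((g \<circ> h) -` A)) \<le> b - mass A" if A: "A \<in> \<F>" for A
  proof -
    have gA: "g -` A \<in> \<F>" using c A by blast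
    have "c * (d * (b - mass (h -` (g -` A)))) \<le> c * (b - mass (g -` A))"
      using d(2)[OF gA] c(1) by (intro mult_left_mono) auto
    also have "\<dots> \<le> b - mass A" using c A by blast
    finally have "c * d * (b - mass (h -` (g -` A))) \<le> b - mass A" by (simp add: mult.assoc)
    moreover have "(g \<circ> h) -` A = h -` (g -` A)" by auto
    ultimately show ?thesis using d(2)[OF gA] by metis
  qed
  moreover have "c * d > 0" using c(1) d(1) by simp
  ultimately show ?case by blast
qed

end

text \<open>By subadditivity d(x, g^(nk) x) \<le> k d(x, g^n x); dividing by nk and letting k grow
  bounds the limit. The bound is the same for all \<open>x\<close>.\<close>

lemma loxodromic_translation:
  assumes "loxodromic g"
  obtains \<tau> where "\<tau> > 0" "\<And>x n. real n * \<tau> \<le> dist x ((g ^^ n) x)"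
proof -
  obtain \<tau> where \<tau>: "\<tau> > 0" "\<And>x. (\<lambda>n. dist x ((g ^^ n) x) / real n) \<longlonglongrightarrow> \<tau>"
    using assms by (auto simp: loxodromic_def)
  have g: "isometry g" using assms by (simp add: loxodromic_def)
  have "real n * \<tau> \<le> dist x ((g ^^ n) x)" for x n
  proof (cases "n = 0")
    case False
    have le: "dist x ((g ^^ (n * k)) x) \<le> real k * dist x ((g ^^ n) x)" for k
    proof (induction k)
      case (Suc k)
      have eq: "(g ^^ (n * Suc k)) x = (g ^^ n) ((g ^^ (n * k)) x)"
        by (simp add: funpow_add)
      have "dist x ((g ^^ (n * Suc k)) x) \<le> dist x ((g ^^ n) x) + dist ((g ^^ n) x) ((g ^^ n) ((g ^^ (n * k)) x))"
        unfolding eq by (rule dist_triangle)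
      also have "dist ((g ^^ n) x) ((g ^^ n) ((g ^^ (n * k)) x)) = dist x ((g ^^ (n * k)) x)"
        by (rule isometryD(1)[OF isometry_funpow[OF g]])
      finally show ?case using Suc.IH unfolding of_nat_Suc distrib_right by linarith
    qed simp
    have "strict_mono (\<lambda>k. n * k)" using False by (simp add: strict_mono_def)
    from LIMSEQ_subseq_LIMSEQ[OF \<tau>(2)[of x] this]
    have "(\<lambda>k. dist x ((g ^^ (n * k)) x) / real (n * k)) \<longlonglongrightarrow> \<tau>" by (simp add: comp_def)
    moreover have "\<exists>N. \<forall>k\<ge>N. dist x ((g ^^ (n * k)) x) / real (n * k) \<le> dist x ((g ^^ n) x) / real n"
    proof (intro exI[of _ 1] allI impI)
      fix k :: nat assume "k \<ge> 1"
      then show "dist x ((g ^^ (n * k)) x) / real (n * k) \<le> dist x ((g ^^ n) x) / real n"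
        using le[of k] False by (simp add: field_simps)
    qed
    ultimately have "\<tau> \<le> dist x ((g ^^ n) x) / real n" by (rule LIMSEQ_le_const2)
    then show ?thesis using False by (simp add: field_simps)
  qed simp
  then show thesis using that \<tau>(1) by blast
qed

lemma isometry_vimage_cball:
  assumes "isometry s"
  shows "s -` cball x K = cball (ginv s x) K"
proof -
  have "dist (ginv s x) y = dist x (s y)" for y
    using isometryD(1)[OF assms, of "ginv s x" y] by (simp add: isometry_inv_apply[OF assms])
  then show ?thesis by auto
qed

locale hyperbolic_mean = hyperbolic x0 \<delta> + stationary_mean \<mu> x0 L
  for x0 :: "'a::metric_space" and \<delta> \<mu> L +
  assumes iso: "\<And>s. s \<in> set_pmf \<mu> \<Longrightarrow> isometry s"
    and ne: "non_elementary x0 (generated_semigroup (set_pmf \<mu>))"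
begin

text \<open>Powers of a loxodromic element move a heavy ball off itself arbitrarily often.\<close>

lemma mass_ball: "mass (cball x K) = 0"
proof (rule ccontr)
  assume "mass (cball x K) \<noteq> 0"
  define \<F> where "\<F> = range (\<lambda>x::'a. cball x K)"
  define b where "b = (SUP x. mass (cball x K))"
  have bdd: "bdd_above (range (\<lambda>x. mass (cball x K)))"
    by (rule bdd_aboveI[of _ 1]) (auto simp: mass_le_1)
  have upper: "mass (cball y K) \<le> b" for y unfolding b_def by (rule cSUP_upper[OF _ bdd]) simp
  have b: "b > 0" using upper[of x] mass_nonneg[of "cball x K"] \<open>mass (cball x K) \<noteq> 0\<close> by linarith
  obtain g where g: "g \<in> generated_semigroup (set_pmf \<mu>)" "loxodromic g"
    using ne unfolding non_elementary_def by blast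
  have ig: "isometry g" using g(2) by (simp add: loxodromic_def)
  obtain \<tau> where \<tau>: "\<tau> > 0" "\<And>x n. real n * \<tau> \<le> dist x ((g ^^ n) x)"
    using loxodromic_translation[OF g(2)] by blast
  \<comment> \<open>Positive powers of \<open>g ^^ p\<close> then move every point by more than
    \<open>2 * K\<close>, the largest distance possible inside the ball.\<close>
  obtain p :: nat where p: "2 * K < real p * \<tau>" using reals_Archimedean3[OF \<tau>(1)] by blast
  obtain n :: nat where n: "real n * (b / 2) > 1" using reals_Archimedean3[of "b / 2"] b by (metis half_gt_zero)
  \<comment> \<open>The successor keeps the exponent positive: the generated semigroup is closed
    under positive powers only.\<close>
  define t where "t i = g ^^ Suc (p * i)" for i
  have "\<exists>c>0. \<forall>A\<in>\<F>. t i -` A \<in> \<F> \<and> c * (b - mass (t i -` A)) \<le> b - mass A" for i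
  proof (rule mass_near_maximal)
    fix s A assume "s \<in> set_pmf \<mu>" "A \<in> \<F>"
    then show "s -` A \<in> \<F>" using isometry_vimage_cball[OF iso] by (auto simp: \<F>_def)
  qed (auto simp: \<F>_def t_def upper intro!: generated_semigroup_funpow g simp del: funpow.simps)
  then obtain c where c: "\<And>i. c i > 0" "\<And>i y. c i * (b - mass (t i -` cball y K)) \<le> b - mass (cball y K)"
    unfolding \<F>_def by (metis rangeI)
  define c0 where "c0 = Min (c ` {..n})"
  have c0: "c0 > 0" "\<And>i. i \<le> n \<Longrightarrow> c0 \<le> c i" using c(1) by (auto simp: c0_def)
  \<comment> \<open>One ball is chosen so close to the supremum that all its preimages under the
    finitely many \<open>t i\<close> still have mass at least \<open>b / 2\<close>.\<close>
  have "b - c0 * (b / 2) < b" using c0 b by simp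
  then obtain y where y: "b - c0 * (b / 2) < mass (cball y K)"
    unfolding b_def less_cSUP_iff[OF UNIV_not_empty bdd] by blast
  have big: "b / 2 \<le> mass (t i -` cball y K)" if "i \<le> n" for i
  proof (rule ccontr)
    assume "\<not> ?thesis"
    then have "c0 * (b / 2) \<le> c i * (b - mass (t i -` cball y K))"
      using c0 c(1)[of i] b that by (intro mult_mono) (auto intro: less_imp_le)
    then show False using c(2)[of i y] y by linarith
  qed
  \<comment> \<open>A common point \<open>v\<close> would place both \<open>t i v\<close> and its
    image \<open>t j v\<close> under a positive power of \<open>g ^^ p\<close> into the same
    ball.\<close>
  have disj: "disjoint_family_on (\<lambda>i. t i -` cball y K) {..<n}"
  proof -
    have False if "i < j" "v \<in> t i -` cball y K" "v \<in> t j -` cball y K" for i j v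
    proof -
      have "dist (t i v) (t j v) \<le> 2 * K"
        using that dist_triangle[of "t i v" "t j v" y] by (auto simp: dist_commute)
      moreover obtain d where d: "j = i + Suc d" using \<open>i < j\<close> less_imp_Suc_add by auto
      have "t j = (g ^^ (p * Suc d)) \<circ> t i"
        unfolding t_def d funpow_add[symmetric] by (simp add: algebra_simps)
      then have "real (p * Suc d) * \<tau> \<le> dist (t i v) (t j v)"
        using \<tau>(2)[of "p * Suc d" "t i v"] by simp
      moreover have "real p * \<tau> \<le> real (p * Suc d) * \<tau>" using \<tau>(1) by (intro mult_right_mono) auto
      ultimately show False using p by linarith
    qed
    then show ?thesis unfolding disjoint_family_on_def by (metis disjoint_iff linorder_neqE_nat)
  qed
  have "real n * (b / 2) \<le> (\<Sum>i<n. mass (t i -` cball y K))"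
    using sum_bounded_below[of "{..<n}" "b / 2" "\<lambda>i. mass (t i -` cball y K)"] big by simp
  also have "\<dots> \<le> 1" by (rule mass_disjoint_family[OF _ disj]) simp
  finally show False using n by simp
qed

section \<open>Atoms of the mean at boundary points\<close>

definition near :: "(nat \<Rightarrow> 'a) set \<Rightarrow> real \<Rightarrow> 'a set" where
  "near \<zeta> R = {x. ereal R < E (Inl x) (Inr \<zeta>)}"

text \<open>An infimum and not the mass of an intersection: no point of \<open>X\<close> lies in all
  neighbourhoods of \<zeta>, and the mean is only finitely additive.\<close>

definition atom :: "(nat \<Rightarrow> 'a) set \<Rightarrow> real" where
  "atom \<zeta> = (INF n. mass (near \<zeta> (real n)))"

lemma near_eq: "near \<zeta> R = Inl -` Sh (Inr \<zeta>) R"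
  by (auto simp: near_def Sh_def)

lemma near_antimono: "R \<le> R' \<Longrightarrow> near \<zeta> R' \<subseteq> near \<zeta> R"
  unfolding near_eq using Sh_mono by blast

lemma near_bdd: "bdd_below (range (\<lambda>n. mass (near \<zeta> (real n))))"
  by (rule bdd_belowI[of _ 0]) (auto simp: mass_nonneg)

lemma atom_le: "atom \<zeta> \<le> mass (near \<zeta> R)"
proof -
  obtain n :: nat where n: "R \<le> real n" using real_arch_simple by blast
  have "atom \<zeta> \<le> mass (near \<zeta> (real n))"
    unfolding atom_def by (rule cINF_lower[OF near_bdd]) simp
  also have "\<dots> \<le> mass (near \<zeta> R)" by (intro mass_mono near_antimono n)
  finally show ?thesis .
qed

lemma atom_nonneg: "0 \<le> atom \<zeta>"
  unfolding atom_def by (rule cINF_greatest) (auto simp: mass_nonneg)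

text \<open>Finitely many distinct boundary points have disjoint neighbourhoods of one common
  radius, whose masses add up to at most 1.\<close>

lemma atom_sum:
  assumes F: "finite F" "F \<subseteq> BX"
  shows "(\<Sum>\<zeta>\<in>F. atom \<zeta>) \<le> 1"
proof -
  \<comment> \<open>The extra alternatives make the statement true for all pairs, so that a total
    choice function \<open>r\<close> exists.\<close>
  have "\<exists>R. \<not> ereal R < E (Inr \<xi>) (Inr \<eta>) \<or> \<xi> = \<eta> \<or> \<xi> \<notin> BX \<or> \<eta> \<notin> BX" for \<xi> \<eta>
    using E_distinct[of \<xi> \<eta>] by blast
  then obtain r where r: "\<And>\<xi> \<eta>. \<not> ereal (r \<xi> \<eta>) < E (Inr \<xi>) (Inr \<eta>) \<or> \<xi> = \<eta> \<or> \<xi> \<notin> BX \<or> \<eta> \<notin> BX"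
    by metis
  define R where "R = Max (insert 0 ((\<lambda>(\<xi>, \<eta>). r \<xi> \<eta>) ` (F \<times> F)))"
  have R: "r \<xi> \<eta> \<le> R" if "\<xi> \<in> F" "\<eta> \<in> F" for \<xi> \<eta>
    unfolding R_def using that F(1) by (intro Max_ge) (auto intro!: rev_image_eqI[of "(\<xi>, \<eta>)"])
  have "disjoint_family_on (\<lambda>\<zeta>. near \<zeta> (R + 2 * C1)) F"
    unfolding disjoint_family_on_def
  proof (intro ballI impI)
    fix \<xi> \<eta> assume *: "\<xi> \<in> F" "\<eta> \<in> F" "\<xi> \<noteq> \<eta>"
    have "\<not> ereal (r \<xi> \<eta>) < E (Inr \<xi>) (Inr \<eta>)" using r[of \<xi> \<eta>] * F by blast
    moreover have "ereal (r \<xi> \<eta>) \<le> ereal R" using R * by simp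
    ultimately have "\<not> ereal R < E (Inr \<xi>) (Inr \<eta>)" using le_less_trans by blast
    then have "Sh (Inr \<xi>) (R + 2 * C1) \<inter> Sh (Inr \<eta>) (R + 2 * C1) = {}"
      using * F by (intro Sh_disjoint) auto
    then show "near \<xi> (R + 2 * C1) \<inter> near \<eta> (R + 2 * C1) = {}"
      unfolding near_eq by blast
  qed
  then have "(\<Sum>\<zeta>\<in>F. mass (near \<zeta> (R + 2 * C1))) \<le> 1" using F by (intro mass_disjoint_family)
  moreover have "(\<Sum>\<zeta>\<in>F. atom \<zeta>) \<le> (\<Sum>\<zeta>\<in>F. mass (near \<zeta> (R + 2 * C1)))"
    by (intro sum_mono atom_le)
  ultimately show ?thesis by linarith
qed

text \<open>Dominated convergence lets the radius tend to infinity inside the average over \<mu>.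
  The inequality comes from the inclusion, with the loss of \<open>E_act\<close>, of the preimage of
  a neighbourhood of \<zeta> in a neighbourhood of its image under the inverse.\<close>

lemma atom_superstationary:
  assumes \<zeta>: "\<zeta> \<in> BX"
  shows "atom \<zeta> \<le> avg \<mu> (\<lambda>s. atom (boundary_action (ginv s) \<zeta>))"
proof -
  define h where "h n s = mass (s -` near \<zeta> (real n))" for n :: nat and s
  define h' where "h' s = (INF n. h n s)" for s
  have bdd: "bdd_below (range (\<lambda>n. h n s))" for s
    by (rule bdd_belowI[of _ 0]) (auto simp: h_def mass_nonneg)
  have dec: "decseq (\<lambda>n. h n s)" for s
    unfolding h_def decseq_def using near_antimono[of "real _" "real _" \<zeta>]
    by (auto intro!: mass_mono dest!: subsetD)
  have lim: "(\<lambda>n. h n s) \<longlonglongrightarrow> h' s" for s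
    unfolding h'_def by (rule LIMSEQ_decseq_INF[OF bdd dec])
  have h'01: "\<bar>h' s\<bar> \<le> 1" for s
  proof -
    have "h' s \<le> h 0 s" unfolding h'_def by (rule cINF_lower[OF bdd]) simp
    moreover have "0 \<le> h' s" unfolding h'_def by (rule cINF_greatest) (auto simp: h_def mass_nonneg)
    ultimately show ?thesis using mass_le_1[of "s -` near \<zeta> (real 0)"] by (simp add: h_def)
  qed
  have h'_le: "h' s \<le> atom (boundary_action (ginv s) \<zeta>)" if s: "s \<in> set_pmf \<mu>" for s
    unfolding atom_def
  proof (rule cINF_greatest)
    fix k :: nat
    have is_: "isometry (ginv s)" using isometry_inv[OF iso[OF s]] .
    obtain n :: nat where n: "real k + C1 + dist x0 (ginv s x0) \<le> real n" using real_arch_simple by blast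
    have "s -` near \<zeta> (real n) \<subseteq> near (boundary_action (ginv s) \<zeta>) (real k)"
    proof
      fix x assume "x \<in> s -` near \<zeta> (real n)"
      then have "s x \<in> near \<zeta> (real k + C1 + dist x0 (ginv s x0))" using near_antimono[OF n] by blast
      then have "ereal (real k + C1 + dist x0 (ginv s x0)) < E (Inl (s x)) (Inr \<zeta>)"
        by (simp add: near_def)
      from E_act[OF is_ _ _ this] show "x \<in> near (boundary_action (ginv s) \<zeta>) (real k)"
        using \<zeta> by (simp add: near_def isometry_inv_apply[OF iso[OF s]])
    qed
    then have "h n s \<le> mass (near (boundary_action (ginv s) \<zeta>) (real k))"
      unfolding h_def by (rule mass_mono)
    moreover have "h' s \<le> h n s" unfolding h'_def by (rule cINF_lower[OF bdd]) simp
    ultimately show "h' s \<le> mass (near (boundary_action (ginv s) \<zeta>) (real k))" by linarith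
  qed simp
  have "(\<lambda>n. avg \<mu> (h n)) \<longlonglongrightarrow> avg \<mu> h'"
  proof (rule integral_dominated_convergence[where w = "\<lambda>_. 1"])
    show "AE s in measure_pmf \<mu>. (\<lambda>n. h n s) \<longlonglongrightarrow> h' s" by (intro AE_I2 lim)
    show "AE s in measure_pmf \<mu>. norm (h n s) \<le> 1" for n
      by (intro AE_I2) (simp add: h_def mass_abs_le)
  qed auto
  moreover have "atom \<zeta> \<le> avg \<mu> (h n)" for n
    unfolding h_def mass_stationary[symmetric] by (rule atom_le)
  ultimately have "atom \<zeta> \<le> avg \<mu> h'"
    by (intro LIMSEQ_le_const) auto
  also have "\<dots> \<le> avg \<mu> (\<lambda>s. atom (boundary_action (ginv s) \<zeta>))"
  proof (rule integral_mono_AE)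
    show "integrable (measure_pmf \<mu>) h'" by (rule pmf_integrable_bounded[of _ _ 1]) (rule h'01)
    show "integrable (measure_pmf \<mu>) (\<lambda>s. atom (boundary_action (ginv s) \<zeta>))"
      by (rule pmf_integrable_bounded[of _ _ 1])
        (use atom_nonneg order_trans[OF atom_le mass_le_1] in auto)
    show "AE s in measure_pmf \<mu>. h' s \<le> atom (boundary_action (ginv s) \<zeta>)"
      using h'_le by (simp add: AE_measure_pmf_iff)
  qed
  finally show ?thesis .
qed

lemma atom_zero: "\<zeta> \<in> BX \<Longrightarrow> atom \<zeta> = 0"
  using no_stationary_atoms[OF iso ne, of atom \<zeta>] atom_nonneg atom_sum atom_superstationary by blast

text \<open>If shadows of mass above \<epsilon> existed at every depth, they would concentrate at a
  boundary point, which would then be an atom of weight at least \<epsilon>.\<close>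

lemma mass_shadow:
  assumes "\<epsilon> > 0"
  shows "\<exists>R. \<forall>z. mass {x. R \<le> gp z x} \<le> \<epsilon>"
proof (rule ccontr)
  assume not: "\<not> ?thesis"
  define m where "m A = mass (Inl -` A)" for A :: "('a + (nat \<Rightarrow> 'a) set) set"
  have "\<exists>\<eta>\<in>BX. \<forall>R. \<epsilon> < m (Sh (Inr \<eta>) R)"
  proof (rule heavy_shadows_concentrate[OF _ _ assms])
    show "m A \<le> m B" if "A \<subseteq> B" for A B unfolding m_def using that by (intro mass_mono) blast
    show "(\<Sum>i\<in>F. m (A i)) \<le> 1" if "finite F" "disjoint_family_on A F" for A :: "nat \<Rightarrow> _" and F
      unfolding m_def using that by (intro mass_disjoint_family) (auto simp: disjoint_family_on_def)
    fix R
    \<comment> \<open>The additional 1 turns the weak inequality into the strict one required by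
      \<open>Sh\<close>.\<close>
    obtain z where z: "\<epsilon> < mass {x. R + 1 \<le> gp z x}" using not by (auto simp: not_le)
    have "{x. R + 1 \<le> gp z x} \<subseteq> Inl -` Sh (Inl z) R"
    proof
      fix x assume "x \<in> {x. R + 1 \<le> gp z x}"
      then have "R < gp x z" by (simp add: gromov_product_commute[of x0 x z])
      then show "x \<in> Inl -` Sh (Inl z) R" using E_Inl_Inl(1) by (simp add: Sh_def)
    qed
    then have "mass {x. R + 1 \<le> gp z x} \<le> m (Sh (Inl z) R)" unfolding m_def by (rule mass_mono)
    then have "\<epsilon> < m (Sh (Inl z) R)" using z by linarith
    then show "\<exists>z. \<epsilon> < m (Sh (Inl z) R)" by (rule exI)
  qed
  then obtain \<eta> where \<eta>: "\<eta> \<in> BX" "\<And>R. \<epsilon> < mass (near \<eta> R)" unfolding m_def near_eq by blast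
  have "\<epsilon> \<le> atom \<eta>" unfolding atom_def by (rule cINF_greatest) (auto intro: less_imp_le \<eta>(2))
  then show False using atom_zero[OF \<eta>(1)] assms by simp
qed

end

section \<open>The random walk\<close>

text \<open>The increments take values in the countable set \<open>G\<close> at every sample point,
  not merely almost surely. As \<mu> lives on all functions, their law is written through a
  retraction onto \<open>G\<close> that is the identity on the support.\<close>

locale group_walk = prob_space M
  for M :: "'w measure" +
  fixes \<mu> :: "('b \<Rightarrow> 'b) pmf" and G :: "('b \<Rightarrow> 'b) set" and X :: "nat \<Rightarrow> 'w \<Rightarrow> 'b \<Rightarrow> 'b"
  assumes countable_G: "countable G" and id_G: "id \<in> G"
    and comp_G: "\<And>g h. g \<in> G \<Longrightarrow> h \<in> G \<Longrightarrow> g \<circ> h \<in> G"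
    and support: "set_pmf \<mu> \<subseteq> G"
    and indep: "indep_vars (\<lambda>_. count_space G) X {1..}"
    and law: "\<And>i. i \<ge> 1 \<Longrightarrow> distr M (count_space G) (X i) =
        distr (measure_pmf \<mu>) (count_space G) (\<lambda>s. if s \<in> G then s else id)"
begin

lemma X_measurable: "i \<ge> 1 \<Longrightarrow> X i \<in> M \<rightarrow>\<^sub>M count_space G"
  using indep by (simp add: indep_vars_def)

lemma X_in_G: "i \<ge> 1 \<Longrightarrow> \<omega> \<in> space M \<Longrightarrow> X i \<omega> \<in> G"
  using measurable_space[OF X_measurable] by simp

section \<open>Finite histories of increments\<close>

definition history :: "nat \<Rightarrow> 'w \<Rightarrow> nat \<Rightarrow> 'b \<Rightarrow> 'b" where
  "history n \<omega> = restrict (\<lambda>i. X i \<omega>) {1..n}"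

text \<open>Since \<open>G\<close> is countable, the space of histories is discrete. Every function
  of a history is measurable, so test functions of the walk need no measurability
  hypothesis.\<close>

lemma PiM_history: "PiM {1..n::nat} (\<lambda>_. count_space G) = count_space (PiE {1..n} (\<lambda>_. G))"
  by (rule count_space_PiM_finite) (simp_all add: countable_G)

lemma history_measurable: "history n \<in> M \<rightarrow>\<^sub>M count_space (PiE {1..n} (\<lambda>_. G))"
  unfolding PiM_history[symmetric] history_def
  by (rule measurable_restrict) (simp add: X_measurable)

lemma measurable_history:
  assumes "\<And>h. \<phi> h \<in> space N"
  shows "(\<lambda>\<omega>. \<phi> (history n \<omega>)) \<in> M \<rightarrow>\<^sub>M N"
  by (rule measurable_compose[OF history_measurable]) (use assms in auto)

lemma law_expectation:
  fixes f :: "('b \<Rightarrow> 'b) \<Rightarrow> real"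
  shows "i \<ge> 1 \<Longrightarrow> (\<integral>s. f s \<partial>distr M (count_space G) (X i)) = avg \<mu> f"
proof -
  assume "i \<ge> 1"
  have "(\<lambda>s. if s \<in> G then s else id) \<in> measure_pmf \<mu> \<rightarrow>\<^sub>M count_space G"
    using id_G by auto
  then have "(\<integral>s. f s \<partial>distr M (count_space G) (X i)) =
      avg \<mu> (\<lambda>s. f (if s \<in> G then s else id))"
    unfolding law[OF \<open>i \<ge> 1\<close>] by (rule integral_distr) simp
  also have "\<dots> = avg \<mu> f"
    using support by (intro integral_cong_AE) (auto simp: AE_measure_pmf_iff)
  finally show ?thesis .
qed

text \<open>The next increment is independent of the history, so their joint law is a product. The
  two equations are Fubini's theorem in its two orders.\<close>

lemma step_expectation:
  fixes \<Phi> :: "(nat \<Rightarrow> 'b \<Rightarrow> 'b) \<Rightarrow> ('b \<Rightarrow> 'b) \<Rightarrow> real"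
  assumes C: "\<And>h s. \<bar>\<Phi> h s\<bar> \<le> C"
  shows "expectation (\<lambda>\<omega>. \<Phi> (history n \<omega>) (X (Suc n) \<omega>)) =
      expectation (\<lambda>\<omega>. avg \<mu> (\<lambda>s. \<Phi> (history n \<omega>) s))" (is "?A = ?B")
    and "expectation (\<lambda>\<omega>. avg \<mu> (\<lambda>s. \<Phi> (history n \<omega>) s)) =
      avg \<mu> (\<lambda>s. expectation (\<lambda>\<omega>. \<Phi> (history n \<omega>) s))" (is "_ = ?C")
proof -
  let ?P = "count_space (PiE {1..n} (\<lambda>_. G))" and ?Q = "count_space (PiE {Suc n} (\<lambda>_. G))"
  \<comment> \<open>The increment as a family with one index: \<open>indep_var_restrict\<close>
    yields independence of blocks of variables.\<close>
  define X' where "X' \<omega> = restrict (\<lambda>i. X i \<omega>) {Suc n}" for \<omega>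
  let ?D1 = "distr M ?P (history n)" and ?D2 = "distr M ?Q X'"
  have Q: "PiM {Suc n} (\<lambda>_. count_space G) = ?Q"
    by (rule count_space_PiM_finite) (simp_all add: countable_G)
  have X': "X' \<in> M \<rightarrow>\<^sub>M ?Q"
    unfolding Q[symmetric] X'_def by (rule measurable_restrict) (simp add: X_measurable)
  have "indep_var (PiM {1..n} (\<lambda>_. count_space G)) (\<lambda>\<omega>. restrict (\<lambda>i. X i \<omega>) {1..n})
      (PiM {Suc n} (\<lambda>_. count_space G)) (\<lambda>\<omega>. restrict (\<lambda>i. X i \<omega>) {Suc n})"
    by (rule indep_var_restrict[OF indep]) auto
  then have "indep_var ?P (history n) ?Q X'"
    unfolding PiM_history Q history_def[symmetric] X'_def[symmetric] .
  then have joint: "?D1 \<Otimes>\<^sub>M ?D2 = distr M (?P \<Otimes>\<^sub>M ?Q) (\<lambda>\<omega>. (history n \<omega>, X' \<omega>))"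
    unfolding indep_var_distribution_eq by blast
  have PQ: "?P \<Otimes>\<^sub>M ?Q = count_space (PiE {1..n} (\<lambda>_. G) \<times> PiE {Suc n} (\<lambda>_. G))"
    by (intro pair_measure_countable countable_PiE) (simp_all add: countable_G)
  define F where "F h f = \<Phi> h (f (Suc n))" for h and f :: "nat \<Rightarrow> 'b \<Rightarrow> 'b"
  have law': "(\<integral>f. \<phi> (f (Suc n)) \<partial>?D2) = avg \<mu> \<phi>" for \<phi> :: "('b \<Rightarrow> 'b) \<Rightarrow> real"
  proof -
    have "(\<integral>f. \<phi> (f (Suc n)) \<partial>?D2) = expectation (\<lambda>\<omega>. \<phi> (X' \<omega> (Suc n)))"
      by (rule integral_distr[OF X']) simp
    also have "\<dots> = (\<integral>s. \<phi> s \<partial>distr M (count_space G) (X (Suc n)))"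
      unfolding X'_def by (subst integral_distr) (simp_all add: X_measurable)
    also have "\<dots> = avg \<mu> \<phi>" by (rule law_expectation) simp
    finally show ?thesis .
  qed
  interpret D1: prob_space ?D1 by (rule prob_space_distr[OF history_measurable])
  interpret D2: prob_space ?D2 by (rule prob_space_distr[OF X'])
  interpret D: pair_prob_space ?D1 ?D2 ..
  have meas: "case_prod F \<in> borel_measurable (?P \<Otimes>\<^sub>M ?Q)"
    unfolding PQ by simp
  have int: "integrable (?D1 \<Otimes>\<^sub>M ?D2) (case_prod F)"
  proof (rule D.P.integrable_const_bound[of _ C])
    show "case_prod F \<in> borel_measurable (?D1 \<Otimes>\<^sub>M ?D2)"
      unfolding joint using meas by simp
  qed (use C in \<open>auto simp: F_def\<close>)
  have hX: "(\<lambda>\<omega>. (history n \<omega>, X' \<omega>)) \<in> M \<rightarrow>\<^sub>M ?P \<Otimes>\<^sub>M ?Q"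
    by (intro measurable_Pair history_measurable X')
  have "?A = (\<integral>x. case_prod F x \<partial>distr M (?P \<Otimes>\<^sub>M ?Q) (\<lambda>\<omega>. (history n \<omega>, X' \<omega>)))"
    by (subst integral_distr[OF hX meas]) (simp add: F_def X'_def)
  also have "\<dots> = (\<integral>h. (\<integral>f. F h f \<partial>?D2) \<partial>?D1)"
    unfolding joint[symmetric] using D.integral_fst'[OF int] by simp
  finally have A: "?A = (\<integral>h. (\<integral>f. F h f \<partial>?D2) \<partial>?D1)" .
  have "(\<integral>h. (\<integral>f. F h f \<partial>?D2) \<partial>?D1) = (\<integral>h. avg \<mu> (\<lambda>s. \<Phi> h s) \<partial>?D1)"
    unfolding F_def law' ..
  also have "\<dots> = ?B"
    by (rule integral_distr[OF history_measurable]) simp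
  finally have B: "(\<integral>h. (\<integral>f. F h f \<partial>?D2) \<partial>?D1) = ?B" .
  show "?A = ?B" using A B by simp
  have "(\<integral>h. (\<integral>f. F h f \<partial>?D2) \<partial>?D1) = (\<integral>f. (\<integral>h. F h f \<partial>?D1) \<partial>?D2)"
    using D.Fubini_integral[OF int] by simp
  also have "\<dots> = avg \<mu> (\<lambda>s. \<integral>h. \<Phi> h s \<partial>?D1)"
    unfolding F_def by (rule law')
  also have "(\<lambda>s. \<integral>h. \<Phi> h s \<partial>?D1) = (\<lambda>s. expectation (\<lambda>\<omega>. \<Phi> (history n \<omega>) s))"
    by (rule ext, rule integral_distr[OF history_measurable]) simp
  finally show "?B = ?C" using B by simp
qed

abbreviation walk :: "nat \<Rightarrow> 'w \<Rightarrow> 'b \<Rightarrow> 'b" where "walk n \<omega> \<equiv> random_walk X n \<omega>"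

text \<open>The same recursion run on the coordinates of a history, which displays the walk as a
  function of the history.\<close>

definition walk_of :: "nat \<Rightarrow> (nat \<Rightarrow> 'b \<Rightarrow> 'b) \<Rightarrow> 'b \<Rightarrow> 'b" where
  "walk_of n h = random_walk (\<lambda>i h. h i) n h"

lemma walk_history: "n \<le> m \<Longrightarrow> walk n \<omega> = walk_of n (history m \<omega>)"
  by (induction n) (auto simp: walk_of_def history_def)

lemma walk_in_G: "\<omega> \<in> space M \<Longrightarrow> walk n \<omega> \<in> G"
  by (induction n) (auto simp: id_G comp_G X_in_G simp del: id_apply)

lemma walk_measurable_borel: "(\<lambda>\<omega>. \<phi> (walk n \<omega>) :: real) \<in> borel_measurable M"
  unfolding walk_history[OF order_refl] by (rule measurable_history) simp

lemma walk_pred2: "Measurable.pred M (\<lambda>\<omega>. P (walk m \<omega>) (walk n \<omega>))"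
proof -
  have "walk m \<omega> = walk_of m (history (max m n) \<omega>)" "walk n \<omega> = walk_of n (history (max m n) \<omega>)" for \<omega>
    by (rule walk_history, simp)+
  then show ?thesis
    using measurable_history[of "\<lambda>h. P (walk_of m h) (walk_of n h)" "count_space UNIV" "max m n"] by simp
qed

lemma walk_pred: "Measurable.pred M (\<lambda>\<omega>. P (walk n \<omega>))"
  using walk_pred2[of "\<lambda>g _. P g" n n] .

lemma integrable_walk:
  fixes \<phi> :: "('b \<Rightarrow> 'b) \<Rightarrow> real"
  assumes "\<And>g. \<bar>\<phi> g\<bar> \<le> C"
  shows "integrable M (\<lambda>\<omega>. \<phi> (walk n \<omega>))"
  by (rule integrable_const_bound[of _ C]) (use assms walk_measurable_borel in auto)

lemma walk_step_expectation:
  fixes \<phi> :: "('b \<Rightarrow> 'b) \<Rightarrow> real"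
  assumes "\<And>g. \<bar>\<phi> g\<bar> \<le> C"
  shows "expectation (\<lambda>\<omega>. \<phi> (walk (Suc n) \<omega>)) =
      expectation (\<lambda>\<omega>. avg \<mu> (\<lambda>s. \<phi> (walk n \<omega> \<circ> s)))"
    and "expectation (\<lambda>\<omega>. avg \<mu> (\<lambda>s. \<phi> (walk n \<omega> \<circ> s))) =
      avg \<mu> (\<lambda>s. expectation (\<lambda>\<omega>. \<phi> (walk n \<omega> \<circ> s)))"
  using step_expectation[of "\<lambda>h s. \<phi> (walk_of n h \<circ> s)" C n] assms
  by (simp_all add: walk_history[OF order_refl, symmetric])

text \<open>The last increment acts first on \<open>x\<close>. Averaging over it replaces
  \<open>x\<close> by \<open>s x\<close>, which is why the induction generalizes
  \<open>x\<close>.\<close>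

lemma walk_distribution:
  assumes "\<And>x. \<bar>f x\<bar> \<le> (C::real)"
  shows "expectation (\<lambda>\<omega>. f (walk n \<omega> x)) = (markov_op \<mu> ^^ n) f x"
proof (induction n arbitrary: x)
  case (Suc n)
  have "expectation (\<lambda>\<omega>. f (walk (Suc n) \<omega> x)) =
      avg \<mu> (\<lambda>s. expectation (\<lambda>\<omega>. f (walk n \<omega> (s x))))"
    using walk_step_expectation[of "\<lambda>g. f (g x)" C n] assms by simp
  then show ?case by (simp add: Suc.IH markov_op_def)
qed (simp add: prob_space)

text \<open>Regrouping the powers of \<open>markov_op\<close> moves the separated increment from the
  right end to the left end. In this form stationarity of the limit law can be read off.\<close>

lemma walk_left_step_expectation:
  assumes "\<And>x. \<bar>f x\<bar> \<le> (C::real)"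
  shows "expectation (\<lambda>\<omega>. f (walk (Suc n) \<omega> x)) =
      avg \<mu> (\<lambda>s. expectation (\<lambda>\<omega>. f (s (walk n \<omega> x))))"
proof -
  have "expectation (\<lambda>\<omega>. f (walk (Suc n) \<omega> x)) = (markov_op \<mu> ^^ Suc n) f x"
    by (rule walk_distribution[OF assms])
  also have "\<dots> = (markov_op \<mu> ^^ n) (markov_op \<mu> f) x" by (simp add: funpow_swap1)
  also have "\<dots> = expectation (\<lambda>\<omega>. markov_op \<mu> f (walk n \<omega> x))"
    by (rule walk_distribution[symmetric, of _ C]) (rule markov_op_abs_le[OF assms])
  also have "\<dots> = avg \<mu> (\<lambda>s. expectation (\<lambda>\<omega>. f (s (walk n \<omega> x))))"
    using step_expectation(2)[of "\<lambda>h s. f (s (walk_of n h x))" C n] assms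
    by (simp add: walk_history[OF order_refl, symmetric] markov_op_def)
  finally show ?thesis .
qed

text \<open>The walk after time \<open>n\<close>, frozen as soon as it is bad relative to its
  position at time \<open>n\<close>. The increments \<open>Y\<close> are a parameter so that the
  recursion also runs on histories.\<close>

primrec stopped :: "(('b \<Rightarrow> 'b) \<Rightarrow> ('b \<Rightarrow> 'b) \<Rightarrow> bool) \<Rightarrow> (nat \<Rightarrow> 'v \<Rightarrow> 'b \<Rightarrow> 'b) \<Rightarrow> nat \<Rightarrow> nat \<Rightarrow> 'v \<Rightarrow> 'b \<Rightarrow> 'b" where
  "stopped bad Y n 0 \<omega> = random_walk Y n \<omega>"
| "stopped bad Y n (Suc k) \<omega> = (if bad (random_walk Y n \<omega>) (stopped bad Y n k \<omega>) then stopped bad Y n k \<omega>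
     else stopped bad Y n k \<omega> \<circ> Y (Suc (n + k)) \<omega>)"

lemma stopped_history:
  "n + k \<le> m \<Longrightarrow> stopped bad X n k \<omega> = stopped bad (\<lambda>i h. h i) n k (history m \<omega>)"
proof (induction k)
  case 0
  then show ?case using walk_history[of n m \<omega>] by (simp add: walk_of_def)
next
  case (Suc k)
  then have x: "X (Suc (n + k)) \<omega> = history m \<omega> (Suc (n + k))" by (simp add: history_def)
  have w: "walk n \<omega> = random_walk (\<lambda>i h. h i) n (history m \<omega>)"
    using walk_history[of n m \<omega>] Suc.prems by (simp add: walk_of_def)
  have "stopped bad X n k \<omega> = stopped bad (\<lambda>i h. h i) n k (history m \<omega>)"
    using Suc by simp
  then show ?case unfolding stopped.simps x w by (simp only:)
qed

lemma stopped_in_G: "\<omega> \<in> space M \<Longrightarrow> stopped bad X n k \<omega> \<in> G"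
  by (induction k) (auto simp: walk_in_G comp_G X_in_G)

lemma stopped_eq_walk:
  "(\<forall>j\<le>k. \<not> bad (walk n \<omega>) (walk (n + j) \<omega>)) \<Longrightarrow> stopped bad X n k \<omega> = walk (n + k) \<omega>"
  by (induction k) auto

lemma stopped_bad:
  "bad (walk n \<omega>) (walk (n + j) \<omega>) \<Longrightarrow> j \<le> k \<Longrightarrow> bad (walk n \<omega>) (stopped bad X n k \<omega>)"
proof (induction k arbitrary: j)
  case 0
  then show ?case by simp
next
  case (Suc k)
  show ?case
  proof (cases "bad (walk n \<omega>) (stopped bad X n k \<omega>)")
    case True
    then show ?thesis by simp
  next
    case False
    then have no: "\<forall>i\<le>k. \<not> bad (walk n \<omega>) (walk (n + i) \<omega>)"
      using Suc.IH by blast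
    then have "j = Suc k" using Suc.prems le_Suc_eq by blast
    then show ?thesis using False stopped_eq_walk[of k bad n \<omega>] no Suc.prems by simp
  qed
qed

lemma stopped_expectation:
  assumes H: "\<And>u v. \<bar>H u v\<bar> \<le> (C::real)"
    and harm: "\<And>u v. H u v = avg \<mu> (\<lambda>s. H u (v \<circ> s))"
  shows "expectation (\<lambda>\<omega>. H (walk n \<omega>) (stopped bad X n k \<omega>)) = expectation (\<lambda>\<omega>. H (walk n \<omega>) (walk n \<omega>))"
proof (induction k)
  case (Suc k)
  define w where "w h = random_walk (\<lambda>i h. h i) n h" for h :: "nat \<Rightarrow> 'b \<Rightarrow> 'b"
  define v where "v h = stopped bad (\<lambda>i h. h i) n k h" for h :: "nat \<Rightarrow> 'b \<Rightarrow> 'b"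
  define \<Phi> where "\<Phi> h s = H (w h) (if bad (w h) (v h) then v h else v h \<circ> s)" for h s
  have w: "w (history (n + k) \<omega>) = walk n \<omega>" for \<omega>
    using walk_history[of n "n + k" \<omega>] by (simp add: w_def walk_of_def)
  have v: "v (history (n + k) \<omega>) = stopped bad X n k \<omega>" for \<omega>
    using stopped_history[of n k "n + k"] by (simp add: v_def)
  have "expectation (\<lambda>\<omega>. H (walk n \<omega>) (stopped bad X n (Suc k) \<omega>))
      = expectation (\<lambda>\<omega>. \<Phi> (history (n + k) \<omega>) (X (Suc (n + k)) \<omega>))"
    unfolding \<Phi>_def w v stopped.simps ..
  also have "\<dots> = expectation (\<lambda>\<omega>. avg \<mu> (\<lambda>s. \<Phi> (history (n + k) \<omega>) s))"
    by (rule step_expectation(1)[of _ C]) (simp add: \<Phi>_def H)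
  also have "(\<lambda>\<omega>. avg \<mu> (\<lambda>s. \<Phi> (history (n + k) \<omega>) s))
      = (\<lambda>\<omega>. H (walk n \<omega>) (stopped bad X n k \<omega>))"
  proof
    fix \<omega>
    show "avg \<mu> (\<lambda>s. \<Phi> (history (n + k) \<omega>) s) = H (walk n \<omega>) (stopped bad X n k \<omega>)"
      unfolding \<Phi>_def w v using harm[of "walk n \<omega>" "stopped bad X n k \<omega>"]
      by (cases "bad (walk n \<omega>) (stopped bad X n k \<omega>)") simp_all
  qed
  finally show ?case using Suc.IH by simp
qed simp

text \<open>Optional stopping for the bounded martingale \<open>H (walk n) (walk m)\<close>, \<open>m \<ge> n\<close>.\<close>

lemma prob_ever_bad_le:
  assumes H: "\<And>u v. 0 \<le> H u v" "\<And>u v. H u v \<le> (1::real)"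
    and harm: "\<And>u v. H u v = avg \<mu> (\<lambda>s. H u (v \<circ> s))"
    and bad: "\<And>u v. u \<in> G \<Longrightarrow> v \<in> G \<Longrightarrow> bad u v \<Longrightarrow> H u v \<le> \<epsilon>"
  shows "(1 - \<epsilon>) * prob {\<omega> \<in> space M. \<exists>j. bad (walk n \<omega>) (walk (n + j) \<omega>)} \<le>
      1 - expectation (\<lambda>\<omega>. H (walk n \<omega>) (walk n \<omega>))"
proof -
  define B where "B k = {\<omega> \<in> space M. \<exists>j\<in>{..k}. bad (walk n \<omega>) (walk (n + j) \<omega>)}" for k
  have B_sets: "B k \<in> events" for k
  proof -
    have "Measurable.pred M (\<lambda>\<omega>. \<exists>j\<in>{..k}. bad (walk n \<omega>) (walk (n + j) \<omega>))"
      by (intro pred_intros_finite walk_pred2) simp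
    then show ?thesis unfolding B_def pred_def .
  qed
  have Habs: "\<bar>H u v\<bar> \<le> 1" for u v using H[of u v] by simp
  have B_le: "(1 - \<epsilon>) * prob (B k) \<le> 1 - expectation (\<lambda>\<omega>. H (walk n \<omega>) (walk n \<omega>))" for k
  proof -
    have meas: "(\<lambda>\<omega>. H (walk n \<omega>) (stopped bad X n k \<omega>)) \<in> borel_measurable M"
      unfolding stopped_history[OF order_refl] walk_history[OF le_add1[of n k]]
      by (rule measurable_history) simp
    have "expectation (\<lambda>\<omega>. H (walk n \<omega>) (walk n \<omega>)) = expectation (\<lambda>\<omega>. H (walk n \<omega>) (stopped bad X n k \<omega>))"
      by (rule sym, rule stopped_expectation[of H 1], rule Habs, rule harm)
    also have "\<dots> \<le> expectation (\<lambda>\<omega>. 1 - (1 - \<epsilon>) * indicator (B k) \<omega>)"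
    proof (rule integral_mono)
      show "integrable M (\<lambda>\<omega>. H (walk n \<omega>) (stopped bad X n k \<omega>))"
        by (rule integrable_const_bound[of _ 1]) (use Habs meas in auto)
      show "integrable M (\<lambda>\<omega>. 1 - (1 - \<epsilon>) * indicator (B k) \<omega>)"
        using B_sets by (auto intro!: integrable_real_indicator simp: emeasure_eq_measure)
      fix \<omega> assume \<omega>: "\<omega> \<in> space M"
      show "H (walk n \<omega>) (stopped bad X n k \<omega>) \<le> 1 - (1 - \<epsilon>) * indicator (B k) \<omega>"
      proof (cases "\<omega> \<in> B k")
        case True
        then have "bad (walk n \<omega>) (stopped bad X n k \<omega>)"
          using stopped_bad[of bad n \<omega>] unfolding B_def by auto
        then show ?thesis using True bad[OF walk_in_G[OF \<omega>] stopped_in_G[OF \<omega>]] by simp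
      qed (simp add: H)
    qed
    also have "\<dots> = 1 - (1 - \<epsilon>) * prob (B k)"
      using B_sets by (subst Bochner_Integration.integral_diff)
        (auto intro!: integrable_real_indicator simp: emeasure_eq_measure prob_space)
    finally show ?thesis by linarith
  qed
  have "(\<lambda>k. prob (B k)) \<longlonglongrightarrow> prob (\<Union>k. B k)"
    using B_sets by (intro finite_Lim_measure_incseq) (auto simp: incseq_def B_def intro: order_trans)
  also have "(\<Union>k. B k) = {\<omega> \<in> space M. \<exists>j. bad (walk n \<omega>) (walk (n + j) \<omega>)}"
    by (auto simp: B_def)
  finally have "(\<lambda>k. (1 - \<epsilon>) * prob (B k)) \<longlonglongrightarrow>
      (1 - \<epsilon>) * prob {\<omega> \<in> space M. \<exists>j. bad (walk n \<omega>) (walk (n + j) \<omega>)}"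
    by (intro tendsto_mult_left)
  then show ?thesis
    by (rule LIMSEQ_le_const2) (use B_le in blast)
qed

end

section \<open>Convergence to the boundary\<close>

locale hyperbolic_walk = hyperbolic x0 \<delta> + group_walk M \<mu> G X
  for x0 :: "'a::metric_space" and \<delta> and M :: "'w measure" and \<mu> :: "('a \<Rightarrow> 'a) pmf"
    and G and X :: "nat \<Rightarrow> 'w \<Rightarrow> 'a \<Rightarrow> 'a" +
  assumes iso_G: "\<And>s. s \<in> G \<Longrightarrow> isometry s"
    and non_elem: "non_elementary x0 (generated_semigroup (set_pmf \<mu>))"
begin

abbreviation backtrack :: "nat \<Rightarrow> real \<Rightarrow> 'w set" where
  "backtrack n T \<equiv> {\<omega> \<in> space M. \<exists>j. gp (walk n \<omega> x0) (walk (n + j) \<omega> x0) < T}"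

text \<open>At a time \<open>n\<close> when the walk is far from \<open>x0\<close> with probability
  above 1 - \<epsilon>, the initial value of \<open>H\<close> has mean at least (1 - \<epsilon>)^2.
  Optional stopping gives (1 - \<epsilon>) P \<le> 1 - (1 - \<epsilon>)^2 \<le> 2\<epsilon> for the
  backtracking probability P, hence P \<le> 4\<epsilon> as \<epsilon> \<le> 1/2.\<close>

lemma prob_backtrack:
  assumes \<epsilon>: "0 < \<epsilon>" "\<epsilon> \<le> 1/2"
  shows "\<exists>n. prob (backtrack n T) \<le> 4 * \<epsilon>"
proof -
  obtain L where L: "stationary_mean \<mu> x0 L" using stationary_mean_exists[of \<mu> x0] by (elim exE)
  have iso_supp: "isometry s" if "s \<in> set_pmf \<mu>" for s
    by (rule iso_G) (rule subsetD[OF support that])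
  interpret hyperbolic_mean x0 \<delta> \<mu> L
    by (intro hyperbolic_mean.intro hyperbolic_mean_axioms.intro L hyperbolic_axioms iso_supp non_elem)
  obtain R where R: "\<And>z. mass {x. R \<le> gp z x} \<le> \<epsilon>" using mass_shadow[OF \<epsilon>(1)] by blast
  \<comment> \<open>Chosen so that a product above K - 2R = T + \<delta> still gives at least
    \<open>T\<close> after one use of the four-point inequality.\<close>
  define K where "K = T + 2 * R + \<delta>"
  \<comment> \<open>If u x0 lies outside this ball, the flip identity puts the points missed by the
    shadow of depth \<open>K\<close> into a shadow of depth \<open>R\<close> once they are pulled
    back by \<open>u\<close>.\<close>
  have "L (indicator (cball x0 (K + R))) < \<epsilon>"
    using mass_ball[of x0 "K + R"] \<epsilon> by (simp add: mass_def)
  then obtain n where n: "(markov_op \<mu> ^^ n) (indicator (cball x0 (K + R))) x0 < \<epsilon>"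
    using L_cluster[OF bounded_fun_indicator] by blast
  define S where "S = {\<omega> \<in> space M. walk n \<omega> x0 \<in> cball x0 (K + R)}"
  have S_sets: "S \<in> events"
    using walk_pred[of "\<lambda>g. g x0 \<in> cball x0 (K + R)" n] unfolding S_def pred_def .
  have "prob S = expectation (\<lambda>\<omega>. indicator (cball x0 (K + R)) (walk n \<omega> x0))"
  proof -
    have "prob S = expectation (indicator S)" using S_sets by simp
    also have "\<dots> = expectation (\<lambda>\<omega>. indicator (cball x0 (K + R)) (walk n \<omega> x0))"
      by (intro Bochner_Integration.integral_cong refl) (auto simp: S_def indicator_def)
    finally show ?thesis .
  qed
  also have "\<dots> = (markov_op \<mu> ^^ n) (indicator (cball x0 (K + R))) x0"
    by (rule walk_distribution[of _ 1]) (simp add: indicator_def)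
  finally have S: "prob S < \<epsilon>" using n by simp
  define H where "H u v = mass (v -` {q. K \<le> gp (u x0) q})" for u v :: "'a \<Rightarrow> 'a"
  have H01: "0 \<le> H u v" "H u v \<le> 1" for u v
    by (simp_all add: H_def mass_nonneg mass_le_1)
  have harm: "H u v = avg \<mu> (\<lambda>s. H u (v \<circ> s))" for u v
    unfolding H_def vimage_comp[symmetric] by (rule mass_stationary)
  \<comment> \<open>The pulled-back shadow lies in a single shadow of depth \<open>R\<close>. If
    \<open>v\<close> moves \<open>x0\<close> by at most K - R, the centre is the preimage of u x0
    and the displacement is paid from \<open>K\<close>; otherwise the centre is the preimage of
    \<open>x0\<close>, by the flip identity.\<close>
  have bad: "H u v \<le> \<epsilon>" if uv: "u \<in> G" "v \<in> G" and b: "gp (u x0) (v x0) < T" for u v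
  proof -
    have iv: "isometry v" using iso_G uv by blast
    have "\<exists>z. v -` {q. K \<le> gp (u x0) q} \<subseteq> {x. R \<le> gp z x}"
    proof (cases "dist x0 (v x0) \<le> K - R")
      case True
      have "R \<le> gp (ginv v (u x0)) q" if "K \<le> gp (u x0) (v q)" for q
        using gromov_product_isometry(1)[OF iv, of x0 "ginv v (u x0)" q] that True
        by (simp add: isometry_inv_apply[OF iv])
      then show ?thesis by (intro exI[of _ "ginv v (u x0)"]) auto
    next
      case False
      have "R \<le> gp (ginv v x0) q" if q: "K \<le> gp (u x0) (v q)" for q
      proof (rule ccontr)
        assume "\<not> ?thesis"
        then have "gp (v q) (v x0) > K - 2 * R"
          using gromov_product_isometry_flip[OF iv, of x0 q] False by linarith
        then have "min K (K - 2 * R) - \<delta> \<le> gp (u x0) (v x0)"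
          using q by (intro gp_tri[of _ "u x0" "v q"]) auto
        moreover have "R \<ge> 0"
          using \<open>\<not> R \<le> gp (ginv v x0) q\<close> gromov_product_nonneg[of x0 "ginv v x0" q] by linarith
        ultimately show False using b by (simp add: K_def)
      qed
      then show ?thesis by (intro exI[of _ "ginv v x0"]) auto
    qed
    then show ?thesis unfolding H_def using mass_mono R order_trans by blast
  qed
  have good: "1 - \<epsilon> \<le> H u u" if u: "u \<in> G" and far: "u x0 \<notin> cball x0 (K + R)" for u
  proof -
    have iu: "isometry u" using iso_G u by blast
    have "- (u -` {q. K \<le> gp (u x0) q}) \<subseteq> {x. R \<le> gp (ginv u x0) x}"
    proof
      fix q assume "q \<in> - (u -` {q. K \<le> gp (u x0) q})"
      then have "gp (u q) (u x0) < K" by (simp add: gromov_product_commute[of x0 "u q"])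
      then show "q \<in> {x. R \<le> gp (ginv u x0) x}"
        using gromov_product_isometry_flip[OF iu, of x0 q] far by simp
    qed
    then have "mass (- (u -` {q. K \<le> gp (u x0) q})) \<le> \<epsilon>" using mass_mono R order_trans by blast
    then show ?thesis by (simp add: H_def mass_compl)
  qed
  have "(1 - \<epsilon>) * (1 - prob S) \<le> expectation (\<lambda>\<omega>. H (walk n \<omega>) (walk n \<omega>))"
  proof -
    have "(1 - \<epsilon>) * (1 - prob S) = expectation (\<lambda>\<omega>. (1 - \<epsilon>) * (1 - indicator S \<omega>))"
      using S_sets by (simp add: prob_space emeasure_eq_measure)
    also have "\<dots> \<le> expectation (\<lambda>\<omega>. H (walk n \<omega>) (walk n \<omega>))"
    proof (rule integral_mono)
      show "integrable M (\<lambda>\<omega>. (1 - \<epsilon>) * (1 - indicator S \<omega>))"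
        using S_sets by (auto intro!: integrable_real_indicator simp: emeasure_eq_measure)
      show "integrable M (\<lambda>\<omega>. H (walk n \<omega>) (walk n \<omega>))"
        by (rule integrable_walk[of "\<lambda>g. H g g" 1]) (use H01 in \<open>auto simp: abs_le_iff intro: order_trans[of _ 0]\<close>)
      fix \<omega> assume \<omega>: "\<omega> \<in> space M"
      show "(1 - \<epsilon>) * (1 - indicator S \<omega>) \<le> H (walk n \<omega>) (walk n \<omega>)"
        using good[OF walk_in_G[OF \<omega>]] \<omega> H01 by (auto simp: S_def indicator_def)
    qed
    finally show ?thesis .
  qed
  moreover have "(1 - \<epsilon>) * (1 - \<epsilon>) \<le> (1 - \<epsilon>) * (1 - prob S)"
    using S \<epsilon> by (intro mult_left_mono) auto
  moreover have "(1 - \<epsilon>) * prob (backtrack n T)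
      \<le> 1 - expectation (\<lambda>\<omega>. H (walk n \<omega>) (walk n \<omega>))"
    by (rule prob_ever_bad_le[of H "\<lambda>u v. gp (u x0) (v x0) < T"], rule H01, rule H01, rule harm, rule bad)
  moreover have "(1/2) * prob (backtrack n T)
      \<le> (1 - \<epsilon>) * prob (backtrack n T)"
    using \<epsilon> by (intro mult_right_mono) auto
  moreover have "(1 - \<epsilon>) * (1 - \<epsilon>) \<ge> 1 - 2 * \<epsilon>" by (simp add: algebra_simps)
  ultimately show ?thesis by (intro exI[of _ n]) linarith
qed

text \<open>The event of backtracking from every time is contained in each single
  \<open>backtrack n T\<close>, so one suitable \<open>n\<close> for each \<epsilon> bounds its
  probability by 4\<epsilon>. No summation over times occurs.\<close>

lemma AE_no_backtrack: "AE \<omega> in M. \<exists>n. \<forall>j. T \<le> gp (walk n \<omega> x0) (walk (n + j) \<omega> x0)"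
proof -
  define B where "B = {\<omega> \<in> space M. \<forall>n. \<exists>j. gp (walk n \<omega> x0) (walk (n + j) \<omega> x0) < T}"
  have meas: "Measurable.pred M (\<lambda>\<omega>. gp (walk n \<omega> x0) (walk m \<omega> x0) < T)" for n m
    by (rule walk_pred2)
  have B: "B \<in> events"
  proof -
    have "Measurable.pred M (\<lambda>\<omega>. \<forall>n. \<exists>j. gp (walk n \<omega> x0) (walk (n + j) \<omega> x0) < T)"
      by (intro pred_intros_countable meas)
    then show ?thesis unfolding B_def pred_def .
  qed
  have "prob B \<le> 4 * \<epsilon>" if \<epsilon>: "0 < \<epsilon>" "\<epsilon> \<le> 1/2" for \<epsilon>
  proof -
    obtain n where n: "prob (backtrack n T) \<le> 4 * \<epsilon>"
      using prob_backtrack[OF \<epsilon>] by blast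
    have "Measurable.pred M (\<lambda>\<omega>. \<exists>j. gp (walk n \<omega> x0) (walk (n + j) \<omega> x0) < T)"
      by (intro pred_intros_countable meas)
    then have "prob B \<le> prob (backtrack n T)"
      unfolding pred_def by (intro finite_measure_mono) (auto simp: B_def)
    then show ?thesis using n by linarith
  qed
  note le = this
  have "prob B = 0"
  proof (rule ccontr)
    assume "prob B \<noteq> 0"
    then have pos: "prob B > 0" using measure_nonneg[of M B] by linarith
    then show False using le[of "prob B / 8"] prob_le_1[of B] by auto
  qed
  then have "AE \<omega> in M. \<omega> \<notin> B" using B by (simp add: prob_eq_0)
  then show ?thesis
    by (rule AE_mp) (auto intro!: AE_I2 simp: B_def not_less)
qed

text \<open>After a time without backtracking below \<open>T\<close>, any two later positions are
  compared through the position at that time, at the cost of \<delta>.\<close>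

lemma AE_gromov_sequence: "AE \<omega> in M. gseq (\<lambda>n. walk n \<omega> x0)"
proof -
  have "AE \<omega> in M. \<forall>T::nat. \<exists>n. \<forall>j. real T \<le> gp (walk n \<omega> x0) (walk (n + j) \<omega> x0)"
    using AE_no_backtrack by (simp add: AE_all_countable)
  then show ?thesis
  proof (rule AE_mp, intro AE_I2 impI)
    fix \<omega> assume *: "\<forall>T::nat. \<exists>n. \<forall>j. real T \<le> gp (walk n \<omega> x0) (walk (n + j) \<omega> x0)"
    show "gseq (\<lambda>n. walk n \<omega> x0)"
      unfolding gromov_sequence_iff
    proof
      fix R
      obtain T :: nat where T: "R + \<delta> + 1 \<le> real T" using real_arch_simple by blast
      obtain n where n: "\<forall>j. real T \<le> gp (walk n \<omega> x0) (walk (n + j) \<omega> x0)" using * by blast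
      have "R < gp (walk i \<omega> x0) (walk j \<omega> x0)" if "i \<ge> n" "j \<ge> n" for i j
      proof -
        have "real T \<le> gp (walk n \<omega> x0) (walk i \<omega> x0)" "real T \<le> gp (walk n \<omega> x0) (walk j \<omega> x0)"
          using n[rule_format, of "i - n"] n[rule_format, of "j - n"] that by simp_all
        then have "real T - \<delta> \<le> gp (walk i \<omega> x0) (walk j \<omega> x0)"
          by (intro gp_tri[of _ _ "walk n \<omega> x0"]) (simp_all add: gromov_product_commute[of x0 "walk i \<omega> x0"])
        then show ?thesis using T by linarith
      qed
      then show "\<exists>N. \<forall>m\<ge>N. \<forall>n\<ge>N. R < gp (walk m \<omega> x0) (walk n \<omega> x0)" by blast
    qed
  qed
qed

end

section \<open>Measures on the boundary\<close>

lemma infsum_pmf_eq_expectation: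
  fixes f :: "'b \<Rightarrow> real"
  assumes "set_pmf p \<subseteq> A" "\<And>x. \<bar>f x\<bar> \<le> C"
  shows "(\<Sum>\<^sub>\<infinity>x\<in>A. pmf p x * f x) = avg p f"
proof -
  have "Infinite_Set_Sum.abs_summable_on (\<lambda>x. pmf p x * f x) UNIV"
  proof (rule abs_summable_on_comparison_test)
    show "Infinite_Set_Sum.abs_summable_on (\<lambda>x. C * pmf p x) UNIV"
      by (intro abs_summable_on_cmult_right pmf_abs_summable)
    show "norm (pmf p x * f x) \<le> norm (C * pmf p x)" for x
      using assms(2)[of x] order_trans[OF abs_ge_zero assms(2)[of x]]
      by (simp add: abs_mult mult.commute mult_right_mono)
  qed
  then have "avg p f = (\<Sum>\<^sub>\<infinity>x. pmf p x * f x)"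
    by (simp add: pmf_expectation_eq_infsetsum infsetsum_infsum)
  also have "\<dots> = (\<Sum>\<^sub>\<infinity>x\<in>A. pmf p x * f x)"
    using assms(1) by (intro infsum_cong_neutral) (auto simp: set_pmf_iff)
  finally show ?thesis by simp
qed

context hyperbolic
begin

abbreviation bb where "bb \<equiv> boundary_borel x0"

abbreviation pre :: "('a \<Rightarrow> 'a) \<Rightarrow> (nat \<Rightarrow> 'a) set set \<Rightarrow> (nat \<Rightarrow> 'a) set set" where
  "pre g U \<equiv> {\<xi> \<in> BX. boundary_action g \<xi> \<in> U}"

lemma bint_mono: "A \<subseteq> B \<Longrightarrow> bint A \<subseteq> bint B"
  unfolding bint_def by blast

lemma bint_borel: "bint A \<in> sets bb"
  by (intro openin_imp_borel openin_bint)

text \<open>The counterpart of \<open>mass_shadow\<close> for a diffuse measure. It speaks of Borel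
  sets inside a shadow, because shadows themselves are not shown to be Borel.\<close>

lemma boundary_measure_shadow:
  assumes \<nu>: "prob_space \<nu>" "sets \<nu> = sets bb"
    and diffuse: "\<And>\<zeta>. \<zeta> \<in> BX \<Longrightarrow> measure \<nu> {\<zeta>} = 0" and "\<epsilon> > 0"
  shows "\<exists>R. \<forall>z. \<forall>S\<in>sets bb. S \<subseteq> {\<eta>. ereal R < E (Inl z) (Inr \<eta>)} \<longrightarrow> measure \<nu> S \<le> \<epsilon>"
proof (rule ccontr)
  assume not: "\<not> ?thesis"
  interpret prob_space \<nu> by (rule \<nu>)
  define m where "m A = measure \<nu> (bint (Inr -` A))" for A :: "('a + (nat \<Rightarrow> 'a) set) set"
  have bs: "bint A \<in> sets \<nu>" for A by (simp add: \<nu>(2) bint_borel)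
  have "\<exists>\<eta>\<in>BX. \<forall>R. \<epsilon> < m (Sh (Inr \<eta>) R)"
  proof (rule heavy_shadows_concentrate[OF _ _ \<open>\<epsilon> > 0\<close>])
    show "m A \<le> m B" if "A \<subseteq> B" for A B
      unfolding m_def using that by (intro finite_measure_mono bs bint_mono) blast
    show "(\<Sum>i\<in>F. m (A i)) \<le> 1" if F: "finite F" "disjoint_family_on A F" for A :: "nat \<Rightarrow> _" and F
    proof -
      have "disjoint_family_on (\<lambda>i. bint (Inr -` A i)) F"
        unfolding disjoint_family_on_def
      proof (intro ballI impI)
        fix i j assume ij: "i \<in> F" "j \<in> F" "i \<noteq> j"
        have "A i \<inter> A j = {}" using F(2) ij unfolding disjoint_family_on_def by blast
        moreover have "bint (Inr -` A i) \<subseteq> Inr -` A i" "bint (Inr -` A j) \<subseteq> Inr -` A j"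
          by (rule bint_subset)+
        ultimately show "bint (Inr -` A i) \<inter> bint (Inr -` A j) = {}" by blast
      qed
      then have "(\<Sum>i\<in>F. m (A i)) = measure \<nu> (\<Union>i\<in>F. bint (Inr -` A i))"
        unfolding m_def using F(1) bs by (intro finite_measure_finite_Union[symmetric]) auto
      then show ?thesis by simp
    qed
    fix R
    \<comment> \<open>The depth is raised by \<open>2 * C1\<close> so that \<open>S\<close> lies in
      the interior of the shadow of depth \<open>R\<close>: one \<open>E_commute\<close>, then one
      \<open>E_tri\<close>.\<close>
    have "\<exists>z S. S \<in> sets bb \<and> S \<subseteq> {\<eta>. ereal (R + 2 * C1) < E (Inl z) (Inr \<eta>)} \<and> \<not> measure \<nu> S \<le> \<epsilon>"
      using not by blast
    then obtain z S where S: "S \<in> sets bb" "S \<subseteq> {\<eta>. ereal (R + 2 * C1) < E (Inl z) (Inr \<eta>)}"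
      "\<epsilon> < measure \<nu> S"
      unfolding not_le by (elim exE conjE)
    have "S \<subseteq> BX" using sets.sets_into_space[OF S(1)] by (simp add: space_boundary_borel)
    have "S \<subseteq> bint (Inr -` Sh (Inl z) R)"
    proof
      fix \<eta> assume "\<eta> \<in> S"
      then have \<eta>: "\<eta> \<in> BX" "ereal (R + 2 * C1) < E (Inl z) (Inr \<eta>)"
        using S(2) \<open>S \<subseteq> BX\<close> by auto
      have 1: "ereal (R + C1) < E (Inr \<eta>) (Inl z)"
        using E_commute[OF _ _ \<eta>(2)] \<eta>(1) by (simp add: add.commute)
      have "\<zeta> \<in> Inr -` Sh (Inl z) R" if "\<zeta> \<in> BX" "ereal (R + C1) < E (Inr \<zeta>) (Inr \<eta>)" for \<zeta>
        using E_tri[OF _ _ _ that(2) 1] that \<eta>(1) by (simp add: Sh_def)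
      then show "\<eta> \<in> bint (Inr -` Sh (Inl z) R)" using \<eta>(1) unfolding bint_def by blast
    qed
    then have "measure \<nu> S \<le> m (Sh (Inl z) R)"
      unfolding m_def by (rule finite_measure_mono[OF _ bs])
    then have "\<epsilon> < m (Sh (Inl z) R)" using S(3) by linarith
    then show "\<exists>z. \<epsilon> < m (Sh (Inl z) R)" by (rule exI)
  qed
  then obtain \<eta> where \<eta>: "\<eta> \<in> BX" "\<And>R. \<epsilon> < m (Sh (Inr \<eta>) R)" by blast
  \<comment> \<open>Decreasing Borel sets with at most the point \<eta> in common; here countable
    additivity turns concentration into an atom.\<close>
  define F where "F n = bint (Inr -` Sh (Inr \<eta>) (real n))" for n :: nat
  have dec: "decseq F"
    unfolding F_def decseq_def
  proof (intro allI impI bint_mono)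
    fix k n :: nat assume "k \<le> n"
    then show "Inr -` Sh (Inr \<eta>) (real n) \<subseteq> Inr -` Sh (Inr \<eta>) (real k)"
      using Sh_mono[of "real k" "real n" "Inr \<eta>"] by auto
  qed
  have lim: "(\<lambda>n. measure \<nu> (F n)) \<longlonglongrightarrow> measure \<nu> (\<Inter>n. F n)"
    by (rule finite_Lim_measure_decseq[OF _ dec]) (auto simp: F_def bs)
  have "\<epsilon> \<le> measure \<nu> (\<Inter>n. F n)"
    by (rule LIMSEQ_le_const[OF lim]) (use \<eta>(2) in \<open>auto simp: F_def m_def intro: less_imp_le\<close>)
  moreover have "(\<Inter>n. F n) \<subseteq> {\<eta>}"
  proof
    fix \<zeta> assume \<zeta>: "\<zeta> \<in> (\<Inter>n. F n)"
    then have mem: "\<zeta> \<in> bint (Inr -` Sh (Inr \<eta>) (real n))" for n by (simp add: F_def)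
    have \<zeta>B: "\<zeta> \<in> BX" using mem[of 0] bint_subset(2) by blast
    have "ereal R < E (Inr \<zeta>) (Inr \<eta>)" for R
    proof -
      obtain n :: nat where n: "R \<le> real n" using real_arch_simple by blast
      have "Inr \<zeta> \<in> Sh (Inr \<eta>) (real n)" using mem[of n] bint_subset(1) by blast
      then have "Inr \<zeta> \<in> Sh (Inr \<eta>) R" using Sh_mono[OF n] by blast
      then show ?thesis by (simp add: Sh_def)
    qed
    then show "\<zeta> \<in> {\<eta>}" using E_eqI[OF \<zeta>B \<eta>(1)] by simp
  qed
  then have "measure \<nu> (\<Inter>n. F n) \<le> measure \<nu> {\<eta>}"
    using singleton_borel[OF \<eta>(1)] \<nu>(2) by (intro finite_measure_mono) auto
  ultimately show False using diffuse[OF \<eta>(1)] \<open>\<epsilon> > 0\<close> by simp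
qed

text \<open>Every open set is an increasing union of closed sets, so comparing two probability measures on open
  sets compares them in both directions.\<close>

lemma boundary_measure_eqI:
  assumes \<alpha>: "prob_space \<alpha>" "sets \<alpha> = sets bb" and \<beta>: "prob_space \<beta>" "sets \<beta> = sets bb"
    and le: "\<And>U. bopen U \<Longrightarrow> measure \<alpha> U \<le> measure \<beta> U"
  shows "\<alpha> = \<beta>"
proof -
  interpret \<alpha>: prob_space \<alpha> by (rule \<alpha>)
  interpret \<beta>: prob_space \<beta> by (rule \<beta>)
  have sp: "space \<alpha> = BX" "space \<beta> = BX"
    using sets_eq_imp_space_eq[OF \<alpha>(2)] sets_eq_imp_space_eq[OF \<beta>(2)] by (simp_all add: space_boundary_borel)
  have ge: "measure \<beta> U \<le> measure \<alpha> U" if U: "bopen U" for U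
  proof -
    have UB: "U \<subseteq> BX" using U by (simp add: openin_boundary_topology)
    \<comment> \<open>Points whose neighbourhood of radius \<open>k\<close> stays inside
      \<open>U\<close>. \<open>F k\<close> is the closure of \<open>V k\<close>, and
      \<open>E_commute\<close> shows that it is still contained in \<open>U\<close>.\<close>
    define V where "V k = {\<xi> \<in> BX. \<forall>\<eta>\<in>BX. ereal (real k) < E (Inr \<eta>) (Inr \<xi>) \<longrightarrow> \<eta> \<in> U}" for k :: nat
    define F where "F k = BX - bint (BX - V k)" for k
    have F_sets: "F k \<in> sets bb" for k
      unfolding F_def by (intro sets.Diff openin_imp_borel openin_BX bint_borel)
    have V_mono: "V k \<subseteq> V l" if "k \<le> l" for k l
    proof
      fix \<xi> assume \<xi>: "\<xi> \<in> V k"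
      have "ereal (real k) \<le> ereal (real l)" using that by simp
      then show "\<xi> \<in> V l" using \<xi> le_less_trans unfolding V_def by blast
    qed
    have inc: "incseq F"
      unfolding F_def incseq_def
    proof (intro allI impI)
      fix k l :: nat assume "k \<le> l"
      then have "bint (BX - V l) \<subseteq> bint (BX - V k)" using V_mono by (intro bint_mono) blast
      then show "BX - bint (BX - V k) \<subseteq> BX - bint (BX - V l)" by blast
    qed
    have F_U: "F k \<subseteq> U" for k
    proof
      fix \<xi> assume "\<xi> \<in> F k"
      then have \<xi>: "\<xi> \<in> BX" "\<xi> \<notin> bint (BX - V k)" by (auto simp: F_def)
      then obtain \<eta> where \<eta>: "\<eta> \<in> BX" "ereal (real k + C1) < E (Inr \<eta>) (Inr \<xi>)" "\<eta> \<in> V k"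
        unfolding bint_def by blast
      have "ereal (real k) < E (Inr \<xi>) (Inr \<eta>)"
        using E_commute[OF _ _ \<eta>(2)] \<eta>(1) \<xi>(1) by simp
      then show "\<xi> \<in> U" using \<eta>(3) \<xi>(1) by (simp add: V_def)
    qed
    have "(\<Union>k. F k) = U"
    proof
      show "U \<subseteq> (\<Union>k. F k)"
      proof
        fix \<xi> assume \<xi>: "\<xi> \<in> U"
        then obtain N where N: "\<forall>\<eta>\<in>BX. ereal N < E (Inr \<eta>) (Inr \<xi>) \<longrightarrow> \<eta> \<in> U"
          using U unfolding openin_boundary_topology by blast
        obtain k :: nat where k: "N \<le> real k" using real_arch_simple by blast
        then have "ereal N \<le> ereal (real k)" by simp
        then have "\<xi> \<in> V k" using N \<xi> UB le_less_trans unfolding V_def by blast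
        then have "\<xi> \<in> F k" using bint_subset(1)[of "BX - V k"] \<xi> UB by (auto simp: F_def)
        then show "\<xi> \<in> (\<Union>k. F k)" by blast
      qed
    qed (use F_U in blast)
    then have lim: "(\<lambda>k. measure \<beta> (F k)) \<longlonglongrightarrow> measure \<beta> U"
      using \<beta>.finite_Lim_measure_incseq[OF _ inc] F_sets \<beta>(2) by auto
    \<comment> \<open>The hypothesis is applied to the open complement of \<open>F k\<close>, which
      reverses the inequality.\<close>
    have "measure \<beta> (F k) \<le> measure \<alpha> U" for k
    proof -
      have "measure \<beta> (F k) = 1 - measure \<beta> (bint (BX - V k))"
        using \<beta>.prob_compl[of "bint (BX - V k)"] bint_borel \<beta>(2) by (simp add: F_def sp)
      also have "\<dots> \<le> 1 - measure \<alpha> (bint (BX - V k))" using le[OF openin_bint] by simp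
      also have "\<dots> = measure \<alpha> (F k)"
        using \<alpha>.prob_compl[of "bint (BX - V k)"] bint_borel \<alpha>(2) by (simp add: F_def sp)
      also have "\<dots> \<le> measure \<alpha> U"
        using F_U openin_imp_borel[OF U] \<alpha>(2) by (intro \<alpha>.finite_measure_mono) auto
      finally show ?thesis .
    qed
    then show ?thesis by (intro LIMSEQ_le_const2[OF lim]) blast
  qed
  show ?thesis
  proof (rule measure_eqI_generator_eq[where E = "{U. bopen U}" and \<Omega> = BX and A = "\<lambda>_. BX"])
    show "Int_stable {U. bopen U}" by (auto simp: Int_stable_def)
    show "{U. bopen U} \<subseteq> Pow BX" by (auto simp: openin_boundary_topology)
    show "emeasure \<alpha> U = emeasure \<beta> U" if "U \<in> {U. bopen U}" for U
      using le[of U] ge[of U] that by (auto simp: \<alpha>.emeasure_eq_measure \<beta>.emeasure_eq_measure intro: antisym)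
  qed (auto simp: \<alpha>(2) \<beta>(2) sets_boundary_borel openin_BX)
qed

lemma pre_inv_singleton:
  assumes "isometry s" "\<zeta> \<in> BX"
  shows "pre s {\<zeta>} = {boundary_action (ginv s) \<zeta>}"
  using boundary_action_inv[OF assms(1)] boundary_action_BX[OF isometry_inv[OF assms(1)] assms(2)] by auto

text \<open>Point masses satisfy the averaging hypothesis of \<open>no_stationary_atoms\<close>,
  here with equality.\<close>

lemma stationary_diffuse:
  fixes \<mu> :: "('a \<Rightarrow> 'a) pmf"
  assumes \<nu>: "prob_space \<nu>" "sets \<nu> = sets bb"
    and stat: "\<And>U. U \<in> sets bb \<Longrightarrow> measure \<nu> U = avg \<mu> (\<lambda>s. measure \<nu> (pre s U))"
    and iso: "\<And>s. s \<in> set_pmf \<mu> \<Longrightarrow> isometry s"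
    and ne: "non_elementary x0 (generated_semigroup (set_pmf \<mu>))"
    and \<zeta>: "\<zeta> \<in> BX"
  shows "measure \<nu> {\<zeta>} = 0"
proof (rule no_stationary_atoms[OF iso ne _ _ _ \<zeta>, where a = "\<lambda>\<zeta>. measure \<nu> {\<zeta>}"])
  interpret prob_space \<nu> by (rule \<nu>)
  fix F assume F: "finite F" "F \<subseteq> BX"
  have "measure \<nu> F = (\<Sum>\<zeta>\<in>F. measure \<nu> {\<zeta>})"
    using F singleton_borel \<nu>(2) by (intro finite_measure_eq_sum_singleton) auto
  then show "(\<Sum>\<zeta>\<in>F. measure \<nu> {\<zeta>}) \<le> 1" using prob_le_1[of F] by simp
next
  fix \<zeta> assume \<zeta>: "\<zeta> \<in> BX"
  have "measure \<nu> {\<zeta>} = avg \<mu> (\<lambda>s. measure \<nu> (pre s {\<zeta>}))"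
    by (rule stat[OF singleton_borel[OF \<zeta>]])
  also have "\<dots> = avg \<mu> (\<lambda>s. measure \<nu> {boundary_action (ginv s) \<zeta>})"
  proof (rule integral_cong_AE)
    show "AE s in measure_pmf \<mu>. measure \<nu> (pre s {\<zeta>}) = measure \<nu> {boundary_action (ginv s) \<zeta>}"
      unfolding AE_measure_pmf_iff
    proof
      fix s assume s: "s \<in> set_pmf \<mu>"
      show "measure \<nu> (pre s {\<zeta>}) = measure \<nu> {boundary_action (ginv s) \<zeta>}"
        by (simp only: pre_inv_singleton[OF iso[OF s] \<zeta>])
    qed
  qed auto
  finally show "measure \<nu> {\<zeta>} \<le> avg \<mu> (\<lambda>s. measure \<nu> {boundary_action (ginv s) \<zeta>})" by simp
qed (use iso in auto)

text \<open>Points of \<open>X\<close> in \<open>approach U k\<close> are so close to \<open>U\<close> that a boundary point they converge to lies in \<open>U\<close>.\<close>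

definition approach :: "(nat \<Rightarrow> 'a) set set \<Rightarrow> nat \<Rightarrow> 'a set" where
  "approach U k = {x. \<exists>\<theta>\<in>U. \<exists>j\<le>k. (\<forall>\<eta>\<in>BX. ereal (real j) < E (Inr \<eta>) (Inr \<theta>) \<longrightarrow> \<eta> \<in> U) \<and>
     ereal (real j + 2 * C1) < E (Inl x) (Inr \<theta>)}"

lemma approach_mono: "k \<le> l \<Longrightarrow> approach U k \<subseteq> approach U l"
  unfolding approach_def by (blast intro: le_trans)

lemma eventually_approach:
  assumes "bopen U" "\<xi> \<in> U" "u \<in> \<xi>"
  shows "\<exists>k N. \<forall>n\<ge>N. u n \<in> approach U k"
proof -
  have \<xi>: "\<xi> \<in> BX" using assms by (auto simp: openin_boundary_topology)
  obtain N where N: "\<forall>\<eta>\<in>BX. ereal N < E (Inr \<eta>) (Inr \<xi>) \<longrightarrow> \<eta> \<in> U"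
    using assms unfolding openin_boundary_topology by blast
  obtain k :: nat where k: "N \<le> real k" using real_arch_simple by blast
  then have "ereal N \<le> ereal (real k)" by simp
  then have k': "\<forall>\<eta>\<in>BX. ereal (real k) < E (Inr \<eta>) (Inr \<xi>) \<longrightarrow> \<eta> \<in> U"
    using N le_less_trans by blast
  obtain K where "\<forall>n\<ge>K. ereal (real k + 2 * C1) < E (Inl (u n)) (Inr \<xi>)"
    using E_seq_tendsto[OF \<xi> assms(3)] by blast
  then have "\<forall>n\<ge>K. u n \<in> approach U k"
    unfolding approach_def using k' assms(2) by blast
  then show ?thesis by blast
qed

text \<open>The surplus \<open>2 * C1\<close> in \<open>approach\<close> pays for
  \<open>E_commute\<close> and \<open>E_tri\<close> through \<open>u n\<close>, and
  \<open>j \<le> k\<close> bounds the required closeness uniformly, so a single late visit decides.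
  With \<open>eventually_approach\<close> this describes membership of the limit by positions of the
  path.\<close>

lemma frequently_approach:
  assumes \<xi>: "\<xi> \<in> BX" "u \<in> \<xi>" and U: "U \<subseteq> BX" and freq: "\<And>N. \<exists>n\<ge>N. u n \<in> approach U k"
  shows "\<xi> \<in> U"
proof -
  obtain N where N: "\<forall>n\<ge>N. ereal (real k + 2 * C1) < E (Inl (u n)) (Inr \<xi>)"
    using E_seq_tendsto[OF \<xi>] by blast
  obtain n where n: "n \<ge> N" "u n \<in> approach U k" using freq by blast
  then obtain \<theta> j where \<theta>: "\<theta> \<in> U" "j \<le> k" "\<forall>\<eta>\<in>BX. ereal (real j) < E (Inr \<eta>) (Inr \<theta>) \<longrightarrow> \<eta> \<in> U"
    "ereal (real j + 2 * C1) < E (Inl (u n)) (Inr \<theta>)"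
    unfolding approach_def by blast
  have "ereal (real j + 2 * C1) \<le> ereal (real k + 2 * C1)" using \<theta>(2) by simp
  then have "ereal (real j + 2 * C1) < E (Inl (u n)) (Inr \<xi>)" using N n(1) le_less_trans by blast
  from E_commute[OF _ _ this] have 1: "ereal (real j + C1) < E (Inr \<xi>) (Inl (u n))"
    using \<xi>(1) by (simp add: add.commute)
  have "ereal (real j + C1) \<le> ereal (real j + 2 * C1)" using C1_ge by simp
  then have 2: "ereal (real j + C1) < E (Inl (u n)) (Inr \<theta>)" using \<theta>(4) le_less_trans by blast
  have "ereal (real j) < E (Inr \<xi>) (Inr \<theta>)"
    using E_tri[OF _ _ _ 1 2] \<xi>(1) \<theta>(1) U by auto
  then show ?thesis using \<theta>(3) \<xi>(1) by blast
qed

end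

section \<open>The hitting measure\<close>

context hyperbolic_walk
begin

abbreviation path :: "'w \<Rightarrow> nat \<Rightarrow> 'a" where "path \<omega> \<equiv> (\<lambda>n. walk n \<omega> x0)"

text \<open>Off the almost sure event an arbitrary fixed boundary point is taken, so that the limit
  is defined everywhere; \<open>BX_nonempty\<close> shows that there is one.\<close>

definition hit :: "'w \<Rightarrow> (nat \<Rightarrow> 'a) set" where
  "hit \<omega> = (if gseq (path \<omega>) then seq_class (path \<omega>) else (SOME \<xi>. \<xi> \<in> BX))"

lemma BX_nonempty: "BX \<noteq> {}"
proof -
  have "\<exists>\<omega>. gseq (path \<omega>)"
  proof (rule ccontr)
    assume "\<not> ?thesis"
    then have "AE \<omega> in M. False" using AE_gromov_sequence by simp
    then show False by simp
  qed
  then show ?thesis using seq_class(1) by blast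
qed

lemma hit_BX: "hit \<omega> \<in> BX"
  unfolding hit_def using seq_class(1) BX_nonempty by (simp add: some_in_eq)

lemma path_hit: "gseq (path \<omega>) \<Longrightarrow> path \<omega> \<in> hit \<omega>"
  unfolding hit_def by (simp add: seq_class)

lemma pred_path: "Measurable.pred M (\<lambda>\<omega>. path \<omega> n \<in> A)"
  by (rule walk_pred)

lemma pred_gromov_sequence: "Measurable.pred M (\<lambda>\<omega>. gseq (path \<omega>))"
proof -
  \<comment> \<open>Integer levels and shifted indices leave only unbounded quantifiers over natural
    numbers, hence countable operations.\<close>
  have eq: "gseq u \<longleftrightarrow> (\<forall>R::nat. \<exists>N. \<forall>m n. real R < gp (u (N + m)) (u (N + n)))" for u
  proof
    assume u: "gseq u"
    show "\<forall>R::nat. \<exists>N. \<forall>m n. real R < gp (u (N + m)) (u (N + n))"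
      using gromov_sequenceD[OF u] by (metis le_add1)
  next
    assume *: "\<forall>R::nat. \<exists>N. \<forall>m n. real R < gp (u (N + m)) (u (N + n))"
    show "gseq u"
      unfolding gromov_sequence_iff
    proof
      fix R
      obtain K :: nat where K: "R \<le> real K" using real_arch_simple by blast
      obtain N where N: "\<And>m n. real K < gp (u (N + m)) (u (N + n))" using * by blast
      have "R < gp (u m) (u n)" if "m \<ge> N" "n \<ge> N" for m n
        using N[of "m - N" "n - N"] K that by simp
      then show "\<exists>N. \<forall>m\<ge>N. \<forall>n\<ge>N. R < gp (u m) (u n)" by blast
    qed
  qed
  show ?thesis
    unfolding eq by (intro pred_intros_countable walk_pred2)
qed

text \<open>For open \<open>U\<close> the event that the limit lies in \<open>U\<close> is, on
  Gromov sequences, that the path finally stays in some \<open>approach U k\<close>: a countable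
  combination of conditions on single positions.\<close>

lemma hit_measurable: "hit \<in> M \<rightarrow>\<^sub>M bb"
proof -
  have "hit \<in> M \<rightarrow>\<^sub>M sigma BX {U. bopen U}"
  proof (rule measurable_measure_of)
    show "{U. bopen U} \<subseteq> Pow BX" by (auto simp: openin_boundary_topology)
    show "hit \<in> space M \<rightarrow> BX" using hit_BX by blast
    fix U assume "U \<in> {U. bopen U}"
    then have U: "bopen U" by simp
    then have UB: "U \<subseteq> BX" by (simp add: openin_boundary_topology)
    have iff: "hit \<omega> \<in> U \<longleftrightarrow> (\<exists>k N. \<forall>n. path \<omega> (N + n) \<in> approach U k)"
      if gs: "gseq (path \<omega>)" for \<omega>
    proof
      assume "hit \<omega> \<in> U"
      then obtain k N where "\<forall>n\<ge>N. path \<omega> n \<in> approach U k"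
        using eventually_approach[OF U _ path_hit[OF gs]] by blast
      then show "\<exists>k N. \<forall>n. path \<omega> (N + n) \<in> approach U k" by (metis le_add1)
    next
      assume "\<exists>k N. \<forall>n. path \<omega> (N + n) \<in> approach U k"
      then obtain k N where kN: "\<And>n. path \<omega> (N + n) \<in> approach U k" by blast
      have "\<exists>n\<ge>K. path \<omega> n \<in> approach U k" for K
        using kN[of K] by (intro exI[of _ "N + K"]) simp
      then show "hit \<omega> \<in> U" by (rule frequently_approach[OF hit_BX path_hit[OF gs] UB])
    qed
    have all_iff: "hit \<omega> \<in> U \<longleftrightarrow>
        (gseq (path \<omega>) \<and> (\<exists>k N. \<forall>n. path \<omega> (N + n) \<in> approach U k)) \<or>
        (\<not> gseq (path \<omega>) \<and> (SOME \<xi>. \<xi> \<in> BX) \<in> U)" for \<omega>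
    proof (cases "gseq (path \<omega>)")
      case True
      then show ?thesis using iff[OF True] by (simp only: simp_thms)
    next
      case False
      then show ?thesis by (simp only: hit_def if_False simp_thms)
    qed
    have "hit -` U \<inter> space M = {\<omega> \<in> space M. hit \<omega> \<in> U}" by blast
    also have "\<dots> = {\<omega> \<in> space M.
        (gseq (path \<omega>) \<and> (\<exists>k N. \<forall>n. path \<omega> (N + n) \<in> approach U k)) \<or>
        (\<not> gseq (path \<omega>) \<and> (SOME \<xi>. \<xi> \<in> BX) \<in> U)}"
      by (simp only: all_iff)
    finally have eq: "hit -` U \<inter> space M = \<dots>" .
    have const: "Measurable.pred M (\<lambda>\<omega>. (SOME \<xi>. \<xi> \<in> BX) \<in> U)" by simp
    have "Measurable.pred M (\<lambda>\<omega>.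
        (gseq (path \<omega>) \<and> (\<exists>k N. \<forall>n. path \<omega> (N + n) \<in> approach U k)) \<or>
        (\<not> gseq (path \<omega>) \<and> (SOME \<xi>. \<xi> \<in> BX) \<in> U))"
      by (intro pred_intros_logic pred_intros_countable pred_path pred_gromov_sequence const)
    then show "hit -` U \<inter> space M \<in> sets M" unfolding pred_def eq .
  qed
  then show ?thesis by (simp add: boundary_borel_def)
qed

section \<open>Stationarity of the hitting measure\<close>

definition hitting :: "(nat \<Rightarrow> 'a) set measure" where "hitting = distr M bb hit"

lemma prob_space_hitting: "prob_space hitting"
  unfolding hitting_def by (rule prob_space_distr[OF hit_measurable])

lemma sets_hitting: "sets hitting = sets bb"
  by (simp add: hitting_def)

lemma measure_hitting: "U \<in> sets bb \<Longrightarrow> measure hitting U = prob {\<omega> \<in> space M. hit \<omega> \<in> U}"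
  unfolding hitting_def by (subst measure_distr[OF hit_measurable]) (auto intro!: arg_cong[of _ _ prob])

lemma hit_event: "U \<in> sets bb \<Longrightarrow> {\<omega> \<in> space M. hit \<omega> \<in> U} \<in> events"
  using measurable_sets[OF hit_measurable] by (simp add: vimage_def Int_def conj_commute)

lemma iso_support: "s \<in> set_pmf \<mu> \<Longrightarrow> isometry s"
  using support iso_G by blast

text \<open>The inequality is Fatou's lemma applied to the events \<open>path (n + 1) \<in> approach U k\<close>, whose probabilities are
  also averages of those of \<open>s (path n) \<in> approach U k\<close>.\<close>

lemma hitting_le_average:
  assumes U: "bopen U"
  shows "measure hitting U \<le> avg \<mu> (\<lambda>s. measure hitting (pre s U))"
proof -
  have UB: "U \<subseteq> BX" using U by (simp add: openin_boundary_topology)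
  have Us: "U \<in> sets bb" by (rule openin_imp_borel[OF U])
  \<comment> \<open>One index serves both as the starting time and as the closeness level; this
    makes the events increase.\<close>
  define B where "B k = {\<omega> \<in> space M. \<forall>n. path \<omega> (k + n) \<in> approach U k}" for k
  have B: "B k \<in> events" for k
  proof -
    have "Measurable.pred M (\<lambda>\<omega>. \<forall>n. path \<omega> (k + n) \<in> approach U k)"
      by (intro pred_intros_countable pred_path)
    then show ?thesis unfolding B_def pred_def .
  qed
  have inc: "incseq B"
    unfolding incseq_def B_def
  proof (intro allI impI subsetI CollectI conjI)
    fix k l n :: nat and \<omega> assume kl: "k \<le> l" and \<omega>: "\<omega> \<in> {\<omega> \<in> space M. \<forall>n. path \<omega> (k + n) \<in> approach U k}"
    then have "path \<omega> (k + (l - k + n)) \<in> approach U k" by blast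
    then show "path \<omega> (l + n) \<in> approach U l" using approach_mono[OF kl] kl by auto
  qed auto
  have "measure hitting U \<le> prob (\<Union>k. B k)"
    unfolding measure_hitting[OF Us]
  proof (rule finite_measure_mono_AE)
    show "AE \<omega> in M. \<omega> \<in> {\<omega> \<in> space M. hit \<omega> \<in> U} \<longrightarrow> \<omega> \<in> (\<Union>k. B k)"
      using AE_gromov_sequence
    proof (rule AE_mp, intro AE_I2 impI)
      fix \<omega> assume gs: "gseq (path \<omega>)" and \<omega>: "\<omega> \<in> {\<omega> \<in> space M. hit \<omega> \<in> U}"
      then obtain k N where kN: "\<forall>n\<ge>N. path \<omega> n \<in> approach U k"
        using eventually_approach[OF U _ path_hit[OF gs]] by blast
      have "\<omega> \<in> B (max k N)"
        using kN \<omega> approach_mono[of k "max k N" U] by (auto simp: B_def)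
      then show "\<omega> \<in> (\<Union>k. B k)" by blast
    qed
  qed (use B in auto)
  also have "prob (\<Union>k. B k) \<le> avg \<mu> (\<lambda>s. measure hitting (pre s U))"
  proof (rule LIMSEQ_le_const2)
    show "(\<lambda>k. prob (B k)) \<longlonglongrightarrow> prob (\<Union>k. B k)"
      using B inc by (intro finite_Lim_measure_incseq) auto
    have "prob (B k) \<le> avg \<mu> (\<lambda>s. measure hitting (pre s U))" for k
    proof -
      \<comment> \<open>\<open>q n s\<close> allows a visit at any time from \<open>n\<close> on, so
        it decreases to \<open>q' s\<close>, the probability of infinitely many visits. Infinitely
        many visits already put the limit into \<open>U\<close> by
        \<open>frequently_approach\<close>.\<close>
      define q where "q n s = prob {\<omega> \<in> space M. \<exists>m. s (path \<omega> (n + m)) \<in> approach U k}" for n and s :: "'a \<Rightarrow> 'a"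
      define q' where "q' s = prob {\<omega> \<in> space M. \<forall>n. \<exists>m. s (path \<omega> (n + m)) \<in> approach U k}" for s :: "'a \<Rightarrow> 'a"
      have pred_s: "Measurable.pred M (\<lambda>\<omega>. s (path \<omega> n) \<in> approach U k)" for s n
        by (rule walk_pred)
      have ev1: "{\<omega> \<in> space M. s (path \<omega> n) \<in> approach U k} \<in> events" for s n
        using pred_s unfolding pred_def .
      have ev2: "{\<omega> \<in> space M. \<exists>m. s (path \<omega> (n + m)) \<in> approach U k} \<in> events" for s n
      proof -
        have "Measurable.pred M (\<lambda>\<omega>. \<exists>m. s (path \<omega> (n + m)) \<in> approach U k)"
          by (intro pred_intros_countable pred_s)
        then show ?thesis unfolding pred_def .
      qed
      \<comment> \<open>The position at time n + 1 is split as an increment \<open>s\<close> on the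
        left of the position at time \<open>n\<close>.\<close>
      have q_ge: "prob (B k) \<le> avg \<mu> (q n)" if "n \<ge> k" for n
      proof -
        have "path \<omega> (Suc n) \<in> approach U k" if "\<omega> \<in> B k" for \<omega>
        proof -
          have "path \<omega> (k + (Suc n - k)) \<in> approach U k" using that unfolding B_def by blast
          then show ?thesis using \<open>n \<ge> k\<close> by simp
        qed
        then have "prob (B k) \<le> prob {\<omega> \<in> space M. path \<omega> (Suc n) \<in> approach U k}"
          using ev1[of id "Suc n"] by (intro finite_measure_mono) (auto simp: B_def)
        also have "\<dots> = expectation (indicator {\<omega> \<in> space M. path \<omega> (Suc n) \<in> approach U k})"
          using ev1[of id "Suc n"] by simp
        also have "\<dots> = expectation (\<lambda>\<omega>. indicator (approach U k) (walk (Suc n) \<omega> x0))"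
          by (intro Bochner_Integration.integral_cong refl) (auto simp: indicator_def)
        also have "\<dots> = avg \<mu> (\<lambda>s. expectation (\<lambda>\<omega>. indicator (approach U k) (s (walk n \<omega> x0))))"
          by (rule walk_left_step_expectation[of _ 1]) (simp add: indicator_def)
        also have "(\<lambda>s. expectation (\<lambda>\<omega>. indicator (approach U k) (s (walk n \<omega> x0)))) =
            (\<lambda>s. prob {\<omega> \<in> space M. s (path \<omega> n) \<in> approach U k})"
        proof
          fix s
          have "expectation (\<lambda>\<omega>. indicator (approach U k) (s (walk n \<omega> x0)) :: real) =
              expectation (indicator {\<omega> \<in> space M. s (path \<omega> n) \<in> approach U k})"
            by (intro Bochner_Integration.integral_cong refl) (auto simp: indicator_def)
          then show "expectation (\<lambda>\<omega>. indicator (approach U k) (s (walk n \<omega> x0))) =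
              prob {\<omega> \<in> space M. s (path \<omega> n) \<in> approach U k}"
            using ev1[of s n] by simp
        qed
        also have "avg \<mu> (\<lambda>s. prob {\<omega> \<in> space M. s (path \<omega> n) \<in> approach U k})
            \<le> avg \<mu> (q n)"
        proof (rule integral_mono)
          show "prob {\<omega> \<in> space M. s (path \<omega> n) \<in> approach U k} \<le> q n s" for s
            unfolding q_def using ev2 by (intro finite_measure_mono) (auto intro: exI[of _ 0])
        qed (auto simp: q_def intro!: pmf_integrable_bounded[of _ _ 1])
        finally show ?thesis .
      qed
      have "(\<lambda>n. avg \<mu> (q n)) \<longlonglongrightarrow> avg \<mu> q'"
      proof (rule integral_dominated_convergence[where w = "\<lambda>_. 1"])
        have "(\<lambda>n. q n s) \<longlonglongrightarrow> q' s" for s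
        proof -
          have "(\<lambda>n. q n s) \<longlonglongrightarrow> prob (\<Inter>n. {\<omega> \<in> space M. \<exists>m. s (path \<omega> (n + m)) \<in> approach U k})"
            unfolding q_def
          proof (rule finite_Lim_measure_decseq)
            show "decseq (\<lambda>n. {\<omega> \<in> space M. \<exists>m. s (path \<omega> (n + m)) \<in> approach U k})"
              unfolding decseq_def
            proof (intro allI impI subsetI)
              fix i j :: nat and \<omega>
              assume ij: "i \<le> j" and "\<omega> \<in> {\<omega> \<in> space M. \<exists>m. s (path \<omega> (j + m)) \<in> approach U k}"
              then obtain m where "\<omega> \<in> space M" "s (path \<omega> (i + (j - i + m))) \<in> approach U k" by auto
              then show "\<omega> \<in> {\<omega> \<in> space M. \<exists>m. s (path \<omega> (i + m)) \<in> approach U k}" by blast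
            qed
          qed (use ev2 in auto)
          moreover have "(\<Inter>n. {\<omega> \<in> space M. \<exists>m. s (path \<omega> (n + m)) \<in> approach U k}) =
              {\<omega> \<in> space M. \<forall>n. \<exists>m. s (path \<omega> (n + m)) \<in> approach U k}" by auto
          ultimately show ?thesis by (simp add: q'_def)
        qed
        then show "AE s in measure_pmf \<mu>. (\<lambda>n. q n s) \<longlonglongrightarrow> q' s" by simp
        show "AE s in measure_pmf \<mu>. norm (q n s) \<le> 1" for n by (simp add: q_def)
      qed auto
      then have "prob (B k) \<le> avg \<mu> q'"
        by (rule LIMSEQ_le_const) (use q_ge in blast)
      also have "\<dots> \<le> avg \<mu> (\<lambda>s. measure hitting (pre s U))"
      proof (rule integral_mono_AE)
        show "integrable (measure_pmf \<mu>) q'" by (rule pmf_integrable_bounded[of _ _ 1]) (simp add: q'_def)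
        show "integrable (measure_pmf \<mu>) (\<lambda>s. measure hitting (pre s U))"
          by (rule pmf_integrable_bounded[of _ _ 1]) (simp add: prob_space.prob_le_1[OF prob_space_hitting])
        have "q' s \<le> measure hitting (pre s U)" if s: "s \<in> set_pmf \<mu>" for s
        proof -
          have iso_s: "isometry s" by (rule iso_support[OF s])
          have ps: "pre s U \<in> sets bb" by (rule boundary_action_vimage_borel[OF iso_s Us])
          show ?thesis
            unfolding q'_def measure_hitting[OF ps]
          proof (rule finite_measure_mono_AE)
            show "AE \<omega> in M. \<omega> \<in> {\<omega> \<in> space M. \<forall>n. \<exists>m. s (path \<omega> (n + m)) \<in> approach U k} \<longrightarrow>
                \<omega> \<in> {\<omega> \<in> space M. hit \<omega> \<in> pre s U}"
              using AE_gromov_sequence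
            proof (rule AE_mp, intro AE_I2 impI)
              fix \<omega> assume gs: "gseq (path \<omega>)"
                and \<omega>: "\<omega> \<in> {\<omega> \<in> space M. \<forall>n. \<exists>m. s (path \<omega> (n + m)) \<in> approach U k}"
              have "s \<circ> path \<omega> \<in> boundary_action s (hit \<omega>)"
                using path_hit[OF gs] by (auto simp: boundary_action_def)
              moreover have "\<exists>n\<ge>N. (s \<circ> path \<omega>) n \<in> approach U k" for N
              proof -
                obtain m where "s (path \<omega> (N + m)) \<in> approach U k" using \<omega> by blast
                then show ?thesis by (intro exI[of _ "N + m"]) simp
              qed
              ultimately have "boundary_action s (hit \<omega>) \<in> U"
                by (rule frequently_approach[OF boundary_action_BX[OF iso_s hit_BX] _ UB])
              then show "\<omega> \<in> {\<omega> \<in> space M. hit \<omega> \<in> pre s U}" using \<omega> hit_BX by simp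
            qed
          qed (rule hit_event[OF ps])
        qed
        then show "AE s in measure_pmf \<mu>. q' s \<le> measure hitting (pre s U)"
          by (simp add: AE_measure_pmf_iff)
      qed
      finally show ?thesis .
    qed
    then show "\<exists>N. \<forall>k\<ge>N. prob (B k) \<le> avg \<mu> (\<lambda>s. measure hitting (pre s U))" by blast
  qed
  finally show ?thesis .
qed

text \<open>The right side is the value at \<open>U\<close> of a probability measure \<beta>, the
  law after one more step. \<open>hitting_le_average\<close> compares the two measures on open sets,
  and \<open>boundary_measure_eqI\<close> makes them equal.\<close>

lemma hitting_stationary:
  assumes "U \<in> sets bb"
  shows "measure hitting U = avg \<mu> (\<lambda>s. measure hitting (pre s U))"
proof -
  \<comment> \<open>Outside the support the identity is substituted, so that every \<open>s\<close>
    gives a measurable action and the kernel is defined everywhere.\<close>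
  define r where "r s = (if s \<in> set_pmf \<mu> then s else id)" for s
  have ir: "isometry (r s)" for s 
    by (cases "s \<in> set_pmf \<mu>") (simp_all only: r_def if_True if_False iso_support isometry_id)
  define k where "k s = distr hitting bb (boundary_action (r s))" for s
  have meas: "boundary_action (r s) \<in> hitting \<rightarrow>\<^sub>M bb" for s
    unfolding hitting_def using boundary_action_measurable[OF ir] by simp
  have pk: "prob_space (k s)" for s
    unfolding k_def by (rule prob_space.prob_space_distr[OF prob_space_hitting meas])
  have k_meas: "k \<in> measure_pmf \<mu> \<rightarrow>\<^sub>M subprob_algebra bb"
    using pk by (auto simp: space_subprob_algebra k_def intro!: prob_space_imp_subprob_space)
  define \<beta> where "\<beta> = measure_pmf \<mu> \<bind> k"
  have \<beta>: "prob_space \<beta>"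
    unfolding \<beta>_def using pk by (intro measure_pmf.prob_space_bind[OF _ k_meas]) simp
  have sets_\<beta>: "sets \<beta> = sets bb"
    unfolding \<beta>_def by (rule sets_bind) (auto simp: k_def)
  have measure_\<beta>: "measure \<beta> V = avg \<mu> (\<lambda>s. measure hitting (pre s V))"
    if V: "V \<in> sets bb" for V
  proof -
    have "measure \<beta> V = avg \<mu> (\<lambda>s. measure (k s) V)"
      unfolding \<beta>_def by (rule measure_pmf.measure_bind[OF k_meas V])
    also have "\<dots> = avg \<mu> (\<lambda>s. measure hitting (pre s V))"
    proof (rule integral_cong_AE)
      have "measure (k s) V = measure hitting (pre s V)" if "s \<in> set_pmf \<mu>" for s
      proof -
        have "measure (k s) V = measure hitting (boundary_action (r s) -` V \<inter> space hitting)"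
          unfolding k_def by (rule measure_distr[OF meas V])
        also have "boundary_action (r s) -` V \<inter> space hitting = pre s V"
          using that by (auto simp: r_def hitting_def space_boundary_borel)
        finally show ?thesis .
      qed
      then show "AE s in measure_pmf \<mu>. measure (k s) V = measure hitting (pre s V)"
        by (simp add: AE_measure_pmf_iff)
    qed auto
    finally show ?thesis .
  qed
  have "hitting = \<beta>"
    by (rule boundary_measure_eqI[OF prob_space_hitting sets_hitting \<beta> sets_\<beta>])
      (simp add: measure_\<beta> openin_imp_borel hitting_le_average)
  then have "measure hitting U = measure \<beta> U" by simp
  then show ?thesis by (simp add: measure_\<beta>[OF assms])
qed

text \<open>Let w be a late position. Boundary points outside the shadow of the preimage of
  \<open>x0\<close> under w are sent by w close to w x0, hence close to the limit and into
  \<open>U\<close>. The shadow has fixed depth \<open>R\<close>, so its \<nu>-mass is small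
  uniformly in w.\<close>

lemma diffuse_pushed_to_hit:
  assumes \<nu>: "prob_space \<nu>" "sets \<nu> = sets bb"
    and diffuse: "\<And>\<zeta>. \<zeta> \<in> BX \<Longrightarrow> measure \<nu> {\<zeta>} = 0"
    and U: "bopen U"
    and \<omega>: "\<omega> \<in> space M" and gs: "gseq (path \<omega>)" and hit: "hit \<omega> \<in> U"
  shows "(\<lambda>n. measure \<nu> (pre (walk n \<omega>) U)) \<longlonglongrightarrow> 1"
proof (rule LIMSEQ_I)
  interpret n: prob_space \<nu> by (rule \<nu>)
  have sp: "space \<nu> = BX" using sets_eq_imp_space_eq[OF \<nu>(2)] by (simp add: space_boundary_borel)
  fix \<epsilon> :: real assume \<epsilon>: "0 < \<epsilon>"
  then have \<epsilon>2: "\<epsilon> / 2 > 0" by simp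
  have "\<exists>R. \<forall>z. \<forall>S\<in>sets bb. S \<subseteq> {\<eta>. ereal R < E (Inl z) (Inr \<eta>)} \<longrightarrow> measure \<nu> S \<le> \<epsilon> / 2"
    by (rule boundary_measure_shadow[OF \<nu> diffuse \<epsilon>2])
  then obtain R where R: "\<forall>z. \<forall>S\<in>sets bb. S \<subseteq> {\<eta>. ereal R < E (Inl z) (Inr \<eta>)} \<longrightarrow> measure \<nu> S \<le> \<epsilon> / 2"
    by (elim exE)
  obtain T where T: "\<forall>\<eta>\<in>BX. ereal T < E (Inr \<eta>) (Inr (hit \<omega>)) \<longrightarrow> \<eta> \<in> U"
    using U hit unfolding openin_boundary_topology by blast
  obtain N1 where N1: "\<forall>n\<ge>N1. ereal (T + C1) < E (Inl (path \<omega> n)) (Inr (hit \<omega>))"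
    using E_seq_tendsto[OF hit_BX path_hit[OF gs]] by blast
  \<comment> \<open>The loss \<open>C1\<close> occurs three times: in \<open>E_act_flip\<close>, in
    \<open>E_commute\<close> and in \<open>E_tri\<close>.\<close>
  obtain N2 where N2: "\<forall>m\<ge>N2. \<forall>n\<ge>N2. T + R + 3 * C1 < gp (path \<omega> m) (path \<omega> n)"
    using gromov_sequenceD[OF gs] by blast
  have "norm (measure \<nu> (pre (walk n \<omega>) U) - 1) < \<epsilon>" if n: "n \<ge> max N1 N2" for n
  proof -
    define w where "w = walk n \<omega>"
    have iw: "isometry w" unfolding w_def by (rule iso_G[OF walk_in_G[OF \<omega>]])
    have far: "T + R + 3 * C1 < dist x0 (w x0)"
      using N2 n gromov_product_le_dist[of x0 "w x0" "w x0"] unfolding w_def by (smt (verit) max.bounded_iff)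
    have close: "ereal (T + C1) < E (Inl (w x0)) (Inr (hit \<omega>))" using N1 n by (simp add: w_def)
    have pre_s: "pre w U \<in> sets bb" by (rule boundary_action_vimage_borel[OF iw openin_imp_borel[OF U]])
    have "BX - pre w U \<subseteq> {\<eta>. ereal R < E (Inl (ginv w x0)) (Inr \<eta>)}"
    proof (rule subsetI, rule ccontr)
      fix \<eta> assume \<eta>: "\<eta> \<in> BX - pre w U" and "\<eta> \<notin> {\<eta>. ereal R < E (Inl (ginv w x0)) (Inr \<eta>)}"
      then have "ereal (dist x0 (w x0) - R - C1) < E (Inl (w x0)) (Inr (boundary_action w \<eta>))"
        by (intro E_act_flip[OF iw]) auto
      moreover have "ereal (T + 2 * C1) \<le> ereal (dist x0 (w x0) - R - C1)" using far by simp
      ultimately have 0: "ereal (T + 2 * C1) < E (Inl (w x0)) (Inr (boundary_action w \<eta>))"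
        using le_less_trans by blast
      have B: "boundary_action w \<eta> \<in> BX" using boundary_action_BX[OF iw] \<eta> by blast
      have 1: "ereal (T + C1) < E (Inr (boundary_action w \<eta>)) (Inl (w x0))"
        using E_commute[OF _ _ 0] B by (simp add: add.commute)
      have "ereal T < E (Inr (boundary_action w \<eta>)) (Inr (hit \<omega>))"
        using E_tri[OF _ _ _ 1 close] B hit_BX by simp
      then have "boundary_action w \<eta> \<in> U" using T B by blast
      then show False using \<eta> by blast
    qed
    moreover have "BX - pre w U \<in> sets bb" by (intro sets.Diff openin_imp_borel openin_BX pre_s)
    ultimately have "measure \<nu> (BX - pre w U) \<le> \<epsilon> / 2" using R by blast
    moreover have "measure \<nu> (BX - pre w U) = 1 - measure \<nu> (pre w U)"
      using n.prob_compl[of "pre w U"] pre_s \<nu>(2) by (simp add: sp)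
    ultimately show ?thesis using \<epsilon> n.prob_le_1[of "pre w U"] by (simp add: w_def)
  qed
  then show "\<exists>no. \<forall>n\<ge>no. norm (measure \<nu> (pre (walk n \<omega>) U) - 1) < \<epsilon>" by blast
qed

text \<open>The \<nu>-mass of the preimage of \<open>U\<close> under the walk has constant mean
  \<open>measure \<nu> U\<close> and tends to 1 where the limit lies in \<open>U\<close>. Discarding
  the rest bounds the hitting probability of \<open>U\<close> by its \<nu>-mass, and an inequality
  on open sets is enough.\<close>

lemma stationary_unique:
  assumes \<nu>: "prob_space \<nu>" "sets \<nu> = sets bb"
    and stat: "\<And>U. U \<in> sets bb \<Longrightarrow> measure \<nu> U = avg \<mu> (\<lambda>s. measure \<nu> (pre s U))"
  shows "\<nu> = hitting"
proof -
  interpret \<nu>: prob_space \<nu> by (rule \<nu>)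
  have diffuse: "measure \<nu> {\<zeta>} = 0" if "\<zeta> \<in> BX" for \<zeta>
    by (rule stationary_diffuse[OF \<nu> stat iso_support non_elem that])
  have "measure hitting U \<le> measure \<nu> U" if U: "bopen U" for U
  proof -
    have UB: "U \<subseteq> BX" using U by (simp add: openin_boundary_topology)
    have Us: "U \<in> sets bb" by (rule openin_imp_borel[OF U])
    define \<phi> where "\<phi> g = measure \<nu> (pre g U)" for g
    have \<phi>1: "\<bar>\<phi> g\<bar> \<le> 1" for g by (simp add: \<phi>_def)
    have mart: "expectation (\<lambda>\<omega>. \<phi> (walk n \<omega>)) = measure \<nu> U" for n
    proof (induction n)
      case 0
      have "pre id U = U" using UB by (auto simp: boundary_action_id[unfolded id_def] id_def)
      then show ?case by (simp add: \<phi>_def prob_space del: id_apply)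
    next
      case (Suc n)
      have "expectation (\<lambda>\<omega>. \<phi> (walk (Suc n) \<omega>)) =
          expectation (\<lambda>\<omega>. avg \<mu> (\<lambda>s. \<phi> (walk n \<omega> \<circ> s)))"
        by (rule walk_step_expectation(1)[of \<phi> 1]) (rule \<phi>1)
      also have "\<dots> = expectation (\<lambda>\<omega>. \<phi> (walk n \<omega>))"
      proof (rule Bochner_Integration.integral_cong[OF refl])
        fix \<omega> assume "\<omega> \<in> space M"
        then have iw: "isometry (walk n \<omega>)" by (intro iso_G walk_in_G)
        have "avg \<mu> (\<lambda>s. \<phi> (walk n \<omega> \<circ> s)) =
            avg \<mu> (\<lambda>s. measure \<nu> (pre s (pre (walk n \<omega>) U)))"
        proof (rule integral_cong_AE)
          show "AE s in measure_pmf \<mu>. \<phi> (walk n \<omega> \<circ> s) = measure \<nu> (pre s (pre (walk n \<omega>) U))"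
            unfolding AE_measure_pmf_iff
          proof
            fix s assume s: "s \<in> set_pmf \<mu>"
            have "pre (walk n \<omega> \<circ> s) U = pre s (pre (walk n \<omega>) U)"
              using boundary_action_BX[OF iso_support[OF s]] unfolding boundary_action_comp by blast
            then show "\<phi> (walk n \<omega> \<circ> s) = measure \<nu> (pre s (pre (walk n \<omega>) U))"
              by (simp only: \<phi>_def)
          qed
        qed auto
        also have "\<dots> = \<phi> (walk n \<omega>)"
          unfolding \<phi>_def by (rule stat[symmetric]) (rule boundary_action_vimage_borel[OF iw Us])
        finally show "avg \<mu> (\<lambda>s. \<phi> (walk n \<omega> \<circ> s)) = \<phi> (walk n \<omega>)" .
      qed
      finally show ?case unfolding Suc.IH .
    qed
    define A where "A = {\<omega> \<in> space M. hit \<omega> \<in> U}"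
    have A: "A \<in> events" unfolding A_def by (rule hit_event[OF Us])
    have \<phi>_meas: "(\<lambda>\<omega>. \<phi> (walk n \<omega>)) \<in> borel_measurable M" for n by (rule walk_measurable_borel)
    have "(\<lambda>n. expectation (\<lambda>\<omega>. indicator A \<omega> * \<phi> (walk n \<omega>))) \<longlonglongrightarrow> expectation (indicator A)"
    proof (rule integral_dominated_convergence[where w = "\<lambda>_. 1"])
      show "AE \<omega> in M. (\<lambda>n. indicator A \<omega> * \<phi> (walk n \<omega>)) \<longlonglongrightarrow> indicator A \<omega>"
        using AE_gromov_sequence
      proof (rule AE_mp, intro AE_I2 impI)
        fix \<omega> assume \<omega>: "\<omega> \<in> space M" and gs: "gseq (path \<omega>)"
        show "(\<lambda>n. indicator A \<omega> * \<phi> (walk n \<omega>)) \<longlonglongrightarrow> indicator A \<omega>"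
        proof (cases "\<omega> \<in> A")
          case True
          then have "hit \<omega> \<in> U" by (simp add: A_def)
          then show ?thesis
            using diffuse_pushed_to_hit[OF \<nu> diffuse U \<omega> gs] True by (simp add: \<phi>_def)
        qed simp
      qed
      show "AE \<omega> in M. norm (indicator A \<omega> * \<phi> (walk n \<omega>)) \<le> 1" for n
        using \<phi>1 by (intro AE_I2) (simp add: indicator_def)
    qed (use A \<phi>_meas in auto)
    moreover have "expectation (\<lambda>\<omega>. indicator A \<omega> * \<phi> (walk n \<omega>)) \<le> measure \<nu> U" for n
    proof -
      have "expectation (\<lambda>\<omega>. indicator A \<omega> * \<phi> (walk n \<omega>)) \<le> expectation (\<lambda>\<omega>. \<phi> (walk n \<omega>))"
      proof (rule integral_mono)
        show "integrable M (\<lambda>\<omega>. indicator A \<omega> * \<phi> (walk n \<omega>))"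
          by (rule integrable_const_bound[of _ 1]) (use \<phi>1 A \<phi>_meas in \<open>auto simp: indicator_def\<close>)
        show "integrable M (\<lambda>\<omega>. \<phi> (walk n \<omega>))" by (rule integrable_walk[OF \<phi>1])
        show "indicator A \<omega> * \<phi> (walk n \<omega>) \<le> \<phi> (walk n \<omega>)" for \<omega>
          by (simp add: indicator_def \<phi>_def)
      qed
      then show ?thesis using mart by simp
    qed
    ultimately have "expectation (indicator A) \<le> measure \<nu> U"
      by (intro LIMSEQ_le_const2) auto
    then show ?thesis using A by (simp add: measure_hitting[OF Us] A_def)
  qed
  then show ?thesis
    by (intro boundary_measure_eqI[OF prob_space_hitting sets_hitting \<nu>, symmetric])
qed

end

theorem theorem1p1:
  fixes G :: "('a::metric_space \<Rightarrow> 'a) set"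
    and \<mu> :: "('a \<Rightarrow> 'a) pmf"
    and x0 :: 'a
    and M :: "'w measure"
    and g :: "nat \<Rightarrow> 'w \<Rightarrow> 'a \<Rightarrow> 'a"
  assumes "gromov_hyperbolic TYPE('a)"
    and "separable_space (euclidean :: 'a topology)"
    and "subgroup G isometry_group"
    and "countable G"
    and "set_pmf \<mu> \<subseteq> G"
    and "non_elementary_distribution x0 G \<mu>"
    and "prob_space M"
    and "prob_space.indep_vars M (\<lambda>_. count_space UNIV) g {1..}"
    and "\<And>i. i \<ge> 1 \<Longrightarrow> distr M (count_space UNIV) (g i) = measure_pmf \<mu>"
  shows "\<exists>\<xi> \<in> M \<rightarrow>\<^sub>M boundary_borel x0.
    (AE s in M. limitin (bordification_topology x0)
       (\<lambda>n. Inl (random_walk g n s x0)) (Inr (\<xi> s)) sequentially) \<and>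
    (let \<nu> = distr M (boundary_borel x0) \<xi> in
       non_atomic \<nu> \<and>
       borel_probability_on_boundary x0 \<nu> \<and> stationary x0 G \<mu> \<nu> \<and>
       (\<forall>\<nu>'. borel_probability_on_boundary x0 \<nu>' \<and> stationary x0 G \<mu> \<nu>' \<longrightarrow> \<nu>' = \<nu>))"
proof -
  obtain \<delta> where \<delta>: "\<delta> \<ge> 0"
    "\<And>w x y z :: 'a. min (gromov_product w x y) (gromov_product w y z) - \<delta> \<le> gromov_product w x z"
    using gromov_hyperbolic_four_point[OF assms(1)] by blast
  have G_iso: "isometry s" if "s \<in> G" for s
    using subgroup.subset[OF assms(3)] that by (auto simp: isometry_group_def)
  have G_id: "id \<in> G"
    using subgroup.one_closed[OF assms(3)] by (simp add: isometry_group_def del: id_apply)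
  have G_comp: "a \<circ> b \<in> G" if "a \<in> G" "b \<in> G" for a b
    using subgroup.m_closed[OF assms(3) that] by (simp add: isometry_group_def)
  \<comment> \<open>Increments outside \<open>G\<close> are replaced by the identity. This alters
    the walk on a null set only and gives increments with values in \<open>G\<close>
    everywhere.\<close>
  define r where "r s = (if s \<in> G then s else id)" for s
  have r_meas: "r \<in> count_space UNIV \<rightarrow>\<^sub>M count_space G"
    using G_id by (auto simp: r_def)
  define X where "X i \<omega> = r (g i \<omega>)" for i \<omega>
  interpret prob_space M by (rule assms(7))
  have g_meas: "g i \<in> M \<rightarrow>\<^sub>M count_space UNIV" if "i \<ge> 1" for i
    using assms(8) that by (simp add: indep_vars_def)
  interpret hyperbolic_walk x0 \<delta> M \<mu> G X
  proof
    show "indep_vars (\<lambda>_. count_space G) X {1..}"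
      unfolding X_def by (rule indep_vars_compose2[OF assms(8)]) (rule r_meas)
    fix i :: nat assume i: "i \<ge> 1"
    have "distr M (count_space G) (X i) = distr (distr M (count_space UNIV) (g i)) (count_space G) r"
      unfolding X_def by (subst distr_distr[OF r_meas g_meas[OF i]]) (simp add: comp_def)
    also have "\<dots> = distr (measure_pmf \<mu>) (count_space G) r" by (simp only: assms(9)[OF i])
    finally show "distr M (count_space G) (X i) =
        distr (measure_pmf \<mu>) (count_space G) (\<lambda>s. if s \<in> G then s else id)"
      by (simp add: r_def[abs_def])
  next
    show "non_elementary x0 (generated_semigroup (set_pmf \<mu>))"
      using assms(6) by (simp add: non_elementary_distribution_def)
  qed (use \<delta> G_id G_comp G_iso assms(4,5) in auto)
  have AE_G: "AE \<omega> in M. \<forall>i\<ge>1. g i \<omega> \<in> G"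
  proof -
    have "AE \<omega> in M. i \<ge> 1 \<longrightarrow> g i \<omega> \<in> G" for i :: nat
    proof (cases "i \<ge> 1")
      case True
      have "AE s in distr M (count_space UNIV) (g i). s \<in> G"
        unfolding assms(9)[OF True] using assms(5) by (auto simp: AE_measure_pmf_iff)
      then show ?thesis using AE_distrD[OF g_meas[OF True]] by force
    qed simp
    then show ?thesis by (simp add: AE_all_countable)
  qed
  have walk_eq: "random_walk g n \<omega> = walk n \<omega>" if "\<forall>i\<ge>1. g i \<omega> \<in> G" for n \<omega>
    using that by (induction n) (auto simp: X_def r_def)
  have conv: "AE s in M. limitin (bordification_topology x0)
      (\<lambda>n. Inl (random_walk g n s x0)) (Inr (hit s)) sequentially"
    using AE_G AE_gromov_sequence
  proof eventually_elim
    case (elim s)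
    then show ?case using limitin_bordification[OF hit_BX path_hit[of s]] by (simp only: walk_eq)
  qed
  \<comment> \<open>Turns the infinite sum over \<open>G\<close> into an expectation, for the
    hitting measure as well as for a competitor.\<close>
  have stat_iff: "stationary x0 G \<mu> \<nu> \<longleftrightarrow>
      (\<forall>U\<in>sets bb. measure \<nu> U = avg \<mu> (\<lambda>s. measure \<nu> (pre s U)))"
    if "prob_space \<nu>" for \<nu>
  proof -
    have "(\<Sum>\<^sub>\<infinity>s\<in>G. pmf \<mu> s * measure \<nu> (pre s U)) = avg \<mu> (\<lambda>s. measure \<nu> (pre s U))" for U
      by (rule infsum_pmf_eq_expectation[OF assms(5), of _ 1]) (simp add: prob_space.prob_le_1[OF that])
    then show ?thesis unfolding stationary_def by simp
  qed
  have "non_atomic hitting"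
    unfolding non_atomic_def
  proof
    fix \<zeta> assume "\<zeta> \<in> space hitting"
    then have \<zeta>: "\<zeta> \<in> BX" by (simp add: hitting_def space_boundary_borel)
    interpret h: prob_space hitting by (rule prob_space_hitting)
    have "measure hitting {\<zeta>} = 0"
      by (rule stationary_diffuse[OF prob_space_hitting sets_hitting hitting_stationary iso_support non_elem \<zeta>])
    then show "{\<zeta>} \<in> null_sets hitting"
      using singleton_borel[OF \<zeta>] by (auto simp: null_sets_def h.emeasure_eq_measure sets_hitting)
  qed
  moreover have "borel_probability_on_boundary x0 hitting"
    by (simp add: borel_probability_on_boundary_def prob_space_hitting sets_hitting)
  moreover have "stationary x0 G \<mu> hitting"
    using hitting_stationary by (simp add: stat_iff[OF prob_space_hitting])
  moreover have "\<nu>' = hitting" if "borel_probability_on_boundary x0 \<nu>'" "stationary x0 G \<mu> \<nu>'" for \<nu>'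
  proof -
    have \<nu>': "prob_space \<nu>'" "sets \<nu>' = sets bb"
      using that(1) by (simp_all add: borel_probability_on_boundary_def)
    show ?thesis using that(2) by (intro stationary_unique[OF \<nu>']) (simp add: stat_iff[OF \<nu>'(1)])
  qed
  ultimately show ?thesis
    using conv hit_measurable unfolding Let_def hitting_def by blast
qed

end
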